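(* Let $V$ be a 6-dimensional real vector space and let $\mathcal N$ be the tensor field of type $(1,1)$ on the submanifold $U_0\subset\Lambda^3V^*$ given by $\mathcal N(\zeta)=D_{F(\zeta)}|_{T_\zeta U_0}$. On $U_0$ there is the following chain of distributions: $$\operatorname{im}\mathcal N^2\subset\ker\mathcal N\subset\operatorname{im}\mathcal N\subset\ker\mathcal N^2,$$ where $\operatorname{im}\mathcal N^2=\mathcal D_1$ and $\operatorname{im}\mathcal N=\mathcal D_2$. The distributions $\operatorname{im}\mathcal N^2$, $\ker\mathcal N$ and $\operatorname{im}\mathcal N$ are integrable. The distribution $\ker\mathcal N^2$ is not integrable.
   Context: $V$ is a 6-dimensional real vector space. $U_0\subset\Lambda^3V^*$ is the $GL(V)$-orbit, under pullback, of $\omega_0=\alpha_1\wedge\alpha_4\wedge\alpha_5+\alpha_2\wedge\alpha_4\wedge\alpha_6+\alpha_3\wedge\alpha_5\wedge\alpha_6$, where $\alpha_1,\dots,\alpha_6$ is a basis of $V^*$; it is a submanifold of codimension 1 in $\Lambda^3V^*$, and $T_\zeta U_0$ is regarded as a subspace of $\Lambda^3V^*$. For $\zeta\in U_0$ let $V_0(\zeta)=\{v\in V;\ (\iota_v\zeta)\wedge(\iota_v\zeta)=0\}$, which is a 3-dimensional subspace of $V$. For $i=1,2$ put $$\mathcal D_i(\zeta)=\{\Omega\in T_\zeta U_0;\ \Omega(v_1,v_2,v_3)=0\text{ whenever }v_1,\dots,v_i\in V_0(\zeta)\};$$ these define distributions $\mathcal D_1\subset\mathcal D_2\subset TU_0$.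 Fix a nonzero $\theta_0\in\Lambda^6V^*$; for $\zeta\in U_0$ let $F(\zeta):V\to V$ be the endomorphism determined by $(\iota_v\zeta)\wedge\zeta=\iota_{F(\zeta)v}\theta_0$ for all $v\in V$ (it satisfies $F(\zeta)^2=0$ and $\operatorname{im}F(\zeta)=\ker F(\zeta)=V_0(\zeta)$). For $\Omega\in\Lambda^3V^*$ put $(D_{F(\zeta)}\Omega)(v_1,v_2,v_3)=\Omega(F(\zeta)v_1,v_2,v_3)+\Omega(v_1,F(\zeta)v_2,v_3)+\Omega(v_1,v_2,F(\zeta)v_3)$. The map $D_{F(\zeta)}$ preserves $T_\zeta U_0$, so $\mathcal N(\zeta)$ is an endomorphism of $T_\zeta U_0$. Integrable is meant in the sense of Frobenius (equivalently, closed under Lie brackets of vector fields). *)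

theory Defs
  imports "HOL-Analysis.Analysis" "HOL-Combinatorics.Permutations"
begin

section \<open>Exterior algebra\<close>

text \<open>A form of degree \<open>k\<close> on the vector space \<open>'v\<close> is a function of a sequence
  of vectors that depends on the entries \<open>0, \<dots>, k - 1\<close> only. With this encoding two
  \<open>k\<close>-forms are equal as forms iff they are equal as functions.\<close>

type_synonym 'v form = "(nat \<Rightarrow> 'v) \<Rightarrow> real"

definition ext_power :: "nat \<Rightarrow> 'v::real_vector form set" where
  "ext_power k = {\<omega>.
     (\<forall>u v. (\<forall>i<k. u i = v i) \<longrightarrow> \<omega> u = \<omega> v) \<and>
     (\<forall>u. \<forall>i<k. linear (\<lambda>x. \<omega> (u(i := x)))) \<and>
     (\<forall>u. \<forall>i<k. \<forall>j<k. i \<noteq> j \<and> u i = u j \<longrightarrow> \<omega> u = 0)}"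

text \<open>The degrees \<open>k\<close>, \<open>l\<close> of the factors are explicit arguments.\<close>

definition wedge :: "nat \<Rightarrow> nat \<Rightarrow> 'v form \<Rightarrow> 'v form \<Rightarrow> 'v form" where
  "wedge k l \<omega> \<eta> = (\<lambda>u.
     (\<Sum>p | p permutes {..<k + l}.
        of_int (sign p) * \<omega> (\<lambda>i. u (p i)) * \<eta> (\<lambda>i. u (p (k + i)))) / (fact k * fact l))"

definition interior_prod :: "'v \<Rightarrow> 'v form \<Rightarrow> 'v form" where
  "interior_prod v \<omega> = (\<lambda>u. \<omega> (case_nat v u))"

definition pullback :: "('v \<Rightarrow> 'v) \<Rightarrow> 'v form \<Rightarrow> 'v form" where
  "pullback g \<omega> = (\<lambda>u. \<omega> (\<lambda>i. g (u i)))"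

definition covector_form :: "('v::real_normed_vector \<Rightarrow>\<^sub>L real) \<Rightarrow> 'v form" where
  "covector_form \<alpha> = (\<lambda>u. \<alpha> (u 0))"

text \<open>To do calculus, 3-forms are also represented as elements of the finite-dimensional normed
  space of all trilinear forms; \<open>\<Lambda>\<^sup>3V\<^sup>*\<close> is a linear subspace of it, and the manifolds
  considered below are contained in that subspace.\<close>

type_synonym 'v trilin = "'v \<Rightarrow>\<^sub>L 'v \<Rightarrow>\<^sub>L 'v \<Rightarrow>\<^sub>L real"

definition form_of :: "'v::real_normed_vector trilin \<Rightarrow> 'v form" where
  "form_of \<Omega> = (\<lambda>u. \<Omega> (u 0) (u 1) (u 2))"

definition trilin_of ::
  "('v::real_normed_vector \<Rightarrow> 'v \<Rightarrow> 'v \<Rightarrow> real) \<Rightarrow> 'v trilin" where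
  "trilin_of B = Blinfun (\<lambda>x. Blinfun (\<lambda>y. Blinfun (\<lambda>z. B x y z)))"

lemma trilin_of_apply:
  fixes B :: "'v::euclidean_space \<Rightarrow> 'v \<Rightarrow> 'v \<Rightarrow> real"
  assumes "\<And>y z. linear (\<lambda>x. B x y z)" "\<And>x z. linear (\<lambda>y. B x y z)" "\<And>x y. linear (B x y)"
  shows "trilin_of B x y z = B x y z"
proof -
  have 3: "blinfun_apply (Blinfun (B x y)) = B x y" for x y
    using assms(3) by (simp add: bounded_linear_Blinfun_apply linear_conv_bounded_linear)
  have "linear (\<lambda>y. Blinfun (B x y))" for x
    using assms(2)[of x]
    by (intro linearI blinfun_eqI)
       (simp_all add: 3 linear_iff plus_blinfun.rep_eq scaleR_blinfun.rep_eq)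
  then have 2: "blinfun_apply (Blinfun (\<lambda>y. Blinfun (B x y))) = (\<lambda>y. Blinfun (B x y))" for x
    by (simp add: bounded_linear_Blinfun_apply linear_conv_bounded_linear)
  have "linear (\<lambda>x. Blinfun (\<lambda>y. Blinfun (B x y)))"
    using assms(1)
    by (intro linearI blinfun_eqI)
       (simp_all add: 2 3 linear_iff plus_blinfun.rep_eq scaleR_blinfun.rep_eq)
  then show ?thesis
    by (simp add: trilin_of_def bounded_linear_Blinfun_apply linear_conv_bounded_linear 2 3)
qed


section \<open>Distributions on submanifolds of a normed space\<close>

text \<open>On open subsets of finite-dimensional spaces the following is the usual \<open>C\<^sup>n\<close>
  condition: all directional derivatives are \<open>n\<close> times continuously differentiable.\<close>

fun C_diff_on :: "nat \<Rightarrow> 'a::real_normed_vector set \<Rightarrow> ('a \<Rightarrow> 'b::real_normed_vector) \<Rightarrow> bool" where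
  "C_diff_on 0 S f \<longleftrightarrow> continuous_on S f"
| "C_diff_on (Suc n) S f \<longleftrightarrow> (\<forall>x\<in>S. f differentiable (at x)) \<and>
     (\<forall>v. C_diff_on n S (\<lambda>x. frechet_derivative f (at x) v))"

definition smooth_on :: "'a::real_normed_vector set \<Rightarrow> ('a \<Rightarrow> 'b::real_normed_vector) \<Rightarrow> bool" where
  "smooth_on S f \<longleftrightarrow> (\<forall>n. C_diff_on n S f)"

text \<open>The tangent space of a submanifold \<open>M\<close>, as the set of velocities of smooth curves in \<open>M\<close>.\<close>

definition tangent_space :: "'a::real_normed_vector set \<Rightarrow> 'a \<Rightarrow> 'a set" where
  "tangent_space M p = {w. \<exists>\<gamma> e. e > 0 \<and> smooth_on {-e<..<e} \<gamma> \<and>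
     (\<forall>t\<in>{-e<..<e}. \<gamma> t \<in> M) \<and> \<gamma> 0 = p \<and> (\<gamma> has_vector_derivative w) (at 0)}"

text \<open>Smooth vector fields on a relatively open subset of a submanifold \<open>M\<close> are represented by
  smooth maps \<open>X\<close> on open sets \<open>W\<close> of the ambient space with \<open>X p\<close> tangent to \<open>M\<close> at every
  \<open>p \<in> W \<inter> M\<close>; locally every smooth vector field on \<open>M\<close> has such an extension. A distribution of
  rank \<open>r\<close> is a field of tangent subspaces with local smooth frames \<open>X\<^sub>0, \<dots>, X\<^sub>r\<^sub>-\<^sub>1\<close>.\<close>

definition smooth_distribution ::
  "'a::real_normed_vector set \<Rightarrow> ('a \<Rightarrow> 'a set) \<Rightarrow> bool" where
  "smooth_distribution M D \<longleftrightarrow> (\<forall>p\<in>M. D p \<subseteq> tangent_space M p) \<and>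
     (\<exists>r::nat. \<forall>p\<in>M. \<exists>W X. open W \<and> p \<in> W \<and> (\<forall>i<r. smooth_on W (X i)) \<and>
        (\<forall>q\<in>W \<inter> M. inj_on (\<lambda>i. X i q) {..<r} \<and>
           independent ((\<lambda>i. X i q) ` {..<r}) \<and>
           D q = span ((\<lambda>i. X i q) ` {..<r})))"

text \<open>For fields tangent to \<open>M\<close> the value of the bracket at a point of \<open>M\<close> does not depend on the
  extensions: \<open>X\<close> is differentiated only in the direction \<open>Y p\<close>, which is tangent to \<open>M\<close>,
  and conversely.\<close>

definition lie_bracket ::
  "('a::real_normed_vector \<Rightarrow> 'a) \<Rightarrow> ('a \<Rightarrow> 'a) \<Rightarrow> 'a \<Rightarrow> 'a" where
  "lie_bracket X Y p = frechet_derivative Y (at p) (X p) - frechet_derivative X (at p) (Y p)"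

definition frobenius_integrable ::
  "'a::real_normed_vector set \<Rightarrow> ('a \<Rightarrow> 'a set) \<Rightarrow> bool" where
  "frobenius_integrable M D \<longleftrightarrow> (\<forall>W X Y. open W \<and> smooth_on W X \<and> smooth_on W Y \<and>
     (\<forall>p\<in>W \<inter> M. X p \<in> D p \<and> Y p \<in> D p) \<longrightarrow> (\<forall>p\<in>W \<inter> M. lie_bracket X Y p \<in> D p))"


section \<open>The orbit and its nilpotent tensor field\<close>

definition dual_basis6 :: "(nat \<Rightarrow> 'v::euclidean_space \<Rightarrow>\<^sub>L real) \<Rightarrow> bool" where
  "dual_basis6 \<alpha> \<longleftrightarrow> inj_on \<alpha> {1..6} \<and> independent (\<alpha> ` {1..6}) \<and> span (\<alpha> ` {1..6}) = UNIV"

definition omega0 :: "(nat \<Rightarrow> 'v::euclidean_space \<Rightarrow>\<^sub>L real) \<Rightarrow> 'v form" where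
  "omega0 \<alpha> = (let a = (\<lambda>i. covector_form (\<alpha> i)) in (\<lambda>u.
      wedge 1 2 (a 1) (wedge 1 1 (a 4) (a 5)) u
    + wedge 1 2 (a 2) (wedge 1 1 (a 4) (a 6)) u
    + wedge 1 2 (a 3) (wedge 1 1 (a 5) (a 6)) u))"

definition U0 :: "(nat \<Rightarrow> 'v::euclidean_space \<Rightarrow>\<^sub>L real) \<Rightarrow> 'v trilin set" where
  "U0 \<alpha> = {\<zeta>. \<exists>g. linear g \<and> bij g \<and> form_of \<zeta> = pullback g (omega0 \<alpha>)}"

definition V0 :: "'v::euclidean_space trilin \<Rightarrow> 'v set" where
  "V0 \<zeta> = {v. wedge 2 2 (interior_prod v (form_of \<zeta>)) (interior_prod v (form_of \<zeta>)) = (\<lambda>_. 0)}"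

definition distr_D ::
  "(nat \<Rightarrow> 'v::euclidean_space \<Rightarrow>\<^sub>L real) \<Rightarrow> nat \<Rightarrow> 'v trilin \<Rightarrow> 'v trilin set" where
  "distr_D \<alpha> i \<zeta> = {\<Omega> \<in> tangent_space (U0 \<alpha>) \<zeta>.
     \<forall>u. (\<forall>j<i. u j \<in> V0 \<zeta>) \<longrightarrow> form_of \<Omega> u = 0}"

definition endo_F :: "'v::euclidean_space form \<Rightarrow> 'v trilin \<Rightarrow> 'v \<Rightarrow> 'v" where
  "endo_F \<theta> \<zeta> = (THE f. linear f \<and>
     (\<forall>v. wedge 2 3 (interior_prod v (form_of \<zeta>)) (form_of \<zeta>) = interior_prod (f v) \<theta>))"

definition derivation :: "('v::euclidean_space \<Rightarrow> 'v) \<Rightarrow> 'v trilin \<Rightarrow> 'v trilin" where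
  "derivation f \<Omega> = trilin_of (\<lambda>x y z. \<Omega> (f x) y z + \<Omega> x (f y) z + \<Omega> x y (f z))"

definition tensor_N :: "'v::euclidean_space form \<Rightarrow> 'v trilin \<Rightarrow> 'v trilin \<Rightarrow> 'v trilin" where
  "tensor_N \<theta> \<zeta> = derivation (endo_F \<theta> \<zeta>)"

text \<open>Image and kernel of the \<open>k\<close>-th power of \<open>tensor_N\<close>, restricted to the tangent spaces of the
  orbit.\<close>

definition im_N ::
  "(nat \<Rightarrow> 'v::euclidean_space \<Rightarrow>\<^sub>L real) \<Rightarrow> 'v form \<Rightarrow> nat \<Rightarrow> 'v trilin \<Rightarrow> 'v trilin set" where
  "im_N \<alpha> \<theta> k \<zeta> = (tensor_N \<theta> \<zeta> ^^ k) ` tangent_space (U0 \<alpha>) \<zeta>"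

definition ker_N ::
  "(nat \<Rightarrow> 'v::euclidean_space \<Rightarrow>\<^sub>L real) \<Rightarrow> 'v form \<Rightarrow> nat \<Rightarrow> 'v trilin \<Rightarrow> 'v trilin set" where
  "ker_N \<alpha> \<theta> k \<zeta> = {\<Omega> \<in> tangent_space (U0 \<alpha>) \<zeta>. (tensor_N \<theta> \<zeta> ^^ k) \<Omega> = 0}"

end

theory Submission
  imports Defs
begin

text \<open>At \<open>\<zeta>\<close> in the orbit choose an adapted basis \<open>b1, \<dots>, b6\<close>, in which \<open>\<zeta>\<close> is the normal form.
  Then \<open>V0 \<zeta>\<close> is spanned by \<open>b1, b2, b3\<close>, and \<open>F \<zeta>\<close> maps \<open>b4, b5, b6\<close> to multiples of
  \<open>b3, b2, b1\<close>. The tangent space consists of the 3-forms that vanish on \<open>V0 \<zeta>\<close>,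
  equivalently of the forms obtained by letting endomorphisms of \<open>V\<close> act on \<open>\<zeta>\<close> as
  derivations; one inclusion comes from differentiating \<open>F\<^sup>2 = 0\<close> along curves. In adapted
  coordinates the inclusions between images and kernels are linear algebra. The fields
  \<open>q \<mapsto> derivation A q\<close> depend linearly on \<open>q\<close> and \<open>F\<close> quadratically, which yields
  polynomial frames of all four distributions.

  The leaves of \<open>\<D>\<^sub>2\<close> are open subsets of the linear spaces of forms that vanish when two
  arguments lie in a fixed 3-dimensional subspace, so a field in \<open>im \<N>\<close> or \<open>im \<N>\<^sup>2\<close> keeps
  its values in a fixed linear space along any line in a direction of \<open>\<D>\<^sub>2\<close>. For \<open>ker \<N>\<close>
  one differentiates the equation \<open>\<N> Y = 0\<close> along such a line. The kernel of \<open>\<N>\<^sup>2\<close> is cut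
  out by \<open>derivation A \<zeta> \<mapsto> tr (F \<zeta> A)\<close>, and the bracket of two explicit fields leaves it, since
  \<open>tr (F \<zeta> [A, B])\<close> can be nonzero although \<open>tr (F \<zeta> A)\<close> and \<open>tr (F \<zeta> B)\<close> vanish.\<close>


section \<open>Alternating forms\<close>

text \<open>Velocities of curves need not form a linear space a priori, so the tangent space is
  squeezed between two bounds. Pulling \<zeta> back along \<open>x + t A x\<close> realises every
  \<open>derivation A \<zeta>\<close> as a velocity; an upper bound needs an equation valid on the
  whole orbit. The single relation \<open>F (F b1) = 0\<close> suffices, because its linearisation
  at \<zeta> is a nonzero multiple of \<open>w b1 b2 b3\<close>.

  Differentiation takes place in the ambient space of all trilinear forms, where
  \<open>endo_F\<close> is only a description. It is replaced by a polynomial \<open>F\<close>,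
  obtained by Cramer's rule in one fixed frame. Both agree at alternating forms, so the formulas of
  different frames can be compared.

  For the kernel of the square, an \<open>A\<close> with \<open>tr (F A) = 0\<close> at one point
  may violate this at nearby points. The fields are corrected by a multiple of a fixed
  \<open>A\<^sub>0\<close> with nonzero trace, and the derivative of this correction contributes to
  the bracket.\<close>

definition alt_sum :: "nat \<Rightarrow> ((nat \<Rightarrow> 'a) \<Rightarrow> real) \<Rightarrow> (nat \<Rightarrow> 'a) \<Rightarrow> real" where
  "alt_sum n G u = (\<Sum>p | p permutes {..<n}. of_int (sign p) * G (u \<circ> p))"

lemma alt_sum_0: "alt_sum 0 G u = G u"
  by (simp add: alt_sum_def)

text \<open>A permutation of \<open>{..n}\<close> factors uniquely into a transposition of
  \<open>n\<close> with some \<open>b\<close> and a permutation of \<open>{..<n}\<close>; the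
  transposition costs a sign unless it is trivial. Used as a rewrite rule, this unfolds a wedge of
  concrete degrees into all its terms.\<close>

lemma alt_sum_Suc:
  "alt_sum (Suc n) G u =
    (\<Sum>b\<le>n. (if b = n then 1 else - 1) * alt_sum n G (u \<circ> Transposition.transpose n b))"
proof -
  have sgn: "sign (Transposition.transpose n b \<circ> q) = (if b = n then 1 else - 1) * sign q"
    if "q permutes {..<n}" for b q
    using that
    by (subst sign_compose)
       (auto simp: sign_swap_id permutation_swap_id intro: permutes_imp_permutation[OF
           finite_lessThan])
  have "{..<Suc n} = insert n {..<n}" "{..n} = insert n {..<n}" by auto
  then show ?thesis
    unfolding alt_sum_def
    by (simp only: sum_over_permutations_insert[OF finite_lessThan, of n n] lessThan_iff less_irrefl
          not_False_eq_True simp_thms)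
       (auto intro!: sum.cong simp: sgn sum_distrib_left o_assoc)
qed

lemma wedge_eq_alt_sum:
  "wedge k l \<omega> \<eta> u = alt_sum (k + l) (\<lambda>w. \<omega> w * \<eta> (\<lambda>i. w (k + i))) u / (fact k * fact l)"
  by (simp add: wedge_def alt_sum_def o_def mult.assoc)

lemma wedge_1_1:
  "wedge 1 1 (\<lambda>u. f (u 0)) (\<lambda>u. g (u 0)) u = f (u 0) * g (u 1) - f (u 1) * g (u 0)"
  unfolding wedge_eq_alt_sum
  by (simp add: alt_sum_0 alt_sum_Suc Transposition.transpose_def)

lemma wedge_1_2:
  assumes "\<And>x y. s x y = - s y x"
  shows "wedge 1 2 (\<lambda>u. f (u 0)) (\<lambda>u. s (u 0) (u 1)) u =
    f (u 0) * s (u 1) (u 2) - f (u 1) * s (u 0) (u 2) + f (u 2) * s (u 0) (u 1)"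
  unfolding wedge_eq_alt_sum
  using assms[of "u 1" "u 0"] assms[of "u 2" "u 0"] assms[of "u 2" "u 1"]
  by (simp add: alt_sum_0 alt_sum_Suc Transposition.transpose_def eval_nat_numeral field_simps)

lemma wedge_2_2:
  assumes "\<And>x y. s x y = - s y x"
  shows "wedge 2 2 (\<lambda>u. s (u 0) (u 1)) (\<lambda>u. s (u 0) (u 1)) u =
    2 * (s (u 0) (u 1) * s (u 2) (u 3) - s (u 0) (u 2) * s (u 1) (u 3)
        + s (u 0) (u 3) * s (u 1) (u 2))"
  unfolding wedge_eq_alt_sum
  using assms[of "u 1" "u 0"] assms[of "u 2" "u 0"] assms[of "u 2" "u 1"]
    assms[of "u 3" "u 0"] assms[of "u 3" "u 1"] assms[of "u 3" "u 2"]
  by (simp add: alt_sum_0 alt_sum_Suc Transposition.transpose_def eval_nat_numeral field_simps)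

text \<open>The sum over the ten (2,3)-shuffles, to which the 120 permutations of the wedge collapse
  for alternating \<open>s\<close> and \<open>t\<close>. As a polynomial expression it also makes
  sense for other \<open>s\<close> and \<open>t\<close>, and can be differentiated without
  constraints.\<close>

definition shuffle23 :: "('a \<Rightarrow> 'a \<Rightarrow> real) \<Rightarrow> ('a \<Rightarrow> 'a \<Rightarrow> 'a \<Rightarrow> real) \<Rightarrow> 'a \<Rightarrow> 'a \<Rightarrow> 'a \<Rightarrow> 'a \<Rightarrow> 'a \<Rightarrow> real"
  where "shuffle23 s t a b c d e =
    s a b * t c d e - s a c * t b d e + s a d * t b c e - s a e * t b c d + s b c * t a d e
    - s b d * t a c e + s b e * t a c d + s c d * t a b e - s c e * t a b d + s d e * t a b c"

lemma wedge_2_3: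
  assumes s: "\<And>x y. s x y = - s y x"
    and t: "\<And>x y z. t x y z = - t y x z" "\<And>x y z. t x y z = - t x z y"
  shows "wedge 2 3 (\<lambda>u. s (u 0) (u 1)) (\<lambda>u. t (u 0) (u 1) (u 2)) u =
    shuffle23 s t (u 0) (u 1) (u 2) (u 3) (u 4)"
proof -
  define a where "a = u 0"
  define b where "b = u 1"
  define c where "c = u 2"
  define d where "d = u 3"
  define e where "e = u 4"
  note u = a_def[symmetric] b_def[symmetric] c_def[symmetric] d_def[symmetric] e_def[symmetric]
  \<comment> \<open>Each instance moves the earlier letter to the left, so rewriting sorts all
    arguments and terminates.\<close>
  note rules =
    s[of b a] s[of c a] s[of d a] s[of e a] s[of c b] s[of d b] s[of e b] s[of d c] s[of e c] s[of e
        d]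
    t(1)[of b a] t(1)[of c a] t(1)[of d a] t(1)[of e a] t(1)[of c b] t(1)[of d b] t(1)[of e b]
    t(1)[of d c] t(1)[of e c] t(1)[of e d]
    t(2)[of _ b a] t(2)[of _ c a] t(2)[of _ d a] t(2)[of _ e a] t(2)[of _ c b] t(2)[of _ d b]
    t(2)[of _ e b] t(2)[of _ d c] t(2)[of _ e c] t(2)[of _ e d]
  have u': "u (Suc 0) = b" "u (Suc (Suc 0)) = c" "u (Suc (Suc (Suc 0))) = d"
      "u (Suc (Suc (Suc (Suc 0)))) = e" "u 0 = a"
    by (simp_all add: a_def b_def c_def d_def e_def eval_nat_numeral)
  show ?thesis
    unfolding wedge_eq_alt_sum u shuffle23_def
    by (simp add: alt_sum_0 alt_sum_Suc Transposition.transpose_def eval_nat_numeral u') (simp add: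
        rules)
qed

section \<open>Vanishing criteria for alternating forms\<close>

lemma ext_powerD:
  assumes "\<omega> \<in> ext_power k"
  shows "(\<And>i. i < k \<Longrightarrow> u i = v i) \<Longrightarrow> \<omega> u = \<omega> v"
    and "i < k \<Longrightarrow> linear (\<lambda>x. \<omega> (u(i := x)))"
    and "i < k \<Longrightarrow> j < k \<Longrightarrow> i \<noteq> j \<Longrightarrow> u i = u j \<Longrightarrow> \<omega> u = 0"
  using assms unfolding ext_power_def by (blast, blast, blast)

text \<open>Polarisation: the form vanishes with \<open>u i + u j\<close> in both slots, and
  additivity leaves the two mixed terms.\<close>

lemma ext_power_swap:
  assumes "\<omega> \<in> ext_power k" "i < k" "j < k" "i \<noteq> j"
  shows "\<omega> (u \<circ> Transposition.transpose i j) = - \<omega> u"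
proof -
  let ?f = "\<lambda>x y. \<omega> (u(i := x, j := y))"
  have "linear (\<lambda>x. \<omega> ((u(j := y))(i := x)))" for y
    using assms by (intro ext_powerD)
  then have 1: "?f (x + x') y = ?f x y + ?f x' y" for x x' y
    using assms(4) by (simp add: linear_iff fun_upd_twist)
  have "linear (\<lambda>y. \<omega> ((u(i := x))(j := y)))" for x
    using assms by (intro ext_powerD)
  then have 2: "?f x (y + y') = ?f x y + ?f x y'" for x y y'
    by (simp add: linear_iff)
  have 0: "?f x x = 0" for x
    using assms by (intro ext_powerD(3)[OF assms(1), of i j]) auto
  have "?f (u i + u j) (u i + u j) = ?f (u i) (u i) + ?f (u i) (u j) + (?f (u j) (u i)
      + ?f (u j) (u j))"
    by (simp only: 1 2 add_ac)
  then have "?f (u i) (u j) + ?f (u j) (u i) = 0" unfolding 0 by simp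
  moreover have "u(i := u i, j := u j) = u" by auto
  moreover have "u(i := u j, j := u i) = u \<circ> Transposition.transpose i j"
    using assms(4) by (auto simp: Transposition.transpose_def)
  ultimately show ?thesis by simp
qed

text \<open>Only vanishing is carried through the decomposition into transpositions, so no sign has
  to be tracked.\<close>

lemma ext_power_permute_eq_0:
  assumes "\<omega> \<in> ext_power k" "p permutes {..<k}" "\<omega> u = 0"
  shows "\<omega> (u \<circ> p) = 0"
  using assms(2) finite_lessThan assms(3)
proof (induction p arbitrary: u rule: permutes_induct)
  case (swap a b p)
  then have "\<omega> ((u \<circ> Transposition.transpose a b) \<circ> p) = 0"
    using ext_power_swap[OF assms(1), of a b u]
    by (intro swap.IH[of "u \<circ> Transposition.transpose a b"]) (simp add: o_def)
  then show ?case by (simp add: o_def)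
qed simp

lemma ext_power_reorder_eq_0:
  assumes "\<omega> \<in> ext_power k" "inj_on u {..<k}" "inj_on v {..<k}" "v ` {..<k} = u ` {..<k}" "\<omega> u = 0"
  shows "\<omega> v = 0"
proof -
  define p where "p i = (if i < k then the_inv_into {..<k} u (v i) else i)" for i
  have "bij_betw (the_inv_into {..<k} u \<circ> v) {..<k} {..<k}"
    using assms(2-4) by (intro bij_betw_trans[of v _ "u ` {..<k}"] bij_betw_the_inv_into) (auto
        simp: bij_betw_def)
  then have "bij_betw p {..<k} {..<k}"
    by (rule bij_betw_cong[THEN iffD1, rotated]) (simp add: p_def)
  then have "p permutes {..<k}"
    by (rule bij_imp_permutes) (simp add: p_def)
  then have "\<omega> (u \<circ> p) = 0" using ext_power_permute_eq_0[OF assms(1)] assms(5) by blast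
  moreover have "v i = (u \<circ> p) i" if "i < k" for i
  proof -
    have "v i \<in> u ` {..<k}" using that assms(4) by blast
    then show ?thesis using that assms(2) by (simp add: p_def f_the_inv_into_f)
  qed
  ultimately show ?thesis using ext_powerD(1)[OF assms(1), of v "u \<circ> p"] by simp
qed

lemma ext_power_eq_0_spanning:
  assumes "\<omega> \<in> ext_power k" "span B = UNIV"
    and "\<And>u. (\<And>i. i < k \<Longrightarrow> u i \<in> B) \<Longrightarrow> \<omega> u = 0"
  shows "\<omega> u = 0"
proof -
  \<comment> \<open>The slots are freed one at a time: entries below \<open>n\<close> are arbitrary,
    those from \<open>n\<close> on lie in \<open>B\<close>.\<close>
  have "n \<le> k \<Longrightarrow> (\<And>i. n \<le> i \<Longrightarrow> i < k \<Longrightarrow> u i \<in> B) \<Longrightarrow> \<omega> u = 0" for n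
  proof (induction n arbitrary: u)
    case 0
    then show ?case using assms(3) by simp
  next
    case (Suc n)
    have lin: "linear (\<lambda>x. \<omega> (u(n := x)))" using Suc.prems by (intro ext_powerD[OF assms(1)]) simp
    have "\<omega> (u(n := x)) = 0" if "x \<in> B" for x
      using Suc.prems that by (intro Suc.IH) auto
    then have "\<omega> (u(n := u n)) = 0"
      using linear_eq_0_on_span[OF lin, of B "u n"] assms(2) by simp
    then show ?case by simp
  qed
  from this[of k] show ?thesis by simp
qed

text \<open>One enumeration per subset suffices, since repeated entries give zero and reorderings
  change only the sign. With six frame vectors, a 6-form is thereby tested on one tuple and a 5-form
  on six.\<close>

lemma ext_power_eq_0I:
  assumes "\<omega> \<in> ext_power k" "span B = UNIV"
    and ex: "\<And>A. A \<subseteq> B \<Longrightarrow> card A = k \<Longrightarrow> \<exists>u. u ` {..<k} = A \<and> \<omega> u = 0"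
  shows "\<omega> = (\<lambda>_. 0)"
proof
  fix u
  show "\<omega> u = 0"
  proof (rule ext_power_eq_0_spanning[OF assms(1,2)])
    fix u :: "nat \<Rightarrow> 'a" assume u: "\<And>i. i < k \<Longrightarrow> u i \<in> B"
    show "\<omega> u = 0"
    proof (cases "inj_on u {..<k}")
      case True
      then have c: "card (u ` {..<k}) = k" by (simp add: card_image)
      obtain w where w: "w ` {..<k} = u ` {..<k}" "\<omega> w = 0"
        using ex[of "u ` {..<k}"] u c by auto
      then have "inj_on w {..<k}" using c by (simp add: inj_on_iff_eq_card)
      then show ?thesis using w True by (intro ext_power_reorder_eq_0[OF assms(1), of w u]) auto
    next
      case False
      then obtain i j where "i < k" "j < k" "i \<noteq> j" "u i = u j" by (auto simp: inj_on_def)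
      then show ?thesis by (rule ext_powerD(3)[OF assms(1)])
    qed
  qed
qed

lemma interior_prod_ext_power:
  fixes \<omega> :: "'a::real_vector form"
  assumes "\<omega> \<in> ext_power (Suc k)"
  shows "interior_prod v \<omega> \<in> ext_power k"
proof -
  have upd: "case_nat v (u(i := x)) = (case_nat v u)(Suc i := x)" for u i x
    by (auto simp: fun_eq_iff split: nat.split)
  show ?thesis
    unfolding ext_power_def interior_prod_def mem_Collect_eq upd
  proof (intro conjI allI impI)
    fix u w :: "nat \<Rightarrow> 'a" assume "\<forall>i<k. u i = w i"
    then show "\<omega> (case_nat v u) = \<omega> (case_nat v w)"
      by (intro ext_powerD(1)[OF assms]) (auto split: nat.split)
  next
    fix u :: "nat \<Rightarrow> 'a" and i assume "i < k"
    then show "linear (\<lambda>x. \<omega> ((case_nat v u)(Suc i := x)))"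
      by (intro ext_powerD(2)[OF assms]) simp
  next
    fix u :: "nat \<Rightarrow> 'a" and i j assume "i < k" "j < k" "i \<noteq> j \<and> u i = u j"
    then show "\<omega> (case_nat v u) = 0"
      by (intro ext_powerD(3)[OF assms, of "Suc i" "Suc j"]) auto
  qed
qed

lemma linear_interior_prod:
  fixes \<omega> :: "'a::real_vector form"
  assumes "\<omega> \<in> ext_power (Suc k)"
  shows "linear (\<lambda>v. interior_prod v \<omega> u)"
proof -
  have "(case_nat undefined u)(0 := x) = case_nat x u" for x
    by (auto simp: fun_eq_iff split: nat.split)
  then show ?thesis
    using ext_powerD(2)[OF assms, of 0 "case_nat undefined u"] by (simp add: interior_prod_def)
qed

lemma ext_power_diff:
  fixes \<omega> \<eta> :: "'a::real_vector form"
  assumes "\<omega> \<in> ext_power k" "\<eta> \<in> ext_power k"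
  shows "(\<lambda>u. \<omega> u - \<eta> u) \<in> ext_power k"
  unfolding ext_power_def mem_Collect_eq
proof (intro conjI allI impI)
  fix u v :: "nat \<Rightarrow> 'a" assume "\<forall>i<k. u i = v i"
  then show "\<omega> u - \<eta> u = \<omega> v - \<eta> v"
    using ext_powerD(1)[OF assms(1), of u v] ext_powerD(1)[OF assms(2), of u v] by simp
next
  fix u :: "nat \<Rightarrow> 'a" and i assume "i < k"
  then show "linear (\<lambda>x. \<omega> (u(i := x)) - \<eta> (u(i := x)))"
    by (intro linear_compose_sub ext_powerD(2)[OF assms(1)] ext_powerD(2)[OF assms(2)])
next
  fix u :: "nat \<Rightarrow> 'a" and i j assume "i < k" "j < k" "i \<noteq> j \<and> u i = u j"
  then show "\<omega> u - \<eta> u = 0"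
    using ext_powerD(3)[OF assms(1), of i j u] ext_powerD(3)[OF assms(2), of i j u] by simp
qed


section \<open>Smooth maps\<close>

text \<open>Formulas for derivatives of sums and products are available only at points of
  \<open>S\<close>. Openness makes the values outside irrelevant, so the inductions below may
  replace a derivative by its formula.\<close>

lemma C_diff_on_cong:
  assumes "open S" "\<And>x. x \<in> S \<Longrightarrow> f x = g x" "C_diff_on n S f"
  shows "C_diff_on n S g"
  using assms(2,3)
proof (induction n arbitrary: f g)
  case 0
  then show ?case by (simp cong: continuous_on_cong)
next
  case (Suc n)
  have "frechet_derivative f (at x) = frechet_derivative g (at x)" if "x \<in> S" for x
    using Suc.prems that assms(1) by (intro frechet_derivative_transform_within_open) auto
  moreover have "g differentiable (at x)" if "x \<in> S" for x
    using Suc.prems that assms(1)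
    by (metis C_diff_on.simps(2) differentiable_def has_derivative_transform_within_open)
  ultimately show ?case
    using Suc.prems(2) Suc.IH[of "\<lambda>x. frechet_derivative f (at x) _"
        "\<lambda>x. frechet_derivative g (at x) _"]
    by simp
qed

lemma C_diff_on_SucD: "C_diff_on (Suc n) S f \<Longrightarrow> C_diff_on n S f"
proof (induction n arbitrary: f)
  case 0
  then show ?case
    by (auto intro!: continuous_at_imp_continuous_on differentiable_imp_continuous_within)
next
  case (Suc n)
  have "C_diff_on n S (\<lambda>x. frechet_derivative f (at x) v)" for v
    using Suc.prems by (intro Suc.IH) (simp only: C_diff_on.simps(2)[of "Suc n"])
  then show ?case
    using Suc.prems by (simp only: C_diff_on.simps(2)) blast
qed

lemma C_diff_on_const: "C_diff_on n S (\<lambda>x. c)"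
  by (induction n arbitrary: c) simp_all

lemma C_diff_on_add:
  assumes "open S"
  shows "C_diff_on n S f \<Longrightarrow> C_diff_on n S g \<Longrightarrow> C_diff_on n S (\<lambda>x. f x + g x)"
proof (induction n arbitrary: f g)
  case 0
  then show ?case by (simp add: continuous_on_add)
next
  case (Suc n)
  have eq: "frechet_derivative f (at x) v + frechet_derivative g (at x) v =
      frechet_derivative (\<lambda>x. f x + g x) (at x) v" if "x \<in> S" for x v
    using Suc.prems that
    by (intro fun_cong[OF frechet_derivative_at] has_derivative_add)
       (simp_all add: frechet_derivative_works)
  have "C_diff_on n S (\<lambda>x. frechet_derivative f (at x) v + frechet_derivative g (at x) v)" for v
    using Suc.prems by (intro Suc.IH) simp_all
  then have "C_diff_on n S (\<lambda>x. frechet_derivative (\<lambda>x. f x + g x) (at x) v)" for v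
    by (rule C_diff_on_cong[OF assms eq, rotated])
  then show ?case
    using Suc.prems by simp
qed

text \<open>The Leibniz rule yields two products of the same kind, each with one undifferentiated
  factor, whose order is first lowered by \<open>C_diff_on_SucD\<close>.\<close>

lemma C_diff_on_bounded_bilinear:
  assumes "bounded_bilinear B" "open S"
  shows "C_diff_on n S f \<Longrightarrow> C_diff_on n S g \<Longrightarrow> C_diff_on n S (\<lambda>x. B (f x) (g x))"
proof (induction n arbitrary: f g)
  case 0
  then show ?case by (simp add: bounded_bilinear.continuous_on[OF assms(1)])
next
  case (Suc n)
  have der: "((\<lambda>x. B (f x) (g x)) has_derivative
      (\<lambda>v. B (f x) (frechet_derivative g (at x) v) + B (frechet_derivative f (at x) v) (g x))) (at
          x)"
    if "x \<in> S" for x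
    using Suc.prems that
    by (intro bounded_bilinear.FDERIV[OF assms(1)]) (simp_all add: frechet_derivative_works)
  have eq: "B (f x) (frechet_derivative g (at x) v) + B (frechet_derivative f (at x) v) (g x) =
      frechet_derivative (\<lambda>x. B (f x) (g x)) (at x) v" if "x \<in> S" for x v
    by (rule fun_cong[OF frechet_derivative_at[OF der[OF that]]])
  have "C_diff_on n S f" "C_diff_on n S g"
    using Suc.prems by (auto intro: C_diff_on_SucD simp del: C_diff_on.simps)
  then have "C_diff_on n S
      (\<lambda>x. B (f x) (frechet_derivative g (at x) v) + B (frechet_derivative f (at x) v) (g x))" for v
    using Suc.prems by (intro Suc.IH C_diff_on_add[OF assms(2)]) simp_all
  then have "C_diff_on n S (\<lambda>x. frechet_derivative (\<lambda>x. B (f x) (g x)) (at x) v)" for v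
    by (rule C_diff_on_cong[OF assms(2) eq, rotated])
  then show ?case
    using der by (auto simp: differentiable_def)
qed

lemma smooth_on_const: "smooth_on S (\<lambda>x. c)"
  by (simp add: smooth_on_def C_diff_on_const)

lemma smooth_on_bounded_linear:
  assumes "bounded_linear f"
  shows "smooth_on S f"
  unfolding smooth_on_def
proof
  have "frechet_derivative f (at x) = f" for x
    by (rule frechet_derivative_at[symmetric]) (rule bounded_linear_imp_has_derivative[OF assms])
  then show "C_diff_on n S f" for n
    using assms
    by (cases n) (simp_all add: C_diff_on_const bounded_linear_imp_differentiable
        linear_continuous_on)
qed

lemma smooth_on_add:
  "open S \<Longrightarrow> smooth_on S f \<Longrightarrow> smooth_on S g \<Longrightarrow> smooth_on S (\<lambda>x. f x + g x)"
  by (simp add: smooth_on_def C_diff_on_add)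

lemma smooth_on_bounded_bilinear:
  "bounded_bilinear B \<Longrightarrow> open S \<Longrightarrow> smooth_on S f \<Longrightarrow> smooth_on S g \<Longrightarrow>
    smooth_on S (\<lambda>x. B (f x) (g x))"
  by (simp add: smooth_on_def C_diff_on_bounded_bilinear)

lemmas smooth_on_scaleR = smooth_on_bounded_bilinear[OF bounded_bilinear_scaleR]
lemmas smooth_on_mult = smooth_on_bounded_bilinear[OF bounded_bilinear_mult]
lemmas smooth_on_inner = smooth_on_bounded_bilinear[OF bounded_bilinear_inner]
lemmas smooth_on_blinfun_apply = smooth_on_bounded_bilinear[OF bounded_bilinear_blinfun_apply]

lemma smooth_on_minus:
  assumes "open S" "smooth_on S f"
  shows "smooth_on S (\<lambda>x. - f x)"
  using smooth_on_scaleR[OF assms(1) smooth_on_const[of S "-1"] assms(2)] by simp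

lemma smooth_on_diff:
  "open S \<Longrightarrow> smooth_on S f \<Longrightarrow> smooth_on S g \<Longrightarrow> smooth_on S (\<lambda>x. f x - g x)"
  using smooth_on_add[OF _ _ smooth_on_minus, of S f g] by simp

lemma smooth_on_sum:
  assumes "open S" "\<And>i. i \<in> I \<Longrightarrow> smooth_on S (f i)"
  shows "smooth_on S (\<lambda>x. \<Sum>i\<in>I. f i x)"
  using assms(2)
  by (induction I rule: infinite_finite_induct) (auto intro: smooth_on_const smooth_on_add assms(1))

lemma smooth_on_imp_differentiable: "smooth_on S f \<Longrightarrow> x \<in> S \<Longrightarrow> f differentiable (at x)"
  unfolding smooth_on_def by (metis C_diff_on.simps(2))

lemma smooth_on_imp_continuous_on: "smooth_on S f \<Longrightarrow> continuous_on S f"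
  unfolding smooth_on_def by (metis C_diff_on.simps(1))

lemma smooth_on_subset:
  assumes "smooth_on S f" "T \<subseteq> S"
  shows "smooth_on T f"
proof -
  have "C_diff_on n S f \<Longrightarrow> C_diff_on n T f" for n
    using assms(2) by (induction n arbitrary: f) (auto intro: continuous_on_subset)
  then show ?thesis using assms(1) by (simp add: smooth_on_def)
qed

lemma has_vector_derivative_line:
  assumes "Y differentiable (at p)"
  shows "((\<lambda>t. Y (p + t *\<^sub>R v)) has_vector_derivative frechet_derivative Y (at p) v) (at 0)"
proof -
  have "((\<lambda>t. p + t *\<^sub>R v) has_vector_derivative v) (at 0)"
    by (auto intro!: derivative_eq_intros)
  moreover have "(Y has_derivative frechet_derivative Y (at p)) (at (p + 0 *\<^sub>R v))"
    using assms by (simp add: frechet_derivative_works)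
  ultimately show ?thesis
    using vector_derivative_diff_chain_within[of "\<lambda>t. p + t *\<^sub>R v" v 0 UNIV Y]
    by (simp add: o_def has_derivative_at_withinI)
qed

text \<open>The source of all upper bounds on tangent vectors and on brackets: an equation that
  persists along a curve passes to the velocity.\<close>

lemma has_vector_derivative_bounded_linear_eq_0:
  assumes "(f has_vector_derivative w) (at 0)" "bounded_linear l"
    and "e > 0" "\<And>t. \<bar>t\<bar> < e \<Longrightarrow> l (f t) = (0::real)"
  shows "l w = 0"
proof -
  have "((\<lambda>t. l (f t)) has_vector_derivative l w) (at 0)"
    using bounded_linear.has_vector_derivative[OF assms(2,1)] .
  then have "((\<lambda>t. 0) has_vector_derivative l w) (at 0)"
    by (rule has_vector_derivative_transform_within_open[where S = "ball 0 e"])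
       (use assms(3,4) in \<open>auto simp: dist_real_def\<close>)
  then show ?thesis
    by (metis has_vector_derivative_const vector_derivative_at)
qed


section \<open>Local frames\<close>

text \<open>Diagonal dominance. The matrix of the \<open>\<phi> j (w i)\<close> differs from the
  identity by less than \<open>1 / (r + 1)\<close> in each entry; tested at an index with
  coefficient of largest modulus, the \<open>r\<close> errors add up to less than that
  modulus.\<close>

lemma independent_family_perturb:
  fixes v w :: "nat \<Rightarrow> 'a::real_vector"
  assumes near: "\<And>i j. i < r \<Longrightarrow> j < r \<Longrightarrow> \<bar>\<phi> j (w i) - (if i = j then 1 else 0)\<bar> < 1 / (real r + 1)"
    and lin: "\<And>j. j < r \<Longrightarrow> linear (\<phi> j)"
    and zero: "(\<Sum>i<r. a i *\<^sub>R w i) = 0"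
  shows "\<forall>i<r. a i = (0::real)"
proof (rule ccontr)
  assume "\<not> (\<forall>i<r. a i = 0)"
  then have r: "0 < r" and ex: "\<exists>i<r. a i \<noteq> 0" by auto
  define m where "m = Max ((\<lambda>i. \<bar>a i\<bar>) ` {..<r})"
  have m: "\<bar>a i\<bar> \<le> m" if "i < r" for i
    using that by (auto simp: m_def)
  have "m \<in> (\<lambda>i. \<bar>a i\<bar>) ` {..<r}"
    unfolding m_def using r by (intro Max_in) auto
  then obtain j where j: "j < r" "m = \<bar>a j\<bar>" by auto
  have m0: "m > 0" using ex m by fastforce
  have "0 = \<phi> j (\<Sum>i<r. a i *\<^sub>R w i)"
    using zero lin[OF j(1)] by (simp add: linear_0)
  also have "\<dots> = (\<Sum>i<r. a i * \<phi> j (w i))"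
    using lin[OF j(1)] by (simp add: linear_sum linear_scale)
  also have "\<dots> = (\<Sum>i<r. a i * (\<phi> j (w i) - (if i = j then 1 else 0))) + a j"
    using j(1) by (simp add: right_diff_distrib sum_subtractf if_distrib[of "\<lambda>x. _ * x"] cong:
        if_cong)
  finally have "m = \<bar>\<Sum>i<r. a i * (\<phi> j (w i) - (if i = j then 1 else 0))\<bar>"
    using j(2) by linarith
  also have "\<dots> \<le> (\<Sum>i<r. \<bar>a i * (\<phi> j (w i) - (if i = j then 1 else 0))\<bar>)"
    by (rule sum_abs)
  also have "\<dots> \<le> (\<Sum>i<r. m * (1 / (real r + 1)))"
    using m0 unfolding abs_mult
    by (intro sum_mono mult_mono m less_imp_le[OF near[OF _ j(1)]]) auto
  also have "\<dots> = m * (r / (real r + 1))" by simp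
  also have "\<dots> < m * 1" using m0 by (intro mult_strict_left_mono) auto
  finally show False by simp
qed

lemma independent_image_lessThanI:
  fixes w :: "nat \<Rightarrow> 'a::real_vector"
  assumes "\<And>a. (\<Sum>i<r. a i *\<^sub>R w i) = 0 \<Longrightarrow> \<forall>i<r. a i = 0"
  shows "inj_on w {..<r}" "independent (w ` {..<r})"
proof -
  show inj: "inj_on w {..<r}"
  proof (rule inj_onI, rule ccontr)
    fix i j assume ij: "i \<in> {..<r}" "j \<in> {..<r}" "w i = w j" "i \<noteq> j"
    define a where "a = (\<lambda>k. if k = i then 1 else if k = j then - 1 else 0 :: real)"
    have "(\<Sum>k<r. a k *\<^sub>R w k) = (\<Sum>k\<in>{i,j}. a k *\<^sub>R w k)"
      using ij by (intro sum.mono_neutral_right) (auto simp: a_def)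
    also have "\<dots> = 0" using ij by (simp add: a_def)
    finally show False using assms[of a] ij by (auto simp: a_def)
  qed
  show "independent (w ` {..<r})"
  proof (rule independent_if_scalars_zero)
    fix f x assume "(\<Sum>x\<in>w ` {..<r}. f x *\<^sub>R x) = 0" "x \<in> w ` {..<r}"
    then show "f x = 0"
      using assms[of "\<lambda>i. f (w i)"] inj by (auto simp: sum.reindex)
  qed simp
qed

text \<open>Steinitz exchange: a vector of \<open>D\<close> outside the span would enlarge
  \<open>S\<close> to an independent set with more elements than \<open>B\<close>.\<close>

lemma span_eq_subspace_card:
  assumes "subspace D" "D \<subseteq> span B" "finite B" "S \<subseteq> D" "independent S" "card S = card B"
  shows "span S = D"
proof
  show "span S \<subseteq> D" using assms by (simp add: span_minimal)
  show "D \<subseteq> span S"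
  proof (rule subsetI, rule ccontr)
    fix x assume x: "x \<in> D" "x \<notin> span S"
    then have "independent (insert x S)" "x \<notin> S"
      using assms(5) by (auto simp: independent_insert span_base)
    moreover have "insert x S \<subseteq> span B" using assms x by auto
    ultimately have "finite (insert x S) \<and> card (insert x S) \<le> card B"
      by (intro independent_span_bound[OF assms(3)])
    then show False using \<open>x \<notin> S\<close> assms(6) by (auto simp: card_insert_if)
  qed
qed

text \<open>The rank is constant because any two fibres are related by a linear isomorphism.\<close>

lemma smooth_distributionI:
  fixes D :: "'a::real_normed_vector \<Rightarrow> 'a set"
  assumes bounded: "\<And>f :: 'a \<Rightarrow> real. linear f \<Longrightarrow> bounded_linear f"
    and fin: "finite S" "span S = (UNIV :: 'a set)"
    and tangent: "\<And>p. p \<in> M \<Longrightarrow> D p \<subseteq> tangent_space M p"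
    and sub: "\<And>p. p \<in> M \<Longrightarrow> subspace (D p)"
    and transport: "\<And>p q. p \<in> M \<Longrightarrow> q \<in> M \<Longrightarrow> \<exists>\<Phi>. linear \<Phi> \<and> \<Phi> ` D p = D q"
    and fields: "\<And>p w. p \<in> M \<Longrightarrow> w \<in> D p \<Longrightarrow>
      \<exists>X. smooth_on UNIV X \<and> X p = w \<and> (\<forall>q\<in>M. X q \<in> D q)"
  shows "smooth_distribution M D"
proof (cases "M = {}")
  case True
  then show ?thesis by (simp add: smooth_distribution_def)
next
  case False
  have basis: "\<exists>B. B \<subseteq> D p \<and> finite B \<and> independent B \<and> span B = D p" if "p \<in> M" for p
  proof -
    obtain B where B: "B \<subseteq> D p" "independent B" "D p \<subseteq> span B"
      using maximal_independent_subset[of "D p"] by auto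
    then have "finite B" using independent_span_bound[OF fin(1), of B] fin(2) by simp
    then show ?thesis
      using B sub[OF that] by (metis span_minimal subset_antisym)
  qed
  \<comment> \<open>The image of a spanning set of one fibre spans the other. Applied in both
    directions, this makes all bases of fibres equally large.\<close>
  have card_le: "card B' \<le> card B"
    if "p \<in> M" "q \<in> M" "finite B" "span B = D p" "independent B'" "span B' = D q" for p q B B'
  proof -
    obtain \<Phi> where "linear \<Phi>" "\<Phi> ` D p = D q" using transport \<open>p \<in> M\<close> \<open>q \<in> M\<close> by blast
    then have "span (\<Phi> ` B) = D q" using that by (simp add: linear_span_image)
    then have "card B' \<le> card (\<Phi> ` B)"
      using that independent_span_bound[of "\<Phi> ` B" B'] span_superset[of B'] by auto
    then show ?thesis using card_image_le[OF that(3), of \<Phi>] by linarith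
  qed
  obtain p0 where p0: "p0 \<in> M" using False by auto
  obtain B0 where B0: "finite B0" "independent B0" "span B0 = D p0" using basis[OF p0] by auto
  define r where "r = card B0"
  show ?thesis
    unfolding smooth_distribution_def
  proof (intro conjI ballI exI[of _ r])
    fix p assume p: "p \<in> M"
    show "D p \<subseteq> tangent_space M p" by (rule tangent[OF p])
    obtain B where B: "B \<subseteq> D p" "finite B" "independent B" "span B = D p"
      using basis[OF p] by auto
    have "card B = r"
      unfolding r_def using card_le[OF p p0 B(2,4) B0(2,3)] card_le[OF p0 p B0(1,3) B(3,4)] by simp
    then obtain v where v: "bij_betw v {..<r} B"
      using ex_bij_betw_nat_finite[OF B(2)] by (auto simp: lessThan_atLeast0)
    have "\<forall>i. \<exists>X. i < r \<longrightarrow> smooth_on UNIV X \<and> X p = v i \<and> (\<forall>q\<in>M. X q \<in> D q)"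
      using fields[OF p] v B(1) by (meson bij_betwE lessThan_iff subsetD)
    from choice[OF this] obtain X where "\<forall>i. i < r \<longrightarrow> smooth_on UNIV (X i) \<and> X i p = v i \<and>
        (\<forall>q\<in>M. X i q \<in> D q)" ..
    then have X: "\<And>i. i < r \<Longrightarrow> smooth_on UNIV (X i)" "\<And>i. i < r \<Longrightarrow> X i p = v i"
        "\<And>i q. i < r \<Longrightarrow> q \<in> M \<Longrightarrow> X i q \<in> D q"
      by auto
    \<comment> \<open>Functionals dual to the chosen basis of \<open>D p\<close>, extended to the
      whole space; paired with the fields they give the identity matrix at \<open>p\<close>.\<close>
    have "\<forall>j. \<exists>\<phi>. linear \<phi> \<and> (\<forall>x\<in>B. \<phi> x = (if x = v j then 1 else 0 :: real))"
      using linear_independent_extend[OF B(3)] by (intro allI)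
    from choice[OF this] obtain \<phi>
      where "\<forall>j. linear (\<phi> j) \<and> (\<forall>x\<in>B. \<phi> j x = (if x = v j then 1 else 0 :: real))" ..
    then have \<phi>: "\<And>j. linear (\<phi> j)" "\<And>j x. x \<in> B \<Longrightarrow> \<phi> j x = (if x = v j then 1 else 0 :: real)"
      by auto
    define f where "f i j q = \<bar>\<phi> j (X i q) - (if i = j then 1 else 0 :: real)\<bar>" for i j q
    have cont: "continuous_on UNIV (f i j)" if "i < r" for i j
      unfolding f_def
      by (intro continuous_intros bounded_linear.continuous_on[OF bounded[OF \<phi>(1)]]
          smooth_on_imp_continuous_on X that)
    \<comment> \<open>On \<open>W\<close> the matrix stays close enough to the identity for the
      fields to remain independent. They are \<open>r\<close> vectors of the
      \<open>r\<close>-dimensional \<open>D q\<close>, so they span it.\<close>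
    define W where "W = (\<Inter>i\<in>{..<r}. \<Inter>j\<in>{..<r}. {q. f i j q < 1 / (real r + 1)})"
    have "open W"
      unfolding W_def using cont by (intro open_INT ballI open_Collect_less) auto
    moreover have "p \<in> W"
    proof -
      have "\<phi> j (v i) = (if i = j then 1 else 0)" if "i < r" "j < r" for i j
        using that v \<phi>(2)[of "v i" j] by (auto simp: bij_betw_def inj_on_eq_iff)
      then show ?thesis by (auto simp: W_def f_def X)
    qed
    moreover have "inj_on (\<lambda>i. X i q) {..<r} \<and> independent ((\<lambda>i. X i q) ` {..<r}) \<and>
        D q = span ((\<lambda>i. X i q) ` {..<r})" if q: "q \<in> W \<inter> M" for q
    proof -
      have "\<forall>i<r. a i = 0" if "(\<Sum>i<r. a i *\<^sub>R X i q) = 0" for a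
        using independent_family_perturb[of r \<phi> "\<lambda>i. X i q" a] q \<phi>(1) that
        by (auto simp: W_def f_def)
      note * = independent_image_lessThanI[where r = r and w = "\<lambda>i. X i q", OF this]
      obtain B' where B': "finite B'" "independent B'" "span B' = D q" using basis[of q] q by auto
      have "card B' = r"
        using card_le[of q p B' B] card_le[of p q B B'] B' B q p \<open>card B = r\<close> by auto
      then have "span ((\<lambda>i. X i q) ` {..<r}) = D q"
        using B' * q sub X(3)
        by (intro span_eq_subspace_card[of "D q" B']) (auto simp: card_image)
      then show ?thesis using * by simp
    qed
    ultimately show "\<exists>W X. open W \<and> p \<in> W \<and> (\<forall>i<r. smooth_on W (X i)) \<and>
        (\<forall>q\<in>W \<inter> M. inj_on (\<lambda>i. X i q) {..<r} \<and> independent ((\<lambda>i. X i q) ` {..<r}) \<and>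
           D q = span ((\<lambda>i. X i q) ` {..<r}))"
      using smooth_on_subset[OF X(1) subset_UNIV] by blast
  qed
qed


section \<open>Trilinear forms\<close>

definition alternating :: "'v::real_normed_vector trilin \<Rightarrow> bool" where
  "alternating \<Omega> \<longleftrightarrow> (\<forall>x y. \<Omega> x x y = 0 \<and> \<Omega> x y y = 0)"

lemma alternating_swap:
  assumes "alternating \<Omega>"
  shows "\<Omega> x y z = - \<Omega> y x z" "\<Omega> x y z = - \<Omega> x z y"
proof -
  have "\<Omega> (x + y) (x + y) z = 0" "\<Omega> x x z = 0" "\<Omega> y y z = 0"
    "\<Omega> x (y + z) (y + z) = 0" "\<Omega> x y y = 0" "\<Omega> x z z = 0"
    using assms by (auto simp: alternating_def)
  then show "\<Omega> x y z = - \<Omega> y x z" "\<Omega> x y z = - \<Omega> x z y"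
    by (simp_all add: blinfun.bilinear_simps)
qed

lemma alternating_repeat:
  assumes "alternating \<Omega>"
  shows "\<Omega> x x y = 0" "\<Omega> x y y = 0" "\<Omega> x y x = 0"
  using assms alternating_swap(1)[OF assms, of x y x] by (simp_all add: alternating_def)

lemma trilin_of_apply_blinfun:
  fixes \<Omega> :: "'v::euclidean_space trilin" and f g h :: "'v \<Rightarrow> 'v"
  assumes "linear f" "linear g" "linear h"
  shows "trilin_of (\<lambda>x y z. \<Omega> (f x) (g y) (h z)) x y z = \<Omega> (f x) (g y) (h z)"
  using assms
  by (intro trilin_of_apply[where B = "\<lambda>x y z. \<Omega> (f x) (g y) (h z)"])
     (auto simp: linear_iff blinfun.bilinear_simps)

lemma derivation_apply:
  assumes "linear f"
  shows "derivation f \<Omega> x y z = \<Omega> (f x) y z + \<Omega> x (f y) z + \<Omega> x y (f z)"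
  unfolding derivation_def
  using assms
  by (intro trilin_of_apply[where B = "\<lambda>x y z. \<Omega> (f x) y z + \<Omega> x (f y) z + \<Omega> x y (f z)"])
     (auto simp: linear_iff blinfun.bilinear_simps algebra_simps)

lemma alternating_derivation:
  assumes "linear f" "alternating \<Omega>"
  shows "alternating (derivation f \<Omega>)"
proof -
  have "\<Omega> (f x) x y + \<Omega> x (f x) y + \<Omega> x x (f y) = 0" "\<Omega> (f x) y y + \<Omega> x (f y) y
      + \<Omega> x y (f y) = 0" for x y
    using alternating_swap(1)[OF assms(2), of x "f x" y] alternating_swap(2)[OF assms(2), of x "f y"
        y]
    by (simp_all add: alternating_repeat[OF assms(2)])
  then show ?thesis by (simp add: alternating_def derivation_apply[OF assms(1)])
qed

lemma linear_derivation:
  assumes "linear f"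
  shows "linear (derivation f)"
  by (intro linearI blinfun_eqI)
     (simp_all add: derivation_apply[OF assms] blinfun.bilinear_simps algebra_simps)

definition pull :: "('v \<Rightarrow> 'v) \<Rightarrow> 'v::euclidean_space trilin \<Rightarrow> 'v trilin" where
  "pull g \<Omega> = trilin_of (\<lambda>x y z. \<Omega> (g x) (g y) (g z))"

lemma pull_apply: "linear g \<Longrightarrow> pull g \<Omega> x y z = \<Omega> (g x) (g y) (g z)"
  unfolding pull_def by (rule trilin_of_apply_blinfun)

lemma linear_pull: "linear g \<Longrightarrow> linear (pull g)"
  by (intro linearI blinfun_eqI) (simp_all add: pull_apply blinfun.bilinear_simps)

lemma alternating_pull: "linear g \<Longrightarrow> alternating \<Omega> \<Longrightarrow> alternating (pull g \<Omega>)"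
  by (simp add: alternating_def pull_apply)

text \<open>Tensor products of coordinate functionals. Expansion in them reduces boundedness, finite
  spanning and smoothness for trilinear forms to scalar statements.\<close>

definition elementary_trilin :: "'v::euclidean_space \<Rightarrow> 'v \<Rightarrow> 'v \<Rightarrow> 'v trilin" where
  "elementary_trilin i j k = trilin_of (\<lambda>x y z. (x \<bullet> i) * (y \<bullet> j) * (z \<bullet> k))"

lemma elementary_trilin_apply:
  "elementary_trilin i j k x y z = (x \<bullet> i) * (y \<bullet> j) * (z \<bullet> k)"
  unfolding elementary_trilin_def
  by (rule trilin_of_apply[where B = "\<lambda>x y z. (x \<bullet> i) * (y \<bullet> j) * (z \<bullet> k)"])
     (auto simp: linear_iff algebra_simps)

lemma trilin_expansion:
  fixes \<Omega> :: "'v::euclidean_space trilin"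
  shows "\<Omega> = (\<Sum>i\<in>Basis. \<Sum>j\<in>Basis. \<Sum>k\<in>Basis. \<Omega> i j k *\<^sub>R elementary_trilin i j k)"
proof (intro blinfun_eqI)
  fix x y z :: 'v
  have 1: "\<Omega> x y z = (\<Sum>i\<in>Basis. (x \<bullet> i) * \<Omega> i y z)" for x y z
    by (subst euclidean_representation[of x, symmetric])
       (simp add: blinfun.sum_left blinfun.sum_right blinfun.scaleR_left blinfun.scaleR_right del:
           euclidean_representation)
  have 2: "\<Omega> x y z = (\<Sum>i\<in>Basis. (y \<bullet> i) * \<Omega> x i z)" for x y z
    by (subst euclidean_representation[of y, symmetric])
       (simp add: blinfun.sum_left blinfun.sum_right blinfun.scaleR_left blinfun.scaleR_right del:
           euclidean_representation)
  have 3: "\<Omega> x y z = (\<Sum>i\<in>Basis. (z \<bullet> i) * \<Omega> x y i)" for x y z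
    by (subst euclidean_representation[of z, symmetric])
       (simp add: blinfun.sum_left blinfun.sum_right blinfun.scaleR_left blinfun.scaleR_right del:
           euclidean_representation)
  have "\<Omega> x y z = (\<Sum>i\<in>Basis. (x \<bullet> i) * \<Omega> i y z)" by (rule 1)
  also have "\<dots> = (\<Sum>i\<in>Basis. (x \<bullet> i) * (\<Sum>j\<in>Basis. (y \<bullet> j) * \<Omega> i j z))"
    by (intro sum.cong refl arg_cong2[where f = "(*)"] 2)
  also have "\<dots> = (\<Sum>i\<in>Basis. (x \<bullet> i) * (\<Sum>j\<in>Basis. (y \<bullet> j) * (\<Sum>k\<in>Basis. (z \<bullet> k) * \<Omega> i j k)))"
    by (intro sum.cong refl arg_cong2[where f = "(*)"] 3)
  finally show "\<Omega> x y z = (\<Sum>i\<in>Basis. \<Sum>j\<in>Basis. \<Sum>k\<in>Basis. \<Omega> i j k *\<^sub>R elementary_trilin i j k) x y z"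
    by (simp add: blinfun.sum_left blinfun.scaleR_left elementary_trilin_apply sum_distrib_left
        mult_ac)
qed

lemma bounded_linear_trilin_apply: "bounded_linear (\<lambda>\<Omega>::'v::real_normed_vector trilin. \<Omega> x y z)"
  by (rule bounded_linear_compose[OF blinfun.bounded_linear_left
        bounded_linear_compose[OF blinfun.bounded_linear_left blinfun.bounded_linear_left]])

lemma linear_trilin_imp_bounded:
  fixes f :: "'v::euclidean_space trilin \<Rightarrow> real"
  assumes "linear f"
  shows "bounded_linear f"
proof -
  have "f \<Omega> = (\<Sum>i\<in>Basis. \<Sum>j\<in>Basis. \<Sum>k\<in>Basis. \<Omega> i j k * f (elementary_trilin i j k))" for \<Omega>
  proof -
    have "f \<Omega> = f (\<Sum>i\<in>Basis. \<Sum>j\<in>Basis. \<Sum>k\<in>Basis. \<Omega> i j k *\<^sub>R elementary_trilin i j k)"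
      by (rule arg_cong[OF trilin_expansion])
    also have "\<dots> = (\<Sum>i\<in>Basis. \<Sum>j\<in>Basis. \<Sum>k\<in>Basis. \<Omega> i j k * f (elementary_trilin i j k))"
      using assms by (simp add: linear_sum linear_scale)
    finally show ?thesis .
  qed
  then have "f = (\<lambda>\<Omega>. \<Sum>i\<in>Basis. \<Sum>j\<in>Basis. \<Sum>k\<in>Basis. \<Omega> i j k * f (elementary_trilin i j k))" ..
  moreover have "bounded_linear \<dots>"
    by (intro bounded_linear_sum bounded_linear_compose[OF bounded_linear_mult_left
        bounded_linear_trilin_apply])
  ultimately show ?thesis by simp
qed

lemma trilin_finite_span:
  "\<exists>S. finite S \<and> span S = (UNIV :: 'v::euclidean_space trilin set)"
proof (intro exI conjI)
  let ?S = "(\<lambda>(i, j, k). elementary_trilin i j k) ` (Basis \<times> Basis \<times> Basis) :: 'v trilin set"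
  show "finite ?S" by simp
  have "\<Omega> \<in> span ?S" for \<Omega>
    by (subst trilin_expansion) (intro span_sum span_scale span_base, force)
  then show "span ?S = UNIV" by auto
qed

lemma smooth_on_trilinI:
  fixes X :: "'a::real_normed_vector \<Rightarrow> 'v::euclidean_space trilin"
  assumes "open S" "\<And>x y z. smooth_on S (\<lambda>q. X q x y z)"
  shows "smooth_on S X"
proof -
  have "X = (\<lambda>q. \<Sum>i\<in>Basis. \<Sum>j\<in>Basis. \<Sum>k\<in>Basis. X q i j k *\<^sub>R elementary_trilin i j k)"
    by (intro ext trilin_expansion)
  moreover have "smooth_on S \<dots>"
    by (intro smooth_on_sum smooth_on_scaleR smooth_on_const assms)
  ultimately show ?thesis by simp
qed

text \<open>The value of the wedge of three covectors: a determinant, expanded along the row of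
  \<open>f\<close>.\<close>

definition det3 :: "('v \<Rightarrow> real) \<Rightarrow> ('v \<Rightarrow> real) \<Rightarrow> ('v \<Rightarrow> real) \<Rightarrow> 'v \<Rightarrow> 'v \<Rightarrow> 'v \<Rightarrow> real" where
  "det3 f g h x y z = f x * (g y * h z - g z * h y) - f y * (g x * h z - g z * h x)
     + f z * (g x * h y - g y * h x)"

lemma wedge_covector_form:
  "wedge 1 2 (covector_form \<alpha>) (wedge 1 1 (covector_form \<beta>) (covector_form \<gamma>)) u =
    det3 \<alpha> \<beta> \<gamma> (u 0) (u 1) (u 2)"
proof -
  have "wedge 1 1 (covector_form \<beta>) (covector_form \<gamma>) = (\<lambda>u. \<beta> (u 0) * \<gamma> (u 1) - \<beta> (u 1) * \<gamma> (u 0))"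
    unfolding covector_form_def by (intro ext wedge_1_1)
  then show ?thesis
    unfolding covector_form_def det3_def
    using wedge_1_2[of "\<lambda>x y. \<beta> x * \<gamma> y - \<beta> y * \<gamma> x" \<alpha> u] by simp
qed

lemma omega0_apply:
  "omega0 \<alpha> u = det3 (\<alpha> 1) (\<alpha> 4) (\<alpha> 5) (u 0) (u 1) (u 2)
     + det3 (\<alpha> 2) (\<alpha> 4) (\<alpha> 6) (u 0) (u 1) (u 2) + det3 (\<alpha> 3) (\<alpha> 5) (\<alpha> 6) (u 0) (u 1) (u 2)"
  unfolding omega0_def Let_def wedge_covector_form by (rule refl)

lemma shuffle23_swap:
  assumes s: "\<And>x y. s x y = - s y x"
    and t: "\<And>x y z. t x y z = - t y x z" "\<And>x y z. t x y z = - t x z y"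
  shows "shuffle23 s t b a c d e = - shuffle23 s t a b c d e"
    and "shuffle23 s t a c b d e = - shuffle23 s t a b c d e"
    and "shuffle23 s t a b d c e = - shuffle23 s t a b c d e"
    and "shuffle23 s t a b c e d = - shuffle23 s t a b c d e"
  unfolding shuffle23_def
  by (simp_all add: s[of b a] s[of c b] s[of d c] s[of e d]
    t(1)[of b a] t(1)[of c b] t(1)[of d c] t(1)[of e d]
    t(2)[of _ b a] t(2)[of _ c b] t(2)[of _ d c] t(2)[of _ e d])

text \<open>Makes the 5-form in the equation defining \<open>endo_F\<close> comparable with an
  interior product of the volume form on just six quintuples of frame vectors.\<close>

lemma shuffle23_in_ext_power:
  assumes s: "\<And>x y. s x y = - s y x" "\<And>y. linear (\<lambda>x. s x y)" "\<And>x. linear (s x)"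
    and t: "\<And>x y z. t x y z = - t y x z" "\<And>x y z. t x y z = - t x z y"
      "\<And>y z. linear (\<lambda>x. t x y z)" "\<And>x z. linear (\<lambda>y. t x y z)" "\<And>x y. linear (t x y)"
  shows "(\<lambda>u. shuffle23 s t (u 0) (u 1) (u 2) (u 3) (u 4)) \<in> ext_power 5"
  unfolding ext_power_def mem_Collect_eq
proof (intro conjI allI impI)
  have sw: "shuffle23 s t b a c d e = - shuffle23 s t a b c d e"
    "shuffle23 s t a c b d e = - shuffle23 s t a b c d e"
    "shuffle23 s t a b d c e = - shuffle23 s t a b c d e"
    "shuffle23 s t a b c e d = - shuffle23 s t a b c d e" for a b c d e
    by (rule shuffle23_swap; fact s t)+
  fix u :: "nat \<Rightarrow> 'a" and i j :: nat assume ij: "i < 5" "j < 5" "i \<noteq> j \<and> u i = u j"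
  \<comment> \<open>Repetitions at distance 1, then 2, 3 and 4: swapping neighbours brings the equal
    entries one place closer.\<close>
  have 0: "shuffle23 s t x x c d e = 0" "shuffle23 s t a x x d e = 0" "shuffle23 s t a b x x e = 0"
    "shuffle23 s t a b c x x = 0" for a b c d e x
    using sw(1)[of x x c d e] sw(2)[of a x x d e] sw(3)[of a b x x e] sw(4)[of a b c x x] by
        simp_all
  have 1: "shuffle23 s t x b x d e = 0" "shuffle23 s t a x c x e = 0" "shuffle23 s t a b x d x = 0"
    for a b c d e x
    using sw(1)[of x b x d e] sw(2)[of a x c x e] sw(3)[of a b x d x] by (simp_all add: 0)
  have 2: "shuffle23 s t x b c x e = 0" "shuffle23 s t a x c d x = 0" for a b c d e x
    using sw(1)[of x b c x e] sw(2)[of a x c d x] by (simp_all add: 1)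
  have 3: "shuffle23 s t x b c d x = 0" for b c d x
    using sw(1)[of x b c d x] by (simp add: 2)
  have "\<exists>k<5. \<exists>l<5. k < l \<and> u k = u l"
    using ij by (metis linorder_neqE_nat)
  then obtain k l where "k < 5" "l < 5" "k < l" "u k = u l" by blast
  then have "u 0 = u 1 \<or> u 0 = u 2 \<or> u 0 = u 3 \<or> u 0 = u 4 \<or> u 1 = u 2 \<or> u 1 = u 3 \<or> u 1 = u 4 \<or>
      u 2 = u 3 \<or> u 2 = u 4 \<or> u 3 = u 4"
    by (auto simp: eval_nat_numeral less_Suc_eq)
  then show "shuffle23 s t (u 0) (u 1) (u 2) (u 3) (u 4) = 0"
    by (elim disjE) (simp_all only: 0 1 2 3)
next
  fix u :: "nat \<Rightarrow> 'a" and i :: nat assume i: "i < 5"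
  have lin: "s (x + x') y = s x y + s x' y" "s y (x + x') = s y x + s y x'"
     "s (a *\<^sub>R x) y = a * s x y" "s y (a *\<^sub>R x) = a * s y x"
     "t (x + x') y z = t x y z + t x' y z" "t y (x + x') z = t y x z + t y x' z"
     "t y z (x + x') = t y z x + t y z x'" "t (a *\<^sub>R x) y z = a * t x y z"
         "t y (a *\<^sub>R x) z = a * t y x z"
     "t y z (a *\<^sub>R x) = a * t y z x" for x x' y z a
    using s(2,3) t(3-5) by (auto simp: linear_iff)
  have "linear (\<lambda>x. shuffle23 s t x b c d e)" "linear (\<lambda>x. shuffle23 s t a x c d e)"
    "linear (\<lambda>x. shuffle23 s t a b x d e)" "linear (\<lambda>x. shuffle23 s t a b c x e)"
    "linear (\<lambda>x. shuffle23 s t a b c d x)" for a b c d e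
    by (rule linearI; simp add: shuffle23_def lin algebra_simps)+
  moreover have "i = 0 \<or> i = 1 \<or> i = 2 \<or> i = 3 \<or> i = 4" using i by auto
  ultimately show "linear (\<lambda>x. shuffle23 s t ((u(i := x)) 0) ((u(i := x)) 1) ((u(i := x)) 2)
      ((u(i := x)) 3) ((u(i := x)) 4))"
    by (elim disjE) simp_all
qed (simp add: eval_nat_numeral)

text \<open>The wedge square of a 2-form is twice its Pluecker expression; membership thus means
  that the interior product with \<open>v\<close> is decomposable.\<close>

lemma V0_iff:
  assumes "alternating \<Omega>"
  shows "v \<in> V0 \<Omega> \<longleftrightarrow>
    (\<forall>x y z w. \<Omega> v x y * \<Omega> v z w - \<Omega> v x z * \<Omega> v y w + \<Omega> v x w * \<Omega> v y z = 0)"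
proof -
  have "interior_prod v (form_of \<Omega>) = (\<lambda>u. \<Omega> v (u 0) (u 1))"
    by (simp add: interior_prod_def form_of_def numeral_2_eq_2)
  then have sq: "wedge 2 2 (interior_prod v (form_of \<Omega>)) (interior_prod v (form_of \<Omega>)) u = 2 *
    (\<Omega> v (u 0) (u 1) * \<Omega> v (u 2) (u 3) - \<Omega> v (u 0) (u 2) * \<Omega> v (u 1) (u 3)
        + \<Omega> v (u 0) (u 3) * \<Omega> v (u 1) (u 2))" for u
    by (simp only: wedge_2_2[of "\<lambda>x y. \<Omega> v x y", OF alternating_swap(2)[OF assms]])
  show ?thesis
  proof (intro iffI allI)
    fix x y z w assume "v \<in> V0 \<Omega>"
    then show "\<Omega> v x y * \<Omega> v z w - \<Omega> v x z * \<Omega> v y w + \<Omega> v x w * \<Omega> v y z = 0"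
      using sq[of "\<lambda>i. [x, y, z, w] ! i"] by (simp add: V0_def eval_nat_numeral)
  qed (simp only: V0_def mem_Collect_eq fun_eq_iff sq mult_zero_right simp_thms)
qed


section \<open>Frames\<close>

text \<open>A basis with its dual basis, named one by one: statements about alternating trilinear
  forms then become explicit identities between twenty coordinates.\<close>

locale frame =
  fixes b1 b2 b3 b4 b5 b6 :: "'v::euclidean_space" and \<beta>1 \<beta>2 \<beta>3 \<beta>4 \<beta>5 \<beta>6 :: "'v \<Rightarrow> real"
  assumes linear_coord: "linear \<beta>1" "linear \<beta>2" "linear \<beta>3" "linear \<beta>4" "linear \<beta>5" "linear \<beta>6"
    and dual:
      "\<beta>1 b1 = 1" "\<beta>1 b2 = 0" "\<beta>1 b3 = 0" "\<beta>1 b4 = 0" "\<beta>1 b5 = 0" "\<beta>1 b6 = 0"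
      "\<beta>2 b1 = 0" "\<beta>2 b2 = 1" "\<beta>2 b3 = 0" "\<beta>2 b4 = 0" "\<beta>2 b5 = 0" "\<beta>2 b6 = 0"
      "\<beta>3 b1 = 0" "\<beta>3 b2 = 0" "\<beta>3 b3 = 1" "\<beta>3 b4 = 0" "\<beta>3 b5 = 0" "\<beta>3 b6 = 0"
      "\<beta>4 b1 = 0" "\<beta>4 b2 = 0" "\<beta>4 b3 = 0" "\<beta>4 b4 = 1" "\<beta>4 b5 = 0" "\<beta>4 b6 = 0"
      "\<beta>5 b1 = 0" "\<beta>5 b2 = 0" "\<beta>5 b3 = 0" "\<beta>5 b4 = 0" "\<beta>5 b5 = 1" "\<beta>5 b6 = 0"
      "\<beta>6 b1 = 0" "\<beta>6 b2 = 0" "\<beta>6 b3 = 0" "\<beta>6 b4 = 0" "\<beta>6 b5 = 0" "\<beta>6 b6 = 1"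
    and expand: "\<And>x. x = \<beta>1 x *\<^sub>R b1 + \<beta>2 x *\<^sub>R b2 + \<beta>3 x *\<^sub>R b3 + \<beta>4 x *\<^sub>R b4 + \<beta>5 x *\<^sub>R b5
        + \<beta>6 x *\<^sub>R b6"
begin

lemma coord_simps:
  shows
  "\<beta>1 (x + y) = \<beta>1 x + \<beta>1 y" "\<beta>2 (x + y) = \<beta>2 x + \<beta>2 y" "\<beta>3 (x + y) = \<beta>3 x + \<beta>3 y"
  "\<beta>4 (x + y) = \<beta>4 x + \<beta>4 y" "\<beta>5 (x + y) = \<beta>5 x + \<beta>5 y" "\<beta>6 (x + y) = \<beta>6 x + \<beta>6 y"
  "\<beta>1 (x - y) = \<beta>1 x - \<beta>1 y" "\<beta>2 (x - y) = \<beta>2 x - \<beta>2 y" "\<beta>3 (x - y) = \<beta>3 x - \<beta>3 y"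
  "\<beta>4 (x - y) = \<beta>4 x - \<beta>4 y" "\<beta>5 (x - y) = \<beta>5 x - \<beta>5 y" "\<beta>6 (x - y) = \<beta>6 x - \<beta>6 y"
  "\<beta>1 (a *\<^sub>R x) = a * \<beta>1 x" "\<beta>2 (a *\<^sub>R x) = a * \<beta>2 x" "\<beta>3 (a *\<^sub>R x) = a * \<beta>3 x"
  "\<beta>4 (a *\<^sub>R x) = a * \<beta>4 x" "\<beta>5 (a *\<^sub>R x) = a * \<beta>5 x" "\<beta>6 (a *\<^sub>R x) = a * \<beta>6 x"
  "\<beta>1 (- x) = - \<beta>1 x" "\<beta>2 (- x) = - \<beta>2 x" "\<beta>3 (- x) = - \<beta>3 x"
  "\<beta>4 (- x) = - \<beta>4 x" "\<beta>5 (- x) = - \<beta>5 x" "\<beta>6 (- x) = - \<beta>6 x"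
  "\<beta>1 0 = 0" "\<beta>2 0 = 0" "\<beta>3 0 = 0"
  "\<beta>4 0 = 0" "\<beta>5 0 = 0" "\<beta>6 0 = 0"
  using linear_coord by (simp_all add: linear_add linear_diff linear_neg linear_0 linear_scale)

lemma distinct:
  "b1 \<noteq> b2" "b1 \<noteq> b3" "b1 \<noteq> b4" "b1 \<noteq> b5" "b1 \<noteq> b6" "b2 \<noteq> b1"
  "b2 \<noteq> b3" "b2 \<noteq> b4" "b2 \<noteq> b5" "b2 \<noteq> b6" "b3 \<noteq> b1" "b3 \<noteq> b2"
  "b3 \<noteq> b4" "b3 \<noteq> b5" "b3 \<noteq> b6" "b4 \<noteq> b1" "b4 \<noteq> b2" "b4 \<noteq> b3"
  "b4 \<noteq> b5" "b4 \<noteq> b6" "b5 \<noteq> b1" "b5 \<noteq> b2" "b5 \<noteq> b3" "b5 \<noteq> b4"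
  "b5 \<noteq> b6" "b6 \<noteq> b1" "b6 \<noteq> b2" "b6 \<noteq> b3" "b6 \<noteq> b4" "b6 \<noteq> b5"
  using dual by (metis zero_neq_one)+

lemma coord_eqI:
  assumes "\<beta>1 x = \<beta>1 y" "\<beta>2 x = \<beta>2 y" "\<beta>3 x = \<beta>3 y" "\<beta>4 x = \<beta>4 y" "\<beta>5 x = \<beta>5 y" "\<beta>6 x = \<beta>6 y"
  shows "x = y"
  using expand[of x] expand[of y] assms by simp

lemma linear_expand:
  fixes f :: "'v \<Rightarrow> real"
  assumes "linear f"
  shows "f x = \<beta>1 x * f b1 + \<beta>2 x * f b2 + \<beta>3 x * f b3 + \<beta>4 x * f b4 + \<beta>5 x * f b5 + \<beta>6 x * f b6"
proof -
  have "f x = f (\<beta>1 x *\<^sub>R b1 + \<beta>2 x *\<^sub>R b2 + \<beta>3 x *\<^sub>R b3 + \<beta>4 x *\<^sub>R b4 + \<beta>5 x *\<^sub>R b5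
      + \<beta>6 x *\<^sub>R b6)" by (rule arg_cong[OF expand])
  then show ?thesis using assms by (simp add: linear_add linear_scale)
qed

lemma span_frame: "span {b1, b2, b3, b4, b5, b6} = UNIV"
proof -
  have "x \<in> span {b1, b2, b3, b4, b5, b6}" for x
    by (subst expand[of x]) (intro span_add span_scale span_base; simp)
  then show ?thesis by auto
qed

text \<open>Oriented instances of antisymmetry. Rewriting with them puts frame vectors in increasing
  order and kills repetitions, so that only the twenty coordinates remain.\<close>

lemma sort:
  assumes "alternating \<Omega>"
  shows "\<Omega> x x y = 0" "\<Omega> x y y = 0"
    "\<Omega> b2 b1 x = - \<Omega> b1 b2 x" "\<Omega> x b2 b1 = - \<Omega> x b1 b2"
    "\<Omega> b3 b1 x = - \<Omega> b1 b3 x" "\<Omega> x b3 b1 = - \<Omega> x b1 b3"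
    "\<Omega> b3 b2 x = - \<Omega> b2 b3 x" "\<Omega> x b3 b2 = - \<Omega> x b2 b3"
    "\<Omega> b4 b1 x = - \<Omega> b1 b4 x" "\<Omega> x b4 b1 = - \<Omega> x b1 b4"
    "\<Omega> b4 b2 x = - \<Omega> b2 b4 x" "\<Omega> x b4 b2 = - \<Omega> x b2 b4"
    "\<Omega> b4 b3 x = - \<Omega> b3 b4 x" "\<Omega> x b4 b3 = - \<Omega> x b3 b4"
    "\<Omega> b5 b1 x = - \<Omega> b1 b5 x" "\<Omega> x b5 b1 = - \<Omega> x b1 b5"
    "\<Omega> b5 b2 x = - \<Omega> b2 b5 x" "\<Omega> x b5 b2 = - \<Omega> x b2 b5"
    "\<Omega> b5 b3 x = - \<Omega> b3 b5 x" "\<Omega> x b5 b3 = - \<Omega> x b3 b5"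
    "\<Omega> b5 b4 x = - \<Omega> b4 b5 x" "\<Omega> x b5 b4 = - \<Omega> x b4 b5"
    "\<Omega> b6 b1 x = - \<Omega> b1 b6 x" "\<Omega> x b6 b1 = - \<Omega> x b1 b6"
    "\<Omega> b6 b2 x = - \<Omega> b2 b6 x" "\<Omega> x b6 b2 = - \<Omega> x b2 b6"
    "\<Omega> b6 b3 x = - \<Omega> b3 b6 x" "\<Omega> x b6 b3 = - \<Omega> x b3 b6"
    "\<Omega> b6 b4 x = - \<Omega> b4 b6 x" "\<Omega> x b6 b4 = - \<Omega> x b4 b6"
    "\<Omega> b6 b5 x = - \<Omega> b5 b6 x" "\<Omega> x b6 b5 = - \<Omega> x b5 b6"
  by (rule alternating_repeat[OF assms] alternating_swap[OF assms])+

lemma expand_1: "\<Omega> x y z = \<beta>1 x * \<Omega> b1 y z + \<beta>2 x * \<Omega> b2 y z + \<beta>3 x * \<Omega> b3 y z + \<beta>4 x * \<Omega> b4 y z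
    + \<beta>5 x * \<Omega> b5 y z + \<beta>6 x * \<Omega> b6 y z"
  for \<Omega> :: "'v trilin"
  by (rule linear_expand[of "\<lambda>x. \<Omega> x y z"]) (simp add: linear_iff blinfun.bilinear_simps)

lemma expand_2: "\<Omega> x y z = \<beta>1 y * \<Omega> x b1 z + \<beta>2 y * \<Omega> x b2 z + \<beta>3 y * \<Omega> x b3 z + \<beta>4 y * \<Omega> x b4 z
    + \<beta>5 y * \<Omega> x b5 z + \<beta>6 y * \<Omega> x b6 z"
  for \<Omega> :: "'v trilin"
  by (rule linear_expand[of "\<lambda>y. \<Omega> x y z"]) (simp add: linear_iff blinfun.bilinear_simps)

lemma expand_3: "\<Omega> x y z = \<beta>1 z * \<Omega> x y b1 + \<beta>2 z * \<Omega> x y b2 + \<beta>3 z * \<Omega> x y b3 + \<beta>4 z * \<Omega> x y b4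
    + \<beta>5 z * \<Omega> x y b5 + \<beta>6 z * \<Omega> x y b6"
  for \<Omega> :: "'v trilin"
  by (rule linear_expand[of "\<lambda>z. \<Omega> x y z"]) (simp add: linear_iff blinfun.bilinear_simps)

text \<open>For a frame adapted to a point of the orbit, whose vectors \<open>b1, b2, b3\<close> span \<open>V0\<close>, these are
  the coordinate forms of \<open>\<D>\<^sub>2\<close> and \<open>\<D>\<^sub>1\<close>.\<close>

abbreviation low_coords_0 :: "'v trilin \<Rightarrow> bool" where
  "low_coords_0 \<Omega> \<equiv> \<Omega> b1 b2 b3 = 0 \<and> \<Omega> b1 b2 b4 = 0 \<and> \<Omega> b1 b2 b5 = 0 \<and> \<Omega> b1 b2 b6 = 0 \<and>
      \<Omega> b1 b3 b4 = 0 \<and> \<Omega> b1 b3 b5 = 0 \<and> \<Omega> b1 b3 b6 = 0 \<and> \<Omega> b2 b3 b4 = 0 \<and> \<Omega> b2 b3 b5 = 0 \<and>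
      \<Omega> b2 b3 b6 = 0"

abbreviation top_coords_only :: "'v trilin \<Rightarrow> bool" where
  "top_coords_only \<Omega> \<equiv> \<Omega> b1 b2 b3 = 0 \<and> \<Omega> b1 b2 b4 = 0 \<and> \<Omega> b1 b2 b5 = 0 \<and> \<Omega> b1 b2 b6 = 0 \<and>
      \<Omega> b1 b3 b4 = 0 \<and> \<Omega> b1 b3 b5 = 0 \<and> \<Omega> b1 b3 b6 = 0 \<and> \<Omega> b1 b4 b5 = 0 \<and> \<Omega> b1 b4 b6 = 0 \<and>
      \<Omega> b1 b5 b6 = 0 \<and> \<Omega> b2 b3 b4 = 0 \<and> \<Omega> b2 b3 b5 = 0 \<and> \<Omega> b2 b3 b6 = 0 \<and> \<Omega> b2 b4 b5 = 0 \<and>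
      \<Omega> b2 b4 b6 = 0 \<and> \<Omega> b2 b5 b6 = 0 \<and> \<Omega> b3 b4 b5 = 0 \<and> \<Omega> b3 b4 b6 = 0 \<and> \<Omega> b3 b5 b6 = 0"

lemma alternating_eqI:
  assumes "alternating \<Omega>" "alternating \<Omega>'"
    and "\<Omega> b1 b2 b3 = \<Omega>' b1 b2 b3" "\<Omega> b1 b2 b4 = \<Omega>' b1 b2 b4" "\<Omega> b1 b2 b5 = \<Omega>' b1 b2 b5"
      "\<Omega> b1 b2 b6 = \<Omega>' b1 b2 b6" "\<Omega> b1 b3 b4 = \<Omega>' b1 b3 b4" "\<Omega> b1 b3 b5 = \<Omega>' b1 b3 b5"
      "\<Omega> b1 b3 b6 = \<Omega>' b1 b3 b6" "\<Omega> b1 b4 b5 = \<Omega>' b1 b4 b5" "\<Omega> b1 b4 b6 = \<Omega>' b1 b4 b6"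
      "\<Omega> b1 b5 b6 = \<Omega>' b1 b5 b6" "\<Omega> b2 b3 b4 = \<Omega>' b2 b3 b4" "\<Omega> b2 b3 b5 = \<Omega>' b2 b3 b5"
      "\<Omega> b2 b3 b6 = \<Omega>' b2 b3 b6" "\<Omega> b2 b4 b5 = \<Omega>' b2 b4 b5" "\<Omega> b2 b4 b6 = \<Omega>' b2 b4 b6"
      "\<Omega> b2 b5 b6 = \<Omega>' b2 b5 b6" "\<Omega> b3 b4 b5 = \<Omega>' b3 b4 b5" "\<Omega> b3 b4 b6 = \<Omega>' b3 b4 b6"
      "\<Omega> b3 b5 b6 = \<Omega>' b3 b5 b6" "\<Omega> b4 b5 b6 = \<Omega>' b4 b5 b6"
  shows "\<Omega> = \<Omega>'"
proof (intro blinfun_eqI)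
  fix x y z
  let ?B = "{b1, b2, b3, b4, b5, b6}"
  have all: "\<forall>x\<in>?B. \<forall>y\<in>?B. \<forall>z\<in>?B. \<Omega> x y z = \<Omega>' x y z"
    by (simp add: sort[OF assms(1)] sort[OF assms(2)] assms(3-))
  have 0: "\<Omega> x y z = \<Omega>' x y z" if "x \<in> ?B" "y \<in> ?B" "z \<in> ?B" for x y z
    by (rule all[THEN bspec, THEN bspec, THEN bspec]) (rule that)+
  have lin: "f x = g x" if "linear f" "linear g" "\<And>x. x \<in> ?B \<Longrightarrow> f x = g x" for f g :: "'v \<Rightarrow> real" and
      x
    by (rule linear_eq_on_span[where B = "?B", OF that]) (use span_frame in simp_all)
  have 1: "\<Omega> x y z = \<Omega>' x y z" if "x \<in> ?B" "y \<in> ?B" for x y z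
    by (rule lin[of "\<lambda>z. \<Omega> x y z" "\<lambda>z. \<Omega>' x y z"])
      (simp add: linear_iff blinfun.bilinear_simps, simp add: linear_iff blinfun.bilinear_simps,
          rule 0[OF that])
  have 2: "\<Omega> x y z = \<Omega>' x y z" if "x \<in> ?B" for x y z
    by (rule lin[of "\<lambda>y. \<Omega> x y z" "\<lambda>y. \<Omega>' x y z"])
      (simp add: linear_iff blinfun.bilinear_simps, simp add: linear_iff blinfun.bilinear_simps,
          rule 1[OF that])
  show "\<Omega> x y z = \<Omega>' x y z"
    by (rule lin[of "\<lambda>x. \<Omega> x y z" "\<lambda>x. \<Omega>' x y z"])
      (simp add: linear_iff blinfun.bilinear_simps, simp add: linear_iff blinfun.bilinear_simps,
          rule 2)
qed

end

section \<open>The volume form and an explicit formula for \<open>F\<close>\<close>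

locale volume_frame = frame b1 b2 b3 b4 b5 b6 \<beta>1 \<beta>2 \<beta>3 \<beta>4 \<beta>5 \<beta>6
  for b1 b2 b3 b4 b5 b6 :: "'v::euclidean_space" and \<beta>1 \<beta>2 \<beta>3 \<beta>4 \<beta>5 \<beta>6 :: "'v \<Rightarrow> real" +
  fixes \<theta> :: "'v form"
  assumes volume: "\<theta> \<in> ext_power 6" "\<theta> \<noteq> (\<lambda>_. 0)"
begin

definition vol :: "'v \<Rightarrow> 'v \<Rightarrow> 'v \<Rightarrow> 'v \<Rightarrow> 'v \<Rightarrow> 'v \<Rightarrow> real" where
  "vol x1 x2 x3 x4 x5 x6 = \<theta> (\<lambda>i. [x1, x2, x3, x4, x5, x6] ! i)"

lemma vol_swap:
  "vol x1 x2 x3 x4 x5 x6 = - vol x2 x1 x3 x4 x5 x6"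
  "vol x1 x2 x3 x4 x5 x6 = - vol x1 x3 x2 x4 x5 x6"
  "vol x1 x2 x3 x4 x5 x6 = - vol x1 x2 x4 x3 x5 x6"
  "vol x1 x2 x3 x4 x5 x6 = - vol x1 x2 x3 x5 x4 x6"
  "vol x1 x2 x3 x4 x5 x6 = - vol x1 x2 x3 x4 x6 x5"
proof -
  show "vol x1 x2 x3 x4 x5 x6 = - vol x2 x1 x3 x4 x5 x6"
  proof -
    have "\<theta> (\<lambda>i. [x1, x2, x3, x4, x5, x6] ! i) = \<theta> ((\<lambda>i. [x2, x1, x3, x4, x5, x6] ! i) \<circ>
        Transposition.transpose 0 1)"
      by (rule ext_powerD(1)[OF volume(1)]) (auto simp: eval_nat_numeral less_Suc_eq
          Transposition.transpose_def)
    also have "\<dots> = - vol x2 x1 x3 x4 x5 x6" unfolding vol_def by (rule ext_power_swap[OF volume(1)])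
        simp_all
    finally show ?thesis by (simp only: vol_def)
  qed
  show "vol x1 x2 x3 x4 x5 x6 = - vol x1 x3 x2 x4 x5 x6"
  proof -
    have "\<theta> (\<lambda>i. [x1, x2, x3, x4, x5, x6] ! i) = \<theta> ((\<lambda>i. [x1, x3, x2, x4, x5, x6] ! i) \<circ>
        Transposition.transpose 1 2)"
      by (rule ext_powerD(1)[OF volume(1)]) (auto simp: eval_nat_numeral less_Suc_eq
          Transposition.transpose_def)
    also have "\<dots> = - vol x1 x3 x2 x4 x5 x6" unfolding vol_def by (rule ext_power_swap[OF volume(1)])
        simp_all
    finally show ?thesis by (simp only: vol_def)
  qed
  show "vol x1 x2 x3 x4 x5 x6 = - vol x1 x2 x4 x3 x5 x6"
  proof -
    have "\<theta> (\<lambda>i. [x1, x2, x3, x4, x5, x6] ! i) = \<theta> ((\<lambda>i. [x1, x2, x4, x3, x5, x6] ! i) \<circ>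
        Transposition.transpose 2 3)"
      by (rule ext_powerD(1)[OF volume(1)]) (auto simp: eval_nat_numeral less_Suc_eq
          Transposition.transpose_def)
    also have "\<dots> = - vol x1 x2 x4 x3 x5 x6" unfolding vol_def by (rule ext_power_swap[OF volume(1)])
        simp_all
    finally show ?thesis by (simp only: vol_def)
  qed
  show "vol x1 x2 x3 x4 x5 x6 = - vol x1 x2 x3 x5 x4 x6"
  proof -
    have "\<theta> (\<lambda>i. [x1, x2, x3, x4, x5, x6] ! i) = \<theta> ((\<lambda>i. [x1, x2, x3, x5, x4, x6] ! i) \<circ>
        Transposition.transpose 3 4)"
      by (rule ext_powerD(1)[OF volume(1)]) (auto simp: eval_nat_numeral less_Suc_eq
          Transposition.transpose_def)
    also have "\<dots> = - vol x1 x2 x3 x5 x4 x6" unfolding vol_def by (rule ext_power_swap[OF volume(1)])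
        simp_all
    finally show ?thesis by (simp only: vol_def)
  qed
  show "vol x1 x2 x3 x4 x5 x6 = - vol x1 x2 x3 x4 x6 x5"
  proof -
    have "\<theta> (\<lambda>i. [x1, x2, x3, x4, x5, x6] ! i) = \<theta> ((\<lambda>i. [x1, x2, x3, x4, x6, x5] ! i) \<circ>
        Transposition.transpose 4 5)"
      by (rule ext_powerD(1)[OF volume(1)]) (auto simp: eval_nat_numeral less_Suc_eq
          Transposition.transpose_def)
    also have "\<dots> = - vol x1 x2 x3 x4 x6 x5" unfolding vol_def by (rule ext_power_swap[OF volume(1)])
        simp_all
    finally show ?thesis by (simp only: vol_def)
  qed
qed

lemma vol_repeat:
  "vol x1 x1 x3 x4 x5 x6 = 0"
  "vol x1 x2 x1 x4 x5 x6 = 0"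
  "vol x1 x2 x3 x1 x5 x6 = 0"
  "vol x1 x2 x3 x4 x1 x6 = 0"
  "vol x1 x2 x3 x4 x5 x1 = 0"
  subgoal unfolding vol_def by (rule ext_powerD(3)[OF volume(1), of 0 1]) simp_all
  subgoal unfolding vol_def by (rule ext_powerD(3)[OF volume(1), of 0 2]) simp_all
  subgoal unfolding vol_def by (rule ext_powerD(3)[OF volume(1), of 0 3]) simp_all
  subgoal unfolding vol_def by (rule ext_powerD(3)[OF volume(1), of 0 4]) simp_all
  subgoal unfolding vol_def by (rule ext_powerD(3)[OF volume(1), of 0 5]) simp_all
  done

lemma vol_sort:
  "vol b2 b1 b3 b4 b5 b6 = - vol b1 b2 b3 b4 b5 b6"
  "vol b3 b1 b2 b4 b5 b6 = vol b1 b2 b3 b4 b5 b6"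
  "vol b4 b1 b2 b3 b5 b6 = - vol b1 b2 b3 b4 b5 b6"
  "vol b5 b1 b2 b3 b4 b6 = vol b1 b2 b3 b4 b5 b6"
  "vol b6 b1 b2 b3 b4 b5 = - vol b1 b2 b3 b4 b5 b6"
  subgoal by (simp only: vol_swap(1)[of b2 b1 b3 b4 b5 b6] minus_minus)
  subgoal by (simp only: vol_swap(1)[of b3 b1 b2 b4 b5 b6] vol_swap(2)[of b1 b3 b2 b4 b5 b6]
      minus_minus)
  subgoal by (simp only: vol_swap(1)[of b4 b1 b2 b3 b5 b6] vol_swap(2)[of b1 b4 b2 b3 b5 b6]
      vol_swap(3)[of b1 b2 b4 b3 b5 b6] minus_minus)
  subgoal by (simp only: vol_swap(1)[of b5 b1 b2 b3 b4 b6] vol_swap(2)[of b1 b5 b2 b3 b4 b6]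
      vol_swap(3)[of b1 b2 b5 b3 b4 b6] vol_swap(4)[of b1 b2 b3 b5 b4 b6] minus_minus)
  subgoal by (simp only: vol_swap(1)[of b6 b1 b2 b3 b4 b5] vol_swap(2)[of b1 b6 b2 b3 b4 b5]
      vol_swap(3)[of b1 b2 b6 b3 b4 b5] vol_swap(4)[of b1 b2 b3 b6 b4 b5] vol_swap(5)[of b1 b2 b3 b4
      b6 b5] minus_minus)
  done

lemma interior_volume:
  "interior_prod w \<theta> (\<lambda>i. [x1, x2, x3, x4, x5] ! i) = vol w x1 x2 x3 x4 x5"
  unfolding interior_prod_def vol_def
  by (rule ext_powerD(1)[OF volume(1)]) (auto simp: less_Suc_eq eval_nat_numeral)

text \<open>When \<open>w\<close> is expanded in the frame, only the missing frame vector
  contributes, and sorting it into place gives the alternating signs. Six evaluations therefore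
  recover \<open>w\<close>.\<close>

lemma interior_volume_frame:
  "interior_prod w \<theta> (\<lambda>i. [b2, b3, b4, b5, b6] ! i) = \<beta>1 w * vol b1 b2 b3 b4 b5 b6"
  "interior_prod w \<theta> (\<lambda>i. [b1, b3, b4, b5, b6] ! i) = - \<beta>2 w * vol b1 b2 b3 b4 b5 b6"
  "interior_prod w \<theta> (\<lambda>i. [b1, b2, b4, b5, b6] ! i) = \<beta>3 w * vol b1 b2 b3 b4 b5 b6"
  "interior_prod w \<theta> (\<lambda>i. [b1, b2, b3, b5, b6] ! i) = - \<beta>4 w * vol b1 b2 b3 b4 b5 b6"
  "interior_prod w \<theta> (\<lambda>i. [b1, b2, b3, b4, b6] ! i) = \<beta>5 w * vol b1 b2 b3 b4 b5 b6"
  "interior_prod w \<theta> (\<lambda>i. [b1, b2, b3, b4, b5] ! i) = - \<beta>6 w * vol b1 b2 b3 b4 b5 b6"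
proof -
  have "linear (\<lambda>w. interior_prod w \<theta> u)" for u
    using linear_interior_prod[of \<theta> 5] volume(1) by simp
  note e = linear_expand[OF this, of _ "\<lambda>i. [x1, x2, x3, x4, x5] ! i" for x1 x2 x3 x4 x5, unfolded
      interior_volume]
  show "interior_prod w \<theta> (\<lambda>i. [b2, b3, b4, b5, b6] ! i) = \<beta>1 w * vol b1 b2 b3 b4 b5 b6"
    unfolding interior_volume by (subst e) (simp add: vol_sort vol_repeat)
  show "interior_prod w \<theta> (\<lambda>i. [b1, b3, b4, b5, b6] ! i) = - \<beta>2 w * vol b1 b2 b3 b4 b5 b6"
    unfolding interior_volume by (subst e) (simp add: vol_sort vol_repeat)
  show "interior_prod w \<theta> (\<lambda>i. [b1, b2, b4, b5, b6] ! i) = \<beta>3 w * vol b1 b2 b3 b4 b5 b6"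
    unfolding interior_volume by (subst e) (simp add: vol_sort vol_repeat)
  show "interior_prod w \<theta> (\<lambda>i. [b1, b2, b3, b5, b6] ! i) = - \<beta>4 w * vol b1 b2 b3 b4 b5 b6"
    unfolding interior_volume by (subst e) (simp add: vol_sort vol_repeat)
  show "interior_prod w \<theta> (\<lambda>i. [b1, b2, b3, b4, b6] ! i) = \<beta>5 w * vol b1 b2 b3 b4 b5 b6"
    unfolding interior_volume by (subst e) (simp add: vol_sort vol_repeat)
  show "interior_prod w \<theta> (\<lambda>i. [b1, b2, b3, b4, b5] ! i) = - \<beta>6 w * vol b1 b2 b3 b4 b5 b6"
    unfolding interior_volume by (subst e) (simp add: vol_sort vol_repeat)
qed

lemma card_frame: "card {b1, b2, b3, b4, b5, b6} = 6"
  using distinct by simp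

lemma vol_frame_neq_0: "vol b1 b2 b3 b4 b5 b6 \<noteq> 0"
proof
  assume 0: "vol b1 b2 b3 b4 b5 b6 = 0"
  have "\<theta> = (\<lambda>_. 0)"
  proof (rule ext_power_eq_0I[OF volume(1) span_frame])
    fix A assume "A \<subseteq> {b1, b2, b3, b4, b5, b6}" "card A = 6"
    then have "A = {b1, b2, b3, b4, b5, b6}" using card_frame by (intro card_subset_eq) simp_all
    then show "\<exists>u. u ` {..<6} = A \<and> \<theta> u = 0"
      using 0 by (intro exI[of _ "\<lambda>i. [b1, b2, b3, b4, b5, b6] ! i"]) (auto simp: vol_def
          eval_nat_numeral lessThan_Suc)
  qed
  then show False using volume(2) by simp
qed

lemma ext_power_5_eqI:
  assumes "\<omega> \<in> ext_power 5" "\<eta> \<in> ext_power 5"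
    and "\<omega> (\<lambda>i. [b2, b3, b4, b5, b6] ! i) = \<eta> (\<lambda>i. [b2, b3, b4, b5, b6] ! i)"
        "\<omega> (\<lambda>i. [b1, b3, b4, b5, b6] ! i) = \<eta> (\<lambda>i. [b1, b3, b4, b5, b6] ! i)"
        "\<omega> (\<lambda>i. [b1, b2, b4, b5, b6] ! i) = \<eta> (\<lambda>i. [b1, b2, b4, b5, b6] ! i)"
        "\<omega> (\<lambda>i. [b1, b2, b3, b5, b6] ! i) = \<eta> (\<lambda>i. [b1, b2, b3, b5, b6] ! i)"
        "\<omega> (\<lambda>i. [b1, b2, b3, b4, b6] ! i) = \<eta> (\<lambda>i. [b1, b2, b3, b4, b6] ! i)"
        "\<omega> (\<lambda>i. [b1, b2, b3, b4, b5] ! i) = \<eta> (\<lambda>i. [b1, b2, b3, b4, b5] ! i)"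
  shows "\<omega> = \<eta>"
proof -
  have "(\<lambda>u. \<omega> u - \<eta> u) = (\<lambda>_. 0)"
  proof (rule ext_power_eq_0I[OF ext_power_diff[OF assms(1,2)] span_frame])
    fix A assume A: "A \<subseteq> {b1, b2, b3, b4, b5, b6}" "card A = 5"
    let ?B = "{b1, b2, b3, b4, b5, b6}"
    have "A \<noteq> ?B"
    proof
      assume "A = ?B"
      then have "card A = card ?B" by (rule arg_cong)
      then show False unfolding A(2) card_frame by simp
    qed
    then have "\<not> ?B \<subseteq> A" using subset_antisym[OF A(1)] by argo
    then obtain x where x: "x \<in> ?B" "x \<notin> A" unfolding subset_iff not_all not_imp by (elim exE conjE)
    have "A \<subseteq> ?B - {x}" by (intro subset_Diff_insert[THEN iffD2] conjI x(2)) (simp only: Diff_empty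
        A(1))
    moreover have "card (?B - {x}) = 5" unfolding card_Diff_singleton[OF x(1)] card_frame by simp
    ultimately have "A = ?B - {x}"
      by (intro card_subset_eq finite_Diff) (simp_all only: A(2) finite.intros)
    moreover have "x = b1 \<or> x = b2 \<or> x = b3 \<or> x = b4 \<or> x = b5 \<or> x = b6"
      using x(1) by simp
    ultimately have "A = {b2, b3, b4, b5, b6} \<or> A = {b1, b3, b4, b5, b6} \<or> A = {b1, b2, b4, b5, b6}
        \<or> A = {b1, b2, b3, b5, b6} \<or> A = {b1, b2, b3, b4, b6} \<or> A = {b1, b2, b3, b4, b5}"
      by (elim disjE) (simp_all add: insert_Diff_if distinct)
    then show "\<exists>u. u ` {..<5} = A \<and> \<omega> u - \<eta> u = 0"
    proof (elim disjE)
      assume "A = {b2, b3, b4, b5, b6}"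
      then show ?thesis
        by (intro exI[of _ "\<lambda>i. [b2, b3, b4, b5, b6] ! i"]) (auto simp: assms eval_nat_numeral
            lessThan_Suc)
    next
      assume "A = {b1, b3, b4, b5, b6}"
      then show ?thesis
        by (intro exI[of _ "\<lambda>i. [b1, b3, b4, b5, b6] ! i"]) (auto simp: assms eval_nat_numeral
            lessThan_Suc)
    next
      assume "A = {b1, b2, b4, b5, b6}"
      then show ?thesis
        by (intro exI[of _ "\<lambda>i. [b1, b2, b4, b5, b6] ! i"]) (auto simp: assms eval_nat_numeral
            lessThan_Suc)
    next
      assume "A = {b1, b2, b3, b5, b6}"
      then show ?thesis
        by (intro exI[of _ "\<lambda>i. [b1, b2, b3, b5, b6] ! i"]) (auto simp: assms eval_nat_numeral
            lessThan_Suc)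
    next
      assume "A = {b1, b2, b3, b4, b6}"
      then show ?thesis
        by (intro exI[of _ "\<lambda>i. [b1, b2, b3, b4, b6] ! i"]) (auto simp: assms eval_nat_numeral
            lessThan_Suc)
    next
      assume "A = {b1, b2, b3, b4, b5}"
      then show ?thesis
        by (intro exI[of _ "\<lambda>i. [b1, b2, b3, b4, b5] ! i"]) (auto simp: assms eval_nat_numeral
            lessThan_Suc)
    qed
  qed
  then show ?thesis by (auto simp: fun_eq_iff)
qed

text \<open>Cramer's rule for the equation defining \<open>endo_F\<close>: each coordinate is, up to
  sign, the value of the 5-form on the other five frame vectors divided by the volume of the frame.
  It is quadratic in \<Omega> on all trilinear forms.\<close>

definition F :: "'v trilin \<Rightarrow> 'v \<Rightarrow> 'v" where
  "F \<Omega> v = (1 / vol b1 b2 b3 b4 b5 b6) *\<^sub>R (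
         shuffle23 (\<Omega> v) (\<lambda>x y. \<Omega> x y) b2 b3 b4 b5 b6 *\<^sub>R b1
       - shuffle23 (\<Omega> v) (\<lambda>x y. \<Omega> x y) b1 b3 b4 b5 b6 *\<^sub>R b2
       + shuffle23 (\<Omega> v) (\<lambda>x y. \<Omega> x y) b1 b2 b4 b5 b6 *\<^sub>R b3
       - shuffle23 (\<Omega> v) (\<lambda>x y. \<Omega> x y) b1 b2 b3 b5 b6 *\<^sub>R b4
       + shuffle23 (\<Omega> v) (\<lambda>x y. \<Omega> x y) b1 b2 b3 b4 b6 *\<^sub>R b5
       - shuffle23 (\<Omega> v) (\<lambda>x y. \<Omega> x y) b1 b2 b3 b4 b5 *\<^sub>R b6)"

lemma linear_F: "linear (F \<Omega>)"
  by (rule linearI)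
     (simp_all add: F_def shuffle23_def blinfun.bilinear_simps algebra_simps)

text \<open>The same six evaluations verify the candidate and prove uniqueness. In particular, at
  alternating forms \<open>F\<close> does not depend on the frame used to write it.\<close>

lemma endo_F_eq:
  assumes alt: "alternating \<Omega>"
  shows "endo_F \<theta> \<Omega> = F \<Omega>"
proof -
  have form: "interior_prod v (form_of \<Omega>) = (\<lambda>u. \<Omega> v (u 0) (u 1))" for v
    by (simp add: interior_prod_def form_of_def numeral_2_eq_2)
  have swap: "\<Omega> v x y = - \<Omega> v y x" "\<Omega> x y z = - \<Omega> y x z" for v x y z
    by (rule alternating_swap[OF alt])+
  have w: "wedge 2 3 (interior_prod v (form_of \<Omega>)) (form_of \<Omega>) =
      (\<lambda>u. shuffle23 (\<Omega> v) (\<lambda>x y. \<Omega> x y) (u 0) (u 1) (u 2) (u 3) (u 4))" for v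
    unfolding form unfolding form_of_def
    by (intro ext wedge_2_3[of "\<lambda>x y. \<Omega> v x y" "\<lambda>x y z. \<Omega> x y z"] swap)
  have ext: "(\<lambda>u. shuffle23 (\<Omega> v) (\<lambda>x y. \<Omega> x y) (u 0) (u 1) (u 2) (u 3) (u 4)) \<in> ext_power 5" for v
    by (intro shuffle23_in_ext_power swap) (simp_all add: linear_iff blinfun.bilinear_simps)
  have int: "interior_prod w \<theta> \<in> ext_power 5" for w
    using interior_prod_ext_power[of \<theta> 5] volume(1) by simp
  have coords: "\<beta>1 (F \<Omega> v) = shuffle23 (\<Omega> v) (\<lambda>x y. \<Omega> x y) b2 b3 b4 b5 b6 / vol b1 b2 b3 b4 b5 b6"
      "\<beta>2 (F \<Omega> v) = - shuffle23 (\<Omega> v) (\<lambda>x y. \<Omega> x y) b1 b3 b4 b5 b6 / vol b1 b2 b3 b4 b5 b6"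
      "\<beta>3 (F \<Omega> v) = shuffle23 (\<Omega> v) (\<lambda>x y. \<Omega> x y) b1 b2 b4 b5 b6 / vol b1 b2 b3 b4 b5 b6"
      "\<beta>4 (F \<Omega> v) = - shuffle23 (\<Omega> v) (\<lambda>x y. \<Omega> x y) b1 b2 b3 b5 b6 / vol b1 b2 b3 b4 b5 b6"
      "\<beta>5 (F \<Omega> v) = shuffle23 (\<Omega> v) (\<lambda>x y. \<Omega> x y) b1 b2 b3 b4 b6 / vol b1 b2 b3 b4 b5 b6"
      "\<beta>6 (F \<Omega> v) = - shuffle23 (\<Omega> v) (\<lambda>x y. \<Omega> x y) b1 b2 b3 b4 b5 / vol b1 b2 b3 b4 b5 b6" for v
    by (simp_all add: F_def coord_simps dual)
  have "wedge 2 3 (interior_prod v (form_of \<Omega>)) (form_of \<Omega>) = interior_prod (F \<Omega> v) \<theta>" for v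
    unfolding w
    by (rule ext_power_5_eqI[OF ext int])
       (simp_all only: interior_volume_frame coords, simp_all add: vol_frame_neq_0)
  moreover have "w = F \<Omega> v"
    if "wedge 2 3 (interior_prod v (form_of \<Omega>)) (form_of \<Omega>) = interior_prod w \<theta>" for v w
  proof -
    have e: "interior_prod (F \<Omega> v) \<theta> u = interior_prod w \<theta> u" for u
      using that calculation[of v] by simp
    show ?thesis
      using e[of "\<lambda>i. [b2, b3, b4, b5, b6] ! i"]
        e[of "\<lambda>i. [b1, b3, b4, b5, b6] ! i"]
        e[of "\<lambda>i. [b1, b2, b4, b5, b6] ! i"]
        e[of "\<lambda>i. [b1, b2, b3, b5, b6] ! i"]
        e[of "\<lambda>i. [b1, b2, b3, b4, b6] ! i"]
        e[of "\<lambda>i. [b1, b2, b3, b4, b5] ! i"]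
      by (intro coord_eqI) (simp_all only: interior_volume_frame, simp_all add: vol_frame_neq_0)
  qed
  ultimately show ?thesis
    unfolding endo_F_def by (intro the_equality conjI linear_F allI) (simp, blast)
qed

end

context frame
begin

definition linear_of :: "'v \<Rightarrow> 'v \<Rightarrow> 'v \<Rightarrow> 'v \<Rightarrow> 'v \<Rightarrow> 'v \<Rightarrow> 'v \<Rightarrow> 'v" where
  "linear_of u1 u2 u3 u4 u5 u6 x = \<beta>1 x *\<^sub>R u1 + \<beta>2 x *\<^sub>R u2 + \<beta>3 x *\<^sub>R u3 + \<beta>4 x *\<^sub>R u4
      + \<beta>5 x *\<^sub>R u5 + \<beta>6 x *\<^sub>R u6"

lemma linear_linear_of: "linear (linear_of u1 u2 u3 u4 u5 u6)"
  by (rule linearI) (simp_all add: linear_of_def coord_simps algebra_simps)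

lemma linear_of_frame:
  "linear_of u1 u2 u3 u4 u5 u6 b1 = u1"
  "linear_of u1 u2 u3 u4 u5 u6 b2 = u2"
  "linear_of u1 u2 u3 u4 u5 u6 b3 = u3"
  "linear_of u1 u2 u3 u4 u5 u6 b4 = u4"
  "linear_of u1 u2 u3 u4 u5 u6 b5 = u5"
  "linear_of u1 u2 u3 u4 u5 u6 b6 = u6"
  by (simp_all add: linear_of_def dual)

end


section \<open>Frames adapted to a point of the orbit\<close>

locale adapted_frame = volume_frame b1 b2 b3 b4 b5 b6 \<beta>1 \<beta>2 \<beta>3 \<beta>4 \<beta>5 \<beta>6 \<theta>
  for b1 b2 b3 b4 b5 b6 :: "'v::euclidean_space" and \<beta>1 \<beta>2 \<beta>3 \<beta>4 \<beta>5 \<beta>6 :: "'v \<Rightarrow> real" and \<theta> ::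
      "'v form" +
  fixes \<zeta> :: "'v trilin"
  assumes alt: "alternating \<zeta>"
    and coeff:
      "\<zeta> b1 b2 b3 = 0" "\<zeta> b1 b2 b4 = 0" "\<zeta> b1 b2 b5 = 0" "\<zeta> b1 b2 b6 = 0" "\<zeta> b1 b3 b4 = 0"
      "\<zeta> b1 b3 b5 = 0" "\<zeta> b1 b3 b6 = 0" "\<zeta> b1 b4 b5 = 1" "\<zeta> b1 b4 b6 = 0" "\<zeta> b1 b5 b6 = 0"
      "\<zeta> b2 b3 b4 = 0" "\<zeta> b2 b3 b5 = 0" "\<zeta> b2 b3 b6 = 0" "\<zeta> b2 b4 b5 = 0" "\<zeta> b2 b4 b6 = 1"
      "\<zeta> b2 b5 b6 = 0" "\<zeta> b3 b4 b5 = 0" "\<zeta> b3 b4 b6 = 0" "\<zeta> b3 b5 b6 = 1" "\<zeta> b4 b5 b6 = 0"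
begin

text \<open>In the interior product of \<zeta> with \<open>b4\<close>, \<open>b5\<close> or
  \<open>b6\<close>, wedged with \<zeta>, exactly two products of coordinate covectors survive, and
  they are equal; hence the 2.\<close>

definition \<kappa> :: real where "\<kappa> = 2 / vol b1 b2 b3 b4 b5 b6"

lemma \<kappa>_neq_0: "\<kappa> \<noteq> 0"
  by (simp add: \<kappa>_def vol_frame_neq_0)

lemma F_frame:
  "F \<zeta> b1 = 0" "F \<zeta> b2 = 0" "F \<zeta> b3 = 0"
  "F \<zeta> b4 = - \<kappa> *\<^sub>R b3" "F \<zeta> b5 = \<kappa> *\<^sub>R b2" "F \<zeta> b6 = - \<kappa> *\<^sub>R b1"
  by (simp_all add: F_def shuffle23_def sort[OF alt] coeff \<kappa>_def)

lemma F_apply: "F \<zeta> x = \<kappa> *\<^sub>R (\<beta>5 x *\<^sub>R b2 - \<beta>4 x *\<^sub>R b3 - \<beta>6 x *\<^sub>R b1)"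
proof -
  have "F \<zeta> x = F \<zeta> (\<beta>1 x *\<^sub>R b1 + \<beta>2 x *\<^sub>R b2 + \<beta>3 x *\<^sub>R b3 + \<beta>4 x *\<^sub>R b4 + \<beta>5 x *\<^sub>R b5
      + \<beta>6 x *\<^sub>R b6)" by (rule arg_cong[OF expand])
  then show ?thesis
    by (simp add: linear_add[OF linear_F] linear_scale[OF linear_F] F_frame algebra_simps)
qed

lemma endo_F_\<zeta>: "endo_F \<theta> \<zeta> = F \<zeta>"
  by (rule endo_F_eq[OF alt])

lemma F_square: "F \<zeta> (F \<zeta> x) = 0"
  by (simp add: F_apply coord_simps dual)

abbreviation N :: "'v trilin \<Rightarrow> 'v trilin" where
  "N \<equiv> derivation (F \<zeta>)"

lemma alternating_N: "alternating \<Omega> \<Longrightarrow> alternating (N \<Omega>)"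
  by (rule alternating_derivation[OF linear_F])

text \<open>\<open>F \<zeta>\<close> trades \<open>b4\<close>, \<open>b5\<close>, \<open>b6\<close>
  for vectors of \<open>V0\<close>, so a coordinate of \<open>N \<Omega>\<close> with
  \<open>k\<close> arguments in \<open>V0\<close> involves only coordinates of \<Omega> with
  \<open>k + 1\<close>. All inclusions between images and kernels are read off this table.\<close>

lemma N_coords:
  assumes "alternating \<Omega>"
  shows "N \<Omega> b1 b2 b3 = 0"
    "N \<Omega> b1 b2 b4 = \<kappa> * (- \<Omega> b1 b2 b3)"
    "N \<Omega> b1 b2 b5 = 0"
    "N \<Omega> b1 b2 b6 = 0"
    "N \<Omega> b1 b3 b4 = 0"
    "N \<Omega> b1 b3 b5 = \<kappa> * (- \<Omega> b1 b2 b3)"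
    "N \<Omega> b1 b3 b6 = 0"
    "N \<Omega> b1 b4 b5 = \<kappa> * (- \<Omega> b1 b2 b4 - \<Omega> b1 b3 b5)"
    "N \<Omega> b1 b4 b6 = \<kappa> * (- \<Omega> b1 b3 b6)"
    "N \<Omega> b1 b5 b6 = \<kappa> * (\<Omega> b1 b2 b6)"
    "N \<Omega> b2 b3 b4 = 0"
    "N \<Omega> b2 b3 b5 = 0"
    "N \<Omega> b2 b3 b6 = \<kappa> * (- \<Omega> b1 b2 b3)"
    "N \<Omega> b2 b4 b5 = \<kappa> * (- \<Omega> b2 b3 b5)"
    "N \<Omega> b2 b4 b6 = \<kappa> * (- \<Omega> b1 b2 b4 - \<Omega> b2 b3 b6)"
    "N \<Omega> b2 b5 b6 = \<kappa> * (- \<Omega> b1 b2 b5)"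
    "N \<Omega> b3 b4 b5 = \<kappa> * (\<Omega> b2 b3 b4)"
    "N \<Omega> b3 b4 b6 = \<kappa> * (- \<Omega> b1 b3 b4)"
    "N \<Omega> b3 b5 b6 = \<kappa> * (- \<Omega> b1 b3 b5 - \<Omega> b2 b3 b6)"
    "N \<Omega> b4 b5 b6 = \<kappa> * (- \<Omega> b1 b4 b5 - \<Omega> b2 b4 b6 - \<Omega> b3 b5 b6)"
  by (simp_all add: derivation_apply[OF linear_F] F_frame sort[OF assms] blinfun.bilinear_simps
      algebra_simps)

text \<open>The infinitesimal action of endomorphisms at \<zeta>. The vanishing first entry is the
  one equation of the tangent space.\<close>

lemma derivation_coords:
  assumes "linear A"
  shows "derivation A \<zeta> b1 b2 b3 = 0"
    "derivation A \<zeta> b1 b2 b4 = - \<beta>5 (A b2) + \<beta>6 (A b1)"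
    "derivation A \<zeta> b1 b2 b5 = \<beta>4 (A b2)"
    "derivation A \<zeta> b1 b2 b6 = - \<beta>4 (A b1)"
    "derivation A \<zeta> b1 b3 b4 = - \<beta>5 (A b3)"
    "derivation A \<zeta> b1 b3 b5 = \<beta>4 (A b3) + \<beta>6 (A b1)"
    "derivation A \<zeta> b1 b3 b6 = - \<beta>5 (A b1)"
    "derivation A \<zeta> b1 b4 b5 = \<beta>1 (A b1) + \<beta>4 (A b4) + \<beta>5 (A b5)"
    "derivation A \<zeta> b1 b4 b6 = \<beta>2 (A b1) + \<beta>5 (A b6)"
    "derivation A \<zeta> b1 b5 b6 = \<beta>3 (A b1) - \<beta>4 (A b6)"
    "derivation A \<zeta> b2 b3 b4 = - \<beta>6 (A b3)"
    "derivation A \<zeta> b2 b3 b5 = \<beta>6 (A b2)"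
    "derivation A \<zeta> b2 b3 b6 = \<beta>4 (A b3) - \<beta>5 (A b2)"
    "derivation A \<zeta> b2 b4 b5 = \<beta>1 (A b2) + \<beta>6 (A b5)"
    "derivation A \<zeta> b2 b4 b6 = \<beta>2 (A b2) + \<beta>4 (A b4) + \<beta>6 (A b6)"
    "derivation A \<zeta> b2 b5 b6 = \<beta>3 (A b2) + \<beta>4 (A b5)"
    "derivation A \<zeta> b3 b4 b5 = \<beta>1 (A b3) - \<beta>6 (A b4)"
    "derivation A \<zeta> b3 b4 b6 = \<beta>2 (A b3) + \<beta>5 (A b4)"
    "derivation A \<zeta> b3 b5 b6 = \<beta>3 (A b3) + \<beta>5 (A b5) + \<beta>6 (A b6)"
    "derivation A \<zeta> b4 b5 b6 = \<beta>1 (A b6) - \<beta>2 (A b5) + \<beta>3 (A b4)"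
  by (simp_all add: derivation_apply[OF assms] expand_1[of \<zeta> "A b1"] expand_2[of \<zeta> _ "A b1"]
      expand_3[of \<zeta> _ _ "A b1"] expand_1[of \<zeta> "A b2"] expand_2[of \<zeta> _ "A b2"] expand_3[of \<zeta> _ _
      "A b2"] expand_1[of \<zeta> "A b3"] expand_2[of \<zeta> _ "A b3"] expand_3[of \<zeta> _ _ "A b3"] expand_1[of \<zeta>
      "A b4"] expand_2[of \<zeta> _ "A b4"] expand_3[of \<zeta> _ _ "A b4"] expand_1[of \<zeta> "A b5"] expand_2[of \<zeta>
      _ "A b5"] expand_3[of \<zeta> _ _ "A b5"] expand_1[of \<zeta> "A b6"] expand_2[of \<zeta> _ "A b6"] expand_3[of
      \<zeta> _ _ "A b6"] sort[OF alt] coeff)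

text \<open>\<open>A\<close> inverts the table \<open>derivation_coords\<close>, choosing one
  solution. The last clause concerns \<Omega> in the second distribution: then \<open>A\<close> has
  image in \<open>V0\<close>, which later makes a curve in the orbit a straight line.\<close>

lemma tangent_vector_eq_derivation:
  assumes "alternating \<Omega>" "\<Omega> b1 b2 b3 = 0"
  obtains A where "linear A" "derivation A \<zeta> = \<Omega>"
    and "(\<And>x. \<Omega> b1 b2 x = 0 \<and> \<Omega> b1 b3 x = 0 \<and> \<Omega> b2 b3 x = 0) \<Longrightarrow>
      (\<And>x. \<beta>4 (A x) = 0 \<and> \<beta>5 (A x) = 0 \<and> \<beta>6 (A x) = 0)"
proof -
  \<comment> \<open>The entries \<open>\<beta>6 (A b1)\<close>, \<open>- \<beta>5 (A b2)\<close>,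
    \<open>\<beta>4 (A b3)\<close> occur only through their pairwise sums, at
    \<open>b1 b2 b4\<close>, \<open>b1 b3 b5\<close>, \<open>b2 b3 b6\<close>; these halves solve
    that system.\<close>
  let ?u = "(\<Omega> b1 b2 b4 + \<Omega> b1 b3 b5 - \<Omega> b2 b3 b6) / 2"
  let ?v = "(\<Omega> b1 b2 b4 - \<Omega> b1 b3 b5 + \<Omega> b2 b3 b6) / 2"
  let ?w = "(- \<Omega> b1 b2 b4 + \<Omega> b1 b3 b5 + \<Omega> b2 b3 b6) / 2"
  define A where "A = linear_of
      (\<Omega> b1 b4 b5 *\<^sub>R b1 + \<Omega> b1 b4 b6 *\<^sub>R b2 + \<Omega> b1 b5 b6 *\<^sub>R b3 - \<Omega> b1 b2 b6 *\<^sub>R b4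
        - \<Omega> b1 b3 b6 *\<^sub>R b5 + ?u *\<^sub>R b6)
      (\<Omega> b2 b4 b5 *\<^sub>R b1 + \<Omega> b2 b4 b6 *\<^sub>R b2 + \<Omega> b2 b5 b6 *\<^sub>R b3 + \<Omega> b1 b2 b5 *\<^sub>R b4
        - ?v *\<^sub>R b5 + \<Omega> b2 b3 b5 *\<^sub>R b6)
      (\<Omega> b3 b4 b5 *\<^sub>R b1 + \<Omega> b3 b4 b6 *\<^sub>R b2 + \<Omega> b3 b5 b6 *\<^sub>R b3 + ?w *\<^sub>R b4
        - \<Omega> b1 b3 b4 *\<^sub>R b5 - \<Omega> b2 b3 b4 *\<^sub>R b6)
      (\<Omega> b4 b5 b6 *\<^sub>R b3) 0 0"
  have lin: "linear A"
    unfolding A_def by (rule linear_linear_of)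
  moreover have "derivation A \<zeta> = \<Omega>"
    by (rule alternating_eqI[OF alternating_derivation[OF lin alt] assms(1)])
       (simp_all only: derivation_coords[OF lin], simp_all add: A_def linear_of_frame coord_simps
           dual assms(2) field_simps)
  moreover have "\<beta>4 (A x) = 0 \<and> \<beta>5 (A x) = 0 \<and> \<beta>6 (A x) = 0"
    if "\<And>x. \<Omega> b1 b2 x = 0 \<and> \<Omega> b1 b3 x = 0 \<and> \<Omega> b2 b3 x = 0" for x
    using that by (simp add: A_def linear_of_def coord_simps dual)
  ultimately show ?thesis using that by blast
qed

lemma V0_eq: "V0 \<zeta> = {v. \<beta>4 v = 0 \<and> \<beta>5 v = 0 \<and> \<beta>6 v = 0}"
proof (intro set_eqI iffI)
  fix v assume "v \<in> V0 \<zeta>"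
  then have 0: "\<zeta> v x y * \<zeta> v z w - \<zeta> v x z * \<zeta> v y w + \<zeta> v x w * \<zeta> v y z = 0" for x y z w
    unfolding V0_iff[OF alt] by blast
  show "v \<in> {v. \<beta>4 v = 0 \<and> \<beta>5 v = 0 \<and> \<beta>6 v = 0}"
    \<comment> \<open>Up to sign, these three relations are the squares of
      \<open>\<beta>4 v\<close>, \<open>\<beta>5 v\<close> and \<open>\<beta>6 v\<close>.\<close>
    using 0[of b1 b2 b5 b6] 0[of b1 b3 b4 b6] 0[of b2 b3 b4 b5]
    by (simp add: expand_1[of \<zeta> v] sort[OF alt] coeff)
next
  fix v assume "v \<in> {v. \<beta>4 v = 0 \<and> \<beta>5 v = 0 \<and> \<beta>6 v = 0}"
  then have v: "\<beta>4 v = 0" "\<beta>5 v = 0" "\<beta>6 v = 0" by auto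
  \<comment> \<open>The interior product descends to the 3-dimensional quotient by
    \<open>V0\<close>, where every 2-form is decomposable.\<close>
  have eq: "\<zeta> v x y = \<beta>1 v * (\<beta>4 x * \<beta>5 y - \<beta>5 x * \<beta>4 y) + \<beta>2 v * (\<beta>4 x * \<beta>6 y - \<beta>6 x * \<beta>4 y)
      + \<beta>3 v * (\<beta>5 x * \<beta>6 y - \<beta>6 x * \<beta>5 y)" for x y
    by (simp add: expand_1[of \<zeta> v] v expand_2[of \<zeta> _ x] expand_3[of \<zeta> _ _ y] sort[OF alt] coeff
        algebra_simps)
  show "v \<in> V0 \<zeta>"
    unfolding V0_iff[OF alt] eq by (simp add: algebra_simps)
qed

lemma frame_in_V0: "b1 \<in> V0 \<zeta>" "b2 \<in> V0 \<zeta>" "b3 \<in> V0 \<zeta>"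
  by (simp_all add: V0_eq dual)

end

section \<open>Derivatives of \<open>F\<close> and of pullbacks\<close>

context volume_frame
begin

text \<open>The bilinear map with \<open>F \<Omega> = F2 \<Omega> \<Omega>\<close>.\<close>

definition F2 :: "'v trilin \<Rightarrow> 'v trilin \<Rightarrow> 'v \<Rightarrow> 'v" where
  "F2 \<Omega> \<Omega>' v = (1 / vol b1 b2 b3 b4 b5 b6) *\<^sub>R (
         shuffle23 (\<Omega> v) (\<lambda>x y. \<Omega>' x y) b2 b3 b4 b5 b6 *\<^sub>R b1
       - shuffle23 (\<Omega> v) (\<lambda>x y. \<Omega>' x y) b1 b3 b4 b5 b6 *\<^sub>R b2
       + shuffle23 (\<Omega> v) (\<lambda>x y. \<Omega>' x y) b1 b2 b4 b5 b6 *\<^sub>R b3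
       - shuffle23 (\<Omega> v) (\<lambda>x y. \<Omega>' x y) b1 b2 b3 b5 b6 *\<^sub>R b4
       + shuffle23 (\<Omega> v) (\<lambda>x y. \<Omega>' x y) b1 b2 b3 b4 b6 *\<^sub>R b5
       - shuffle23 (\<Omega> v) (\<lambda>x y. \<Omega>' x y) b1 b2 b3 b4 b5 *\<^sub>R b6)"

lemma shuffle23_has_derivative:
  fixes \<gamma> :: "real \<Rightarrow> 'v trilin"
  assumes "(\<gamma> has_vector_derivative w) (at 0)"
  shows "((\<lambda>t. shuffle23 (\<gamma> t v) (\<lambda>x y. \<gamma> t x y) x1 x2 x3 x4 x5) has_vector_derivative
    shuffle23 (w v) (\<lambda>x y. \<gamma> 0 x y) x1 x2 x3 x4 x5 + shuffle23 (\<gamma> 0 v) (\<lambda>x y. w x y) x1 x2 x3 x4 x5)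
        (at 0)"
proof -
  have d: "((\<lambda>t. \<gamma> t x y z) has_real_derivative w x y z) (at 0)" for x y z
    using bounded_linear.has_vector_derivative[OF bounded_linear_trilin_apply assms]
    by (simp add: has_real_derivative_iff_has_vector_derivative)
  show ?thesis
    unfolding has_real_derivative_iff_has_vector_derivative[symmetric] shuffle23_def
    by (rule derivative_eq_intros d refl)+ (simp add: algebra_simps)
qed

lemma F_has_vector_derivative:
  fixes \<gamma> :: "real \<Rightarrow> 'v trilin"
  assumes "(\<gamma> has_vector_derivative w) (at 0)"
  shows "((\<lambda>t. F (\<gamma> t) v) has_vector_derivative F2 w (\<gamma> 0) v + F2 (\<gamma> 0) w v) (at 0)"
  unfolding F_def
  by (rule has_vector_derivative_eq_rhs, rule bounded_linear.has_vector_derivative[OF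
      bounded_linear_scaleR_right],
      (rule has_vector_derivative_add has_vector_derivative_diff
        bounded_linear.has_vector_derivative[OF bounded_linear_scaleR_left]
            shuffle23_has_derivative[OF assms])+)
     (simp add: F2_def algebra_simps)

lemma smooth_on_F: "open S \<Longrightarrow> smooth_on S (\<lambda>\<Omega>. F \<Omega> v)"
  unfolding F_def shuffle23_def
  by (intro smooth_on_scaleR smooth_on_const smooth_on_add smooth_on_diff smooth_on_mult
      smooth_on_bounded_linear bounded_linear_trilin_apply)

end

lemma smooth_on_derivation:
  assumes "open S" "smooth_on S X" "\<And>v. smooth_on S (\<lambda>q. f q v)" "\<And>q. linear (f q)"
  shows "smooth_on S (\<lambda>q. derivation (f q) (X q))"
proof (rule smooth_on_trilinI[OF assms(1)])
  show "smooth_on S (\<lambda>q. derivation (f q) (X q) x y z)" for x y z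
    unfolding derivation_apply[OF assms(4)]
    by (intro smooth_on_add smooth_on_blinfun_apply smooth_on_const assms)
qed

lemma smooth_on_pull_curve:
  assumes "linear A" "open S"
  shows "smooth_on S (\<lambda>t::real. pull (\<lambda>x. x + t *\<^sub>R A x) \<Omega>)"
proof (rule smooth_on_trilinI[OF assms(2)])
  have lin: "linear (\<lambda>x. x + t *\<^sub>R A x)" for t
    using assms(1) by (auto simp: linear_iff algebra_simps)
  have "smooth_on S (\<lambda>t. x + t *\<^sub>R A x)" for x
    by (intro smooth_on_add smooth_on_const smooth_on_bounded_linear bounded_linear_scaleR_left
        assms(2))
  then show "smooth_on S (\<lambda>t. pull (\<lambda>x. x + t *\<^sub>R A x) \<Omega> x y z)" for x y z
    unfolding pull_apply[OF lin] by (intro smooth_on_blinfun_apply smooth_on_const assms(2))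
qed

text \<open>The affine family \<open>x + t A x\<close> agrees to first order with the exponential of
  \<open>t A\<close>, and pullback along it is polynomial in \<open>t\<close>. Smoothness provides a
  derivative, which is then identified by evaluation.\<close>

lemma pull_curve_has_vector_derivative:
  assumes "linear A"
  shows "((\<lambda>t. pull (\<lambda>x. x + t *\<^sub>R A x) \<Omega>) has_vector_derivative derivation A \<Omega>) (at 0)"
proof -
  let ?\<gamma> = "\<lambda>t::real. pull (\<lambda>x. x + t *\<^sub>R A x) \<Omega>"
  have lin: "linear (\<lambda>x. x + t *\<^sub>R A x)" for t
    using assms(1) by (auto simp: linear_iff algebra_simps)
  have "?\<gamma> differentiable (at 0)"
    using smooth_on_imp_differentiable[OF smooth_on_pull_curve[OF assms open_UNIV]] by simp
  then obtain w where w: "(?\<gamma> has_vector_derivative w) (at 0)"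
    using vector_derivative_works by blast
  have eq: "w x y z = derivation A \<Omega> x y z" for x y z
  proof (rule vector_derivative_unique_at)
    show "((\<lambda>t. ?\<gamma> t x y z) has_vector_derivative w x y z) (at 0)"
      by (rule bounded_linear.has_vector_derivative[OF bounded_linear_trilin_apply w])
    show "((\<lambda>t. ?\<gamma> t x y z) has_vector_derivative derivation A \<Omega> x y z) (at 0)"
      unfolding pull_apply[OF lin] derivation_apply[OF assms]
      by (auto intro!: derivative_eq_intros simp: blinfun.bilinear_simps algebra_simps
            has_real_derivative_iff_has_vector_derivative[symmetric])
  qed
  have "w = derivation A \<Omega>" by (intro blinfun_eqI eq)
  then show ?thesis using w by simp
qed

text \<open>If \<open>K\<close> bounds \<open>A\<close> and \<open>\<bar>t\<bar> K < 1\<close>, then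
  \<open>t A\<close> shrinks every nonzero vector and cannot equal minus the identity on it. This
  keeps the pulled back curve inside the orbit.\<close>

lemma bij_id_plus_small:
  fixes A :: "'v::euclidean_space \<Rightarrow> 'v"
  assumes "linear A"
  obtains e where "e > 0" "\<And>t. \<bar>t\<bar> < e \<Longrightarrow> bij (\<lambda>x. x + t *\<^sub>R A x)"
proof -
  obtain K where K: "K > 0" "\<And>x. norm (A x) \<le> norm x * K"
    using bounded_linear.pos_bounded[of A] assms by (auto simp: linear_conv_bounded_linear)
  have "bij (\<lambda>x. x + t *\<^sub>R A x)" if t: "\<bar>t\<bar> < 1 / K" for t
  proof -
    have lin: "linear (\<lambda>x. x + t *\<^sub>R A x)"
      using assms(1) by (auto simp: linear_iff algebra_simps)
    have "x = 0" if x: "x + t *\<^sub>R A x = 0" for x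
    proof (rule ccontr)
      assume "x \<noteq> 0"
      have "x = - (t *\<^sub>R A x)" using x by (simp add: eq_neg_iff_add_eq_0)
      then have "norm x = \<bar>t\<bar> * norm (A x)" by (metis norm_minus_cancel norm_scaleR)
      also have "\<dots> \<le> \<bar>t\<bar> * (norm x * K)" by (intro mult_left_mono K(2)) simp
      also have "\<dots> = (\<bar>t\<bar> * K) * norm x" by simp
      also have "\<dots> < 1 * norm x"
        using t K(1) \<open>x \<noteq> 0\<close> by (intro mult_strict_right_mono) (auto simp: field_simps)
      finally show False by simp
    qed
    then have "inj (\<lambda>x. x + t *\<^sub>R A x)" using linear_injective_0[OF lin] by blast
    then show ?thesis using linear_injective_imp_surjective[OF lin] by (simp add: bij_def)
  qed
  then show ?thesis using that[of "1 / K"] K(1) by simp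
qed


section \<open>The orbit and its tangent spaces\<close>

lemma exists_dual_vectors:
  fixes \<alpha> :: "nat \<Rightarrow> 'v::euclidean_space \<Rightarrow>\<^sub>L real"
  assumes "DIM('v) = 6" "dual_basis6 \<alpha>"
  shows "\<exists>e. (\<forall>i\<in>{1..6}. \<forall>j\<in>{1..6}. \<alpha> i (e j) = (if i = j then 1 else 0)) \<and>
    (\<forall>x. x = (\<Sum>i\<in>{1..6}. \<alpha> i x *\<^sub>R e i))"
proof -
  have separate: "v = 0" if "\<And>i. i \<in> {1..6} \<Longrightarrow> \<alpha> i v = 0" for v
  proof -
    have "subspace {\<beta>. blinfun_apply \<beta> v = 0}"
      by (auto simp: subspace_def blinfun.bilinear_simps)
    then have "span (\<alpha> ` {1..6}) \<subseteq> {\<beta>. blinfun_apply \<beta> v = 0}"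
      using that by (intro span_minimal) auto
    \<comment> \<open>The inner product with \<open>v\<close> is itself a combination of the
      covectors, so it annihilates \<open>v\<close>.\<close>
    then have "blinfun_inner_left v \<in> {\<beta>. blinfun_apply \<beta> v = 0}"
      using assms(2) unfolding dual_basis6_def by blast
    then show ?thesis by simp
  qed
  \<comment> \<open>Labelling the orthonormal basis by 1 to 6 turns the coordinate map into an
    endomorphism of the space, for which injectivity implies surjectivity.\<close>
  obtain h where h: "bij_betw h {1..6::nat} (Basis :: 'v set)"
    using assms(1) finite_same_card_bij[of "{1..6::nat}" "Basis :: 'v set"] by auto
  define \<phi> where "\<phi> v = (\<Sum>i\<in>{1..6}. \<alpha> i v *\<^sub>R h i)" for v
  have lin: "linear \<phi>"
    unfolding \<phi>_def by (rule linearI) (simp_all add: blinfun.bilinear_simps scaleR_add_left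
        sum.distrib scaleR_sum_right)
  have inner: "h i \<bullet> h j = (if i = j then 1 else 0)" if "i \<in> {1..6}" "j \<in> {1..6}" for i j
  proof -
    have "h i \<in> Basis" "h j \<in> Basis" using bij_betwE[OF h] that by auto
    moreover have "h i = h j \<longleftrightarrow> i = j" using h that by (auto simp only: bij_betw_def inj_on_eq_iff)
    ultimately show ?thesis by (simp add: inner_Basis)
  qed
  have coord: "\<phi> v \<bullet> h j = \<alpha> j v" if "j \<in> {1..6}" for v j
    using that by (simp add: \<phi>_def inner_sum_left inner if_distrib cong: if_cong)
  have "inj \<phi>"
    unfolding linear_injective_0[OF lin]
  proof (intro allI impI separate)
    fix v i assume "\<phi> v = 0" "i \<in> {1..6::nat}"
    then show "\<alpha> i v = 0" using coord[of i v] by simp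
  qed
  then have "surj \<phi>" by (rule linear_injective_imp_surjective[OF lin]) (rule refl)
  define e where "e i = inv \<phi> (h i)" for i
  have e: "\<alpha> i (e j) = (if i = j then 1 else 0)" if "i \<in> {1..6}" "j \<in> {1..6}" for i j
    using coord[of i "e j"] that inner[of j i] by (simp add: e_def surj_f_inv_f[OF \<open>surj \<phi>\<close>])
  have "x = (\<Sum>i\<in>{1..6}. \<alpha> i x *\<^sub>R e i)" for x
  proof -
    have "\<alpha> j (x - (\<Sum>i\<in>{1..6}. \<alpha> i x *\<^sub>R e i)) = 0" if "j \<in> {1..6}" for j
    proof -
      have "(\<Sum>i\<in>{1..6}. \<alpha> i x * \<alpha> j (e i)) = (\<Sum>i\<in>{1..6}. \<alpha> i x * (if j = i then 1 else 0))"
        using that by (intro sum.cong refl) (simp only: e)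
      also have "\<dots> = \<alpha> j x" using that by (simp add: if_distrib cong: if_cong)
      finally show ?thesis by (simp add: blinfun.bilinear_simps blinfun.sum_right)
    qed
    then show ?thesis using separate[of "x - (\<Sum>i\<in>{1..6}. \<alpha> i x *\<^sub>R e i)"] by simp
  qed
  then show ?thesis using e by blast
qed

locale orbit =
  fixes \<alpha> :: "nat \<Rightarrow> 'v::euclidean_space \<Rightarrow>\<^sub>L real" and \<theta> :: "'v form"
  assumes dim: "DIM('v) = 6"
    and dual_basis: "dual_basis6 \<alpha>"
    and theta: "\<theta> \<in> ext_power 6" "\<theta> \<noteq> (\<lambda>_. 0)"
begin

lemma exists_frame: "\<exists>e1 e2 e3 e4 e5 e6. frame e1 e2 e3 e4 e5 e6 (\<alpha> 1) (\<alpha> 2) (\<alpha> 3) (\<alpha> 4) (\<alpha> 5) (\<alpha>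
    6)"
proof -
  obtain e where e: "\<And>i j. i \<in> {1..6} \<Longrightarrow> j \<in> {1..6} \<Longrightarrow> \<alpha> i (e j) = (if i = j then 1 else 0)"
    and x: "\<And>x. x = (\<Sum>i\<in>{1..6}. \<alpha> i x *\<^sub>R e i)"
    using exists_dual_vectors[OF dim dual_basis] by blast
  have 6: "{1..6::nat} = {1, 2, 3, 4, 5, 6}" by auto
  have "frame (e 1) (e 2) (e 3) (e 4) (e 5) (e 6) (\<alpha> 1) (\<alpha> 2) (\<alpha> 3) (\<alpha> 4) (\<alpha> 5) (\<alpha> 6)"
  proof
    show "x = \<alpha> 1 x *\<^sub>R e 1 + \<alpha> 2 x *\<^sub>R e 2 + \<alpha> 3 x *\<^sub>R e 3 + \<alpha> 4 x *\<^sub>R e 4 + \<alpha> 5 x *\<^sub>R e 5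
        + \<alpha> 6 x *\<^sub>R e 6" for x
      using x[of x] unfolding 6 by (simp add: algebra_simps)
  qed (simp_all add: e linear_iff blinfun.bilinear_simps)
  then show ?thesis by blast
qed

text \<open>If \<zeta> is the pullback of the normal form along \<open>g\<close>, the inverse images
  under \<open>g\<close> of the vectors dual to \<alpha> are adapted, with coordinates \<alpha>
  composed with \<open>g\<close>.\<close>

lemma U0_adapted_frame:
  assumes "\<zeta> \<in> U0 \<alpha>"
  shows "\<exists>b1 b2 b3 b4 b5 b6 \<beta>1 \<beta>2 \<beta>3 \<beta>4 \<beta>5 \<beta>6. adapted_frame b1 b2 b3 b4 b5 b6 \<beta>1 \<beta>2 \<beta>3 \<beta>4 \<beta>5 \<beta>6 \<theta>
      \<zeta>"
proof -
  obtain g where g: "linear g" "bij g" "form_of \<zeta> = pullback g (omega0 \<alpha>)"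
    using assms by (auto simp: U0_def)
  obtain e1 e2 e3 e4 e5 e6 where "frame e1 e2 e3 e4 e5 e6 (\<alpha> 1) (\<alpha> 2) (\<alpha> 3) (\<alpha> 4) (\<alpha> 5) (\<alpha> 6)"
    using exists_frame by blast
  then interpret E: frame e1 e2 e3 e4 e5 e6
    "blinfun_apply (\<alpha> 1)" "blinfun_apply (\<alpha> 2)" "blinfun_apply (\<alpha> 3)" "blinfun_apply (\<alpha> 4)"
        "blinfun_apply (\<alpha> 5)" "blinfun_apply (\<alpha> 6)" .
  define g' where "g' = inv g"
  have gg': "g (g' x) = x" "g' (g x) = x" for x
    using g(2) by (simp_all add: g'_def bij_is_surj surj_f_inv_f bij_is_inj)
  have lin': "linear g'"
    unfolding g'_def by (rule inj_linear_imp_inv_linear[OF g(1) bij_is_inj[OF g(2)]])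
  have z: "\<zeta> x y z = det3 (\<alpha> 1) (\<alpha> 4) (\<alpha> 5) (g x) (g y) (g z)
     + det3 (\<alpha> 2) (\<alpha> 4) (\<alpha> 6) (g x) (g y) (g z) + det3 (\<alpha> 3) (\<alpha> 5) (\<alpha> 6) (g x) (g y) (g
         z)" for x y z
  proof -
    have "form_of \<zeta> (\<lambda>i. [x, y, z] ! i) = pullback g (omega0 \<alpha>) (\<lambda>i. [x, y, z] ! i)"
      by (simp only: g(3))
    then show ?thesis by (simp add: form_of_def pullback_def omega0_apply numeral_2_eq_2)
  qed
  have "adapted_frame (g' e1) (g' e2) (g' e3) (g' e4) (g' e5) (g' e6)
    (\<lambda>x. \<alpha> 1 (g x)) (\<lambda>x. \<alpha> 2 (g x)) (\<lambda>x. \<alpha> 3 (g x)) (\<lambda>x. \<alpha> 4 (g x)) (\<lambda>x. \<alpha> 5 (g x)) (\<lambda>x. \<alpha> 6 (g x))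
        \<theta> \<zeta>"
  proof
    fix x
    have "g' (g x) = g' (\<alpha> 1 (g x) *\<^sub>R e1 + \<alpha> 2 (g x) *\<^sub>R e2 + \<alpha> 3 (g x) *\<^sub>R e3 + \<alpha> 4 (g x) *\<^sub>R e4
        + \<alpha> 5 (g x) *\<^sub>R e5 + \<alpha> 6 (g x) *\<^sub>R e6)"
      by (rule arg_cong[OF E.expand])
    then show "x = \<alpha> 1 (g x) *\<^sub>R g' e1 + \<alpha> 2 (g x) *\<^sub>R g' e2 + \<alpha> 3 (g x) *\<^sub>R g' e3
        + \<alpha> 4 (g x) *\<^sub>R g' e4 + \<alpha> 5 (g x) *\<^sub>R g' e5 + \<alpha> 6 (g x) *\<^sub>R g' e6"
      by (simp only: gg' linear_add[OF lin'] linear_scale[OF lin'])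
  next
    show "alternating \<zeta>"
      by (simp add: alternating_def z det3_def algebra_simps)
  qed (simp_all only: gg' E.dual theta z det3_def not_False_eq_True,
       use g(1) in \<open>simp_all add: linear_iff blinfun.bilinear_simps\<close>)
  then show ?thesis by blast
qed

lemma U0_alternating: "\<zeta> \<in> U0 \<alpha> \<Longrightarrow> alternating \<zeta>"
  using U0_adapted_frame adapted_frame.alt by metis

text \<open>Needed for the negative claim: over an empty orbit every distribution would be
  integrable.\<close>

lemma U0_nonempty: "U0 \<alpha> \<noteq> {}"
proof -
  have lin: "linear (\<lambda>x. det3 (\<alpha> i) (\<alpha> j) (\<alpha> k) x y z)" "linear (\<lambda>y. det3 (\<alpha> i) (\<alpha> j) (\<alpha> k) x y z)"
    "linear (\<lambda>z. det3 (\<alpha> i) (\<alpha> j) (\<alpha> k) x y z)" for i j k x y z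
    by (rule linearI; simp add: det3_def blinfun.bilinear_simps algebra_simps)+
  let ?B = "\<lambda>x y z. det3 (\<alpha> 1) (\<alpha> 4) (\<alpha> 5) x y z
     + det3 (\<alpha> 2) (\<alpha> 4) (\<alpha> 6) x y z + det3 (\<alpha> 3) (\<alpha> 5) (\<alpha> 6) x y z"
  have "trilin_of ?B x y z = ?B x y z" for x y z
    by (rule trilin_of_apply[where B = ?B]) (intro linear_compose_add lin)+
  then have "form_of (trilin_of ?B) = pullback (\<lambda>x. x) (omega0 \<alpha>)"
    by (simp add: fun_eq_iff form_of_def pullback_def omega0_apply)
  then show ?thesis
    unfolding U0_def using linear_ident bij_id[unfolded id_def] by blast
qed

lemma U0_pull:
  assumes "\<zeta> \<in> U0 \<alpha>" "linear h" "bij h"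
  shows "pull h \<zeta> \<in> U0 \<alpha>"
proof -
  obtain g where g: "linear g" "bij g" "form_of \<zeta> = pullback g (omega0 \<alpha>)"
    using assms(1) by (auto simp: U0_def)
  have "form_of (pull h \<zeta>) u = form_of \<zeta> (\<lambda>i. h (u i))" for u
    by (simp add: form_of_def pull_apply[OF assms(2)])
  then have "form_of (pull h \<zeta>) = pullback (g \<circ> h) (omega0 \<alpha>)"
    by (simp add: g(3) pullback_def fun_eq_iff)
  then show ?thesis
    using linear_compose[OF assms(2) g(1)] bij_comp[OF assms(3) g(2)] unfolding U0_def by blast
qed

lemma derivation_in_tangent_space:
  assumes "\<zeta> \<in> U0 \<alpha>" "linear A"
  shows "derivation A \<zeta> \<in> tangent_space (U0 \<alpha>) \<zeta>"
proof -
  obtain e where e: "e > 0" "\<And>t. \<bar>t\<bar> < e \<Longrightarrow> bij (\<lambda>x. x + t *\<^sub>R A x)"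
    using bij_id_plus_small[OF assms(2)] by blast
  have lin: "linear (\<lambda>x. x + t *\<^sub>R A x)" for t
    using assms(2) by (auto simp: linear_iff algebra_simps)
  have "pull (\<lambda>x. x + t *\<^sub>R A x) \<zeta> \<in> U0 \<alpha>" if "t \<in> {-e<..<e}" for t
    using that by (intro U0_pull assms(1) lin e(2)) auto
  moreover have "pull (\<lambda>x. x + 0 *\<^sub>R A x) \<zeta> = \<zeta>"
    by (intro blinfun_eqI) (subst pull_apply[OF lin], simp)
  ultimately show ?thesis
    unfolding tangent_space_def
    using e(1) smooth_on_pull_curve[OF assms(2) open_greaterThanLessThan]
      pull_curve_has_vector_derivative[OF assms(2), of \<zeta>] by blast
qed

text \<open>Stated without a frame, because along a curve in the orbit the adapted frame changes
  with the point.\<close>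

lemma endo_F_square:
  assumes "\<zeta> \<in> U0 \<alpha>"
  shows "endo_F \<theta> \<zeta> (endo_F \<theta> \<zeta> x) = 0"
proof -
  obtain b1 b2 b3 b4 b5 b6 \<beta>1 \<beta>2 \<beta>3 \<beta>4 \<beta>5 \<beta>6 where "adapted_frame b1 b2 b3 b4 b5 b6 \<beta>1 \<beta>2 \<beta>3 \<beta>4 \<beta>5
      \<beta>6 \<theta> \<zeta>"
    using U0_adapted_frame[OF assms] by blast
  then interpret adapted_frame b1 b2 b3 b4 b5 b6 \<beta>1 \<beta>2 \<beta>3 \<beta>4 \<beta>5 \<beta>6 \<theta> \<zeta> .
  show ?thesis by (simp add: endo_F_\<zeta> F_square)
qed

end

context frame
begin

text \<open>Independence of the trace from the basis: one and the same scalar can be evaluated in a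
  frame adapted to any point of the orbit.\<close>

lemma trace_frame:
  assumes "linear L"
  shows "(\<Sum>i\<in>Basis. L i \<bullet> i) = \<beta>1 (L b1) + \<beta>2 (L b2) + \<beta>3 (L b3) + \<beta>4 (L b4) + \<beta>5 (L b5)
      + \<beta>6 (L b6)"
proof -
  have lin: "linear (\<lambda>x. \<beta> (L x))" if "linear \<beta>" for \<beta> :: "'v \<Rightarrow> real"
    using linear_compose[OF assms that] by (simp add: o_def)
  have e: "\<beta> (L x) = (\<Sum>i\<in>Basis. (x \<bullet> i) * \<beta> (L i))" if "linear \<beta>" for \<beta> :: "'v \<Rightarrow> real" and x
  proof -
    have "\<beta> (L x) = \<beta> (L (\<Sum>i\<in>Basis. (x \<bullet> i) *\<^sub>R i))" by (simp only: euclidean_representation)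
    then show ?thesis by (simp add: linear_sum[OF lin[OF that]] linear_scale[OF lin[OF that]])
  qed
  have "L i \<bullet> i = \<beta>1 (L i) * (b1 \<bullet> i) + \<beta>2 (L i) * (b2 \<bullet> i) + \<beta>3 (L i) * (b3 \<bullet> i)
      + \<beta>4 (L i) * (b4 \<bullet> i) + \<beta>5 (L i) * (b5 \<bullet> i) + \<beta>6 (L i) * (b6 \<bullet> i)" for i
  proof -
    have "L i \<bullet> i = (\<beta>1 (L i) *\<^sub>R b1 + \<beta>2 (L i) *\<^sub>R b2 + \<beta>3 (L i) *\<^sub>R b3 + \<beta>4 (L i) *\<^sub>R b4
        + \<beta>5 (L i) *\<^sub>R b5 + \<beta>6 (L i) *\<^sub>R b6) \<bullet> i" by (rule arg_cong[OF expand])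
    then show ?thesis by (simp add: inner_add_left)
  qed
  then show ?thesis
    by (simp add: e[OF linear_coord(1), of b1] e[OF linear_coord(2), of b2] e[OF linear_coord(3), of
        b3] e[OF linear_coord(4), of b4] e[OF linear_coord(5), of b5] e[OF linear_coord(6), of b6]
        sum.distrib mult_ac)
qed

end

locale orbit_frame = orbit \<alpha> \<theta> + adapted_frame b1 b2 b3 b4 b5 b6
    \<beta>1 \<beta>2 \<beta>3 \<beta>4 \<beta>5 \<beta>6 \<theta> \<zeta>
  for \<alpha> :: "nat \<Rightarrow> 'v::euclidean_space \<Rightarrow>\<^sub>L real" and \<theta> :: "'v form" and b1 b2 b3 b4 b5 b6 :: 'v
    and \<beta>1 \<beta>2 \<beta>3 \<beta>4 \<beta>5 \<beta>6 :: "'v \<Rightarrow> real" and \<zeta> +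
  assumes \<zeta>: "\<zeta> \<in> U0 \<alpha>"
begin

text \<open>A curve \<open>\<gamma>\<close> in the orbit satisfies \<open>F (\<gamma> t) (F (\<gamma> t) b1) = 0\<close>. The derivative of this equation
  says that the velocity vanishes on \<open>V0\<close>.\<close>

lemma tangent_space_coord:
  assumes "w \<in> tangent_space (U0 \<alpha>) \<zeta>"
  shows "alternating w" "w b1 b2 b3 = 0"
proof -
  obtain \<gamma> e where e: "e > 0" and U: "\<And>t. t \<in> {-e<..<e} \<Longrightarrow> \<gamma> t \<in> U0 \<alpha>"
    and \<gamma>0: "\<gamma> 0 = \<zeta>" and der: "(\<gamma> has_vector_derivative w) (at 0)"
    using assms unfolding tangent_space_def mem_Collect_eq by blast
  have U: "\<gamma> t \<in> U0 \<alpha>" if "\<bar>t\<bar> < e" for t using that by (intro U) auto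
  have "w x x y = 0" "w x y y = 0" for x y
    by (rule has_vector_derivative_bounded_linear_eq_0[OF der bounded_linear_trilin_apply e],
        rule alternating_repeat[OF U0_alternating[OF U]], assumption)+
  then show alt_w: "alternating w" by (simp add: alternating_def)
  define y where "y t = F (\<gamma> t) b1" for t
  define dy where "dy = F2 w \<zeta> b1 + F2 \<zeta> w b1"
  have dy: "(y has_vector_derivative dy) (at 0)"
    using F_has_vector_derivative[OF der, of b1] by (simp add: y_def[abs_def] dy_def \<gamma>0)
  \<comment> \<open>Hence the product rule leaves only the term in which \<open>y\<close>, not the
    outer \<open>F\<close>, is differentiated.\<close>
  have y0: "y 0 = 0" by (simp add: y_def \<gamma>0 F_frame)
  have expF: "F \<Omega> v = \<beta>1 v *\<^sub>R F \<Omega> b1 + \<beta>2 v *\<^sub>R F \<Omega> b2 + \<beta>3 v *\<^sub>R F \<Omega> b3 + \<beta>4 v *\<^sub>R F \<Omega> b4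
      + \<beta>5 v *\<^sub>R F \<Omega> b5 + \<beta>6 v *\<^sub>R F \<Omega> b6" for \<Omega> v
  proof -
    have "F \<Omega> v = F \<Omega> (\<beta>1 v *\<^sub>R b1 + \<beta>2 v *\<^sub>R b2 + \<beta>3 v *\<^sub>R b3 + \<beta>4 v *\<^sub>R b4 + \<beta>5 v *\<^sub>R b5
        + \<beta>6 v *\<^sub>R b6)" by (rule arg_cong[OF expand])
    then show ?thesis by (simp add: linear_add[OF linear_F] linear_scale[OF linear_F])
  qed
  have coord: "((\<lambda>t. \<beta> (y t)) has_vector_derivative \<beta> dy) (at 0)" if "linear \<beta>" for \<beta> :: "'v \<Rightarrow> real"
    using that by (intro bounded_linear.has_vector_derivative[OF _ dy]) (simp add:
        linear_conv_bounded_linear)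
  have dFF: "((\<lambda>t. F (\<gamma> t) (y t)) has_vector_derivative F \<zeta> dy) (at 0)"
  proof -
    have prod: "((\<lambda>t. \<beta> (y t) *\<^sub>R F (\<gamma> t) x) has_vector_derivative \<beta> dy *\<^sub>R F \<zeta> x) (at 0)"
      if "linear \<beta>" for \<beta> x
      using has_vector_derivative_scaleR[OF coord[OF that, folded
          has_real_derivative_iff_has_vector_derivative]
          F_has_vector_derivative[OF der, of x]] that
      by (simp add: y0 \<gamma>0 linear_0)
    show ?thesis
      unfolding expF[of "\<gamma> _" "y _"] expF[of \<zeta> dy]
      by (intro has_vector_derivative_add prod linear_coord)
  qed
  have FF: "F (\<gamma> t) (y t) = 0" if "\<bar>t\<bar> < e" for t
    using endo_F_square[OF U[OF that]] by (simp add: y_def endo_F_eq[OF U0_alternating[OF U[OF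
        that]]])
  \<comment> \<open>This coordinate is \<open>- \<kappa>\<close> times \<open>\<beta>6 dy\<close>,
    which in turn is a nonzero multiple of \<open>w b1 b2 b3\<close>.\<close>
  have "\<beta>1 (F \<zeta> dy) = 0"
    by (rule has_vector_derivative_bounded_linear_eq_0[OF dFF _ e])
       (simp_all add: FF linear_coord linear_conv_bounded_linear[symmetric] coord_simps)
  then have "\<beta>6 dy = 0"
    using \<kappa>_neq_0 by (simp add: F_apply coord_simps dual)
  then show "w b1 b2 b3 = 0"
    using vol_frame_neq_0
    by (simp add: dy_def F2_def coord_simps dual shuffle23_def sort[OF alt] sort[OF alt_w] coeff
        field_simps)
qed

lemma tangent_space_iff:
  "\<Omega> \<in> tangent_space (U0 \<alpha>) \<zeta> \<longleftrightarrow> alternating \<Omega> \<and> \<Omega> b1 b2 b3 = 0"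
  using tangent_space_coord tangent_vector_eq_derivation derivation_in_tangent_space[OF \<zeta>] by metis

lemma tensor_N_eq: "tensor_N \<theta> \<zeta> = N"
  by (simp add: tensor_N_def endo_F_\<zeta>)

lemma N_in_tangent_space:
  "\<Omega> \<in> tangent_space (U0 \<alpha>) \<zeta> \<Longrightarrow> N \<Omega> \<in> tangent_space (U0 \<alpha>) \<zeta>"
  by (simp add: tangent_space_iff alternating_N N_coords)

lemma alternating_0: "alternating (0 :: 'v trilin)"
  by (simp add: alternating_def)

lemma zero_iff_coords:
  assumes "alternating \<Omega>"
  shows "\<Omega> = 0 \<longleftrightarrow> top_coords_only \<Omega> \<and> \<Omega> b4 b5 b6 = 0"
proof (intro iffI)
  assume "top_coords_only \<Omega> \<and> \<Omega> b4 b5 b6 = 0"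
  then show "\<Omega> = 0"
    by (intro alternating_eqI[OF assms alternating_0]) simp_all
qed simp

text \<open>Three entries of \<open>N \<Omega>\<close> are pairwise sums of the coordinates at
  \<open>b1 b2 b4\<close>, \<open>b1 b3 b5\<close>, \<open>b2 b3 b6\<close>; if all three sums
  vanish, so does each coordinate.\<close>

lemma ker_N_1_iff:
  "\<Omega> \<in> ker_N \<alpha> \<theta> 1 \<zeta> \<longleftrightarrow> alternating \<Omega> \<and> low_coords_0 \<Omega> \<and>
     \<Omega> b1 b4 b5 + \<Omega> b2 b4 b6 + \<Omega> b3 b5 b6 = 0"
proof -
  have "\<Omega> b1 b2 b3 = 0 \<and> N \<Omega> = 0 \<longleftrightarrow> low_coords_0 \<Omega> \<and>
     \<Omega> b1 b4 b5 + \<Omega> b2 b4 b6 + \<Omega> b3 b5 b6 = 0" if "alternating \<Omega>"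
    unfolding zero_iff_coords[OF alternating_N[OF that]] N_coords[OF that]
    using \<kappa>_neq_0 by simp linarith
  then show ?thesis
    unfolding ker_N_def mem_Collect_eq tangent_space_iff tensor_N_eq funpow_simps_right One_nat_def
        o_def id_def conj_assoc
    by (intro conj_cong refl) simp
qed

text \<open>On tangent vectors only the coordinate at \<open>b4 b5 b6\<close> survives two
  applications of \<open>N\<close>, so the kernel is the zero set of a single functional.\<close>

lemma ker_N_2_iff:
  "\<Omega> \<in> ker_N \<alpha> \<theta> 2 \<zeta> \<longleftrightarrow> alternating \<Omega> \<and> \<Omega> b1 b2 b3 = 0 \<and>
     \<Omega> b1 b2 b4 + \<Omega> b1 b3 b5 + \<Omega> b2 b3 b6 = 0"
proof -
  have "N (N \<Omega>) = 0 \<longleftrightarrow> \<Omega> b1 b2 b4 + \<Omega> b1 b3 b5 + \<Omega> b2 b3 b6 = 0"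
    if "alternating \<Omega>" "\<Omega> b1 b2 b3 = 0"
  proof -
    have "N (N \<Omega>) b4 b5 b6 = 2 * \<kappa>^2 * (\<Omega> b1 b2 b4 + \<Omega> b1 b3 b5 + \<Omega> b2 b3 b6)"
      by (simp add: N_coords[OF alternating_N[OF that(1)]] N_coords[OF that(1)] algebra_simps
          power2_eq_square)
    then show ?thesis
      using \<kappa>_neq_0 that(2)
      by (simp add: zero_iff_coords[OF alternating_N[OF alternating_N[OF that(1)]]]
          N_coords(1-19)[OF alternating_N[OF that(1)]] N_coords(1-19)[OF that(1)])
  qed
  then show ?thesis
    unfolding ker_N_def mem_Collect_eq tangent_space_iff tensor_N_eq numeral_2_eq_2
        funpow_simps_right o_def id_def conj_assoc
    by (intro conj_cong refl) simp
qed

lemma im_N_1_iff: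
  "\<Omega> \<in> im_N \<alpha> \<theta> 1 \<zeta> \<longleftrightarrow> alternating \<Omega> \<and> low_coords_0 \<Omega>"
proof
  assume "\<Omega> \<in> im_N \<alpha> \<theta> 1 \<zeta>"
  then obtain \<Omega>' where "\<Omega> = N \<Omega>'" "alternating \<Omega>'" "\<Omega>' b1 b2 b3 = 0"
    by (auto simp: im_N_def tangent_space_iff tensor_N_eq)
  then show "alternating \<Omega> \<and> low_coords_0 \<Omega>"
    by (simp add: alternating_N N_coords)
next
  assume \<Omega>: "alternating \<Omega> \<and> low_coords_0 \<Omega>"
  \<comment> \<open>These are the pairwise sums required of three coordinates of the preimage, and
    those coordinates are again pairwise sums of entries of \<open>A\<close>. Inverting both systems
    gives \<open>(3 p - q - r) / 4\<close> and its analogues.\<close>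
  let ?p = "- \<Omega> b1 b4 b5 / \<kappa>" and ?q = "- \<Omega> b2 b4 b6 / \<kappa>" and ?r = "- \<Omega> b3 b5 b6 / \<kappa>"
  define A where "A = linear_of
      (- (\<Omega> b4 b5 b6 / \<kappa>) *\<^sub>R b1 - (\<Omega> b1 b5 b6 / \<kappa>) *\<^sub>R b4 + (\<Omega> b1 b4 b6 / \<kappa>) *\<^sub>R b5 + ((3 * ?p - ?q
          - ?r) / 4) *\<^sub>R b6)
      (- (\<Omega> b2 b5 b6 / \<kappa>) *\<^sub>R b4 - ((3 * ?q - ?p - ?r) / 4) *\<^sub>R b5 - (\<Omega> b2 b4 b5 / \<kappa>) *\<^sub>R b6)
      (((3 * ?r - ?p - ?q) / 4) *\<^sub>R b4 + (\<Omega> b3 b4 b6 / \<kappa>) *\<^sub>R b5 - (\<Omega> b3 b4 b5 / \<kappa>) *\<^sub>R b6)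
      0 0 0"
  have lin: "linear A" unfolding A_def by (rule linear_linear_of)
  have alt': "alternating (derivation A \<zeta>)" by (rule alternating_derivation[OF lin alt])
  have "N (derivation A \<zeta>) = \<Omega>"
    by (rule alternating_eqI[OF alternating_N[OF alt'] conjunct1[OF \<Omega>]])
       (simp_all only: N_coords[OF alt'] derivation_coords[OF lin],
        simp_all add: A_def linear_of_frame coord_simps dual \<Omega> \<kappa>_neq_0 field_simps)
  then show "\<Omega> \<in> im_N \<alpha> \<theta> 1 \<zeta>"
    using derivation_in_tangent_space[OF \<zeta> lin] by (auto simp: im_N_def tensor_N_eq)
qed

lemma im_N_2_iff:
  "\<Omega> \<in> im_N \<alpha> \<theta> 2 \<zeta> \<longleftrightarrow> alternating \<Omega> \<and> top_coords_only \<Omega>"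
proof
  assume "\<Omega> \<in> im_N \<alpha> \<theta> 2 \<zeta>"
  then obtain \<Omega>' where "\<Omega> = N (N \<Omega>')" "alternating \<Omega>'" "\<Omega>' b1 b2 b3 = 0"
    by (auto simp: im_N_def tangent_space_iff tensor_N_eq numeral_2_eq_2)
  then show "alternating \<Omega> \<and> top_coords_only \<Omega>"
    by (simp add: alternating_N N_coords)
next
  assume \<Omega>: "alternating \<Omega> \<and> top_coords_only \<Omega>"
  \<comment> \<open>Sending \<open>b1\<close> to \<open>c\<close> times \<open>b6\<close> puts
    \<open>c\<close> into the coordinates at \<open>b1 b2 b4\<close> and \<open>b1 b3 b5\<close>;
    two applications of \<open>N\<close> turn their sum into \<open>4 \<kappa>^2 c\<close>.\<close>
  define A where "A = linear_of ((\<Omega> b4 b5 b6 / (4 * \<kappa>^2)) *\<^sub>R b6) 0 0 0 0 0"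
  have lin: "linear A" unfolding A_def by (rule linear_linear_of)
  have alt': "alternating (derivation A \<zeta>)" by (rule alternating_derivation[OF lin alt])
  have "N (N (derivation A \<zeta>)) = \<Omega>"
    by (rule alternating_eqI[OF alternating_N[OF alternating_N[OF alt']] conjunct1[OF \<Omega>]])
       (simp_all only: N_coords[OF alternating_N[OF alt']] N_coords[OF alt'] derivation_coords[OF
           lin],
        simp_all add: A_def linear_of_frame coord_simps dual \<Omega> \<kappa>_neq_0 field_simps power2_eq_square)
  then show "\<Omega> \<in> im_N \<alpha> \<theta> 2 \<zeta>"
    using derivation_in_tangent_space[OF \<zeta> lin] by (auto simp: im_N_def tensor_N_eq numeral_2_eq_2)
qed

text \<open>The left side refers to an adapted frame, the trace does not. The equation of the kernel
  of the square thus takes a form that makes sense at all points of the orbit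
  simultaneously.\<close>

lemma derivation_trace:
  assumes "linear A"
  shows "derivation A \<zeta> b1 b2 b4 + derivation A \<zeta> b1 b3 b5 + derivation A \<zeta> b2 b3 b6 =
    - (2 / \<kappa>) * (\<Sum>i\<in>Basis. F \<zeta> (A i) \<bullet> i)"
  unfolding trace_frame[OF linear_compose[OF assms linear_F, unfolded o_def]]
  using \<kappa>_neq_0 by (simp add: derivation_coords[OF assms] F_apply coord_simps dual field_simps)

text \<open>The fibre depends on \<zeta> only through \<open>V0 \<zeta>\<close>, so it is constant
  along curves that fix \<open>V0\<close>.\<close>

lemma im_N_1_iff_V0:
  "\<Omega> \<in> im_N \<alpha> \<theta> 1 \<zeta> \<longleftrightarrow> alternating \<Omega> \<and> (\<forall>x\<in>V0 \<zeta>. \<forall>y\<in>V0 \<zeta>. \<forall>z. \<Omega> x y z = 0)"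
  unfolding im_N_1_iff
proof (intro conj_cong refl iffI ballI allI)
  fix x y z assume alt': "alternating \<Omega>" and "low_coords_0 \<Omega>" "x \<in> V0 \<zeta>" "y \<in> V0 \<zeta>"
  then show "\<Omega> x y z = 0"
    by (simp add: V0_eq expand_1[of \<Omega> x] expand_2[of \<Omega> _ y] expand_3[of \<Omega> _ _ z] sort[OF alt'])
next
  assume "\<forall>x\<in>V0 \<zeta>. \<forall>y\<in>V0 \<zeta>. \<forall>z. \<Omega> x y z = 0"
  then show "low_coords_0 \<Omega>"
    using frame_in_V0 by blast
qed

lemma im_N_2_iff_V0:
  "\<Omega> \<in> im_N \<alpha> \<theta> 2 \<zeta> \<longleftrightarrow> alternating \<Omega> \<and> (\<forall>x\<in>V0 \<zeta>. \<forall>y z. \<Omega> x y z = 0)"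
  unfolding im_N_2_iff
proof (intro conj_cong refl iffI ballI allI)
  fix x y z assume alt': "alternating \<Omega>" and "top_coords_only \<Omega>" "x \<in> V0 \<zeta>"
  then show "\<Omega> x y z = 0"
    by (simp add: V0_eq expand_1[of \<Omega> x] expand_2[of \<Omega> _ y] expand_3[of \<Omega> _ _ z] sort[OF alt'])
next
  assume "\<forall>x\<in>V0 \<zeta>. \<forall>y z. \<Omega> x y z = 0"
  then show "top_coords_only \<Omega>"
    using frame_in_V0 by blast
qed

text \<open>Tangency is automatic on the image side: the vanishing conditions include the triple
  \<open>b1\<close>, \<open>b2\<close>, \<open>b3\<close> of vectors in \<open>V0\<close>.\<close>

lemma distr_D_eq: "im_N \<alpha> \<theta> 2 \<zeta> = distr_D \<alpha> 1 \<zeta>" "im_N \<alpha> \<theta> 1 \<zeta> = distr_D \<alpha> 2 \<zeta>"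
proof -
  have 1: "(\<forall>u. (\<forall>j<1. u j \<in> V0 \<zeta>) \<longrightarrow> form_of \<Omega> u = 0) \<longleftrightarrow> (\<forall>x\<in>V0 \<zeta>. \<forall>y z. \<Omega> x y z = 0)"
    for \<Omega> :: "'v trilin"
  proof (intro iffI ballI allI)
    fix x y z assume "\<forall>u. (\<forall>j<1. u j \<in> V0 \<zeta>) \<longrightarrow> form_of \<Omega> u = 0" "x \<in> V0 \<zeta>"
    then show "\<Omega> x y z = 0"
      by (auto simp: form_of_def numeral_2_eq_2 dest!: spec[of _ "\<lambda>i. [x, y, z] ! i"])
  qed (simp add: form_of_def)
  have 2: "(\<forall>u. (\<forall>j<2. u j \<in> V0 \<zeta>) \<longrightarrow> form_of \<Omega> u = 0) \<longleftrightarrow>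
      (\<forall>x\<in>V0 \<zeta>. \<forall>y\<in>V0 \<zeta>. \<forall>z. \<Omega> x y z = 0)"
    for \<Omega> :: "'v trilin"
  proof (intro iffI ballI allI)
    fix x y z assume "\<forall>u. (\<forall>j<2. u j \<in> V0 \<zeta>) \<longrightarrow> form_of \<Omega> u = 0" "x \<in> V0 \<zeta>" "y \<in> V0 \<zeta>"
    then show "\<Omega> x y z = 0"
      by (auto simp: form_of_def numeral_2_eq_2 less_Suc_eq dest!: spec[of _ "\<lambda>i. [x, y, z] ! i"])
  qed (simp add: form_of_def)
  show "im_N \<alpha> \<theta> 2 \<zeta> = distr_D \<alpha> 1 \<zeta>"
    using frame_in_V0(1) unfolding set_eq_iff im_N_2_iff_V0 distr_D_def mem_Collect_eq
        tangent_space_iff 1 by blast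
  show "im_N \<alpha> \<theta> 1 \<zeta> = distr_D \<alpha> 2 \<zeta>"
    using frame_in_V0(1,2) unfolding set_eq_iff im_N_1_iff_V0 distr_D_def mem_Collect_eq
        tangent_space_iff 2 by blast
qed

end

lemma V0_pull:
  assumes "alternating \<zeta>" "linear g" "bij g"
  shows "v \<in> V0 (pull g \<zeta>) \<longleftrightarrow> g v \<in> V0 \<zeta>"
proof -
  have s: "(\<forall>x. P (g x)) \<longleftrightarrow> (\<forall>x. P x)" for P
    using bij_is_surj[OF assms(3)] by (metis surjD)
  show ?thesis
    unfolding V0_iff[OF assms(1)] V0_iff[OF alternating_pull[OF assms(2,1)]] pull_apply[OF assms(2)]
    by (subst s, subst s, subst s, subst s) (rule refl)
qed

section \<open>Homogeneity and linearity of the fibres\<close>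

context orbit
begin

lemma U0_orbit_frame:
  assumes "\<zeta> \<in> U0 \<alpha>"
  obtains b1 b2 b3 b4 b5 b6 \<beta>1 \<beta>2 \<beta>3 \<beta>4 \<beta>5 \<beta>6 where "orbit_frame \<alpha> \<theta> b1 b2 b3 b4 b5 b6 \<beta>1 \<beta>2 \<beta>3 \<beta>4
      \<beta>5 \<beta>6 \<zeta>"
  using U0_adapted_frame[OF assms] orbit_axioms assms
  by (auto simp: orbit_frame_def orbit_frame_axioms_def)

text \<open>The coordinate equations of the four fibres do not contain \<kappa>. Pullback along the
  isomorphism matching the two frames therefore carries fibres to fibres, even if the frames have
  different volumes.\<close>

lemma frame_transport:
  assumes "orbit_frame \<alpha> \<theta> b1 b2 b3 b4 b5 b6 \<beta>1 \<beta>2 \<beta>3 \<beta>4 \<beta>5 \<beta>6 p"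
      "orbit_frame \<alpha> \<theta> c1 c2 c3 c4 c5 c6 \<gamma>1 \<gamma>2 \<gamma>3 \<gamma>4 \<gamma>5 \<gamma>6 q"
  shows "\<exists>\<Phi>. linear \<Phi> \<and> \<Phi> ` im_N \<alpha> \<theta> 2 p = im_N \<alpha> \<theta> 2 q \<and> \<Phi> ` ker_N \<alpha> \<theta> 1 p = ker_N \<alpha> \<theta> 1 q \<and>
    \<Phi> ` im_N \<alpha> \<theta> 1 p = im_N \<alpha> \<theta> 1 q \<and> \<Phi> ` ker_N \<alpha> \<theta> 2 p = ker_N \<alpha> \<theta> 2 q"
proof -
  interpret P: orbit_frame \<alpha> \<theta> b1 b2 b3 b4 b5 b6 \<beta>1 \<beta>2 \<beta>3 \<beta>4 \<beta>5 \<beta>6 p by (rule assms(1))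
  interpret Q: orbit_frame \<alpha> \<theta> c1 c2 c3 c4 c5 c6 \<gamma>1 \<gamma>2 \<gamma>3 \<gamma>4 \<gamma>5 \<gamma>6 q by (rule assms(2))
  define g where "g = Q.linear_of b1 b2 b3 b4 b5 b6"
  define h where "h = P.linear_of c1 c2 c3 c4 c5 c6"
  have lin: "linear g" "linear h"
    unfolding g_def h_def by (rule Q.linear_linear_of P.linear_linear_of)+
  have g: "g c1 = b1" "g c2 = b2" "g c3 = b3" "g c4 = b4" "g c5 = b5" "g c6 = b6"
    by (simp_all add: g_def Q.linear_of_frame)
  have h: "h b1 = c1" "h b2 = c2" "h b3 = c3" "h b4 = c4" "h b5 = c5" "h b6 = c6"
    by (simp_all add: h_def P.linear_of_frame)
  have gh: "g (h x) = x" for x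
  proof -
    have "h x = \<beta>1 x *\<^sub>R c1 + \<beta>2 x *\<^sub>R c2 + \<beta>3 x *\<^sub>R c3 + \<beta>4 x *\<^sub>R c4 + \<beta>5 x *\<^sub>R c5
        + \<beta>6 x *\<^sub>R c6" by (simp only: h_def P.linear_of_def)
    then have "g (h x) = \<beta>1 x *\<^sub>R b1 + \<beta>2 x *\<^sub>R b2 + \<beta>3 x *\<^sub>R b3 + \<beta>4 x *\<^sub>R b4 + \<beta>5 x *\<^sub>R b5
        + \<beta>6 x *\<^sub>R b6"
      by (simp only: linear_add[OF lin(1)] linear_scale[OF lin(1)] g)
    then show ?thesis using P.expand[of x] by simp
  qed
  have hg: "h (g x) = x" for x
  proof -
    have "g x = \<gamma>1 x *\<^sub>R b1 + \<gamma>2 x *\<^sub>R b2 + \<gamma>3 x *\<^sub>R b3 + \<gamma>4 x *\<^sub>R b4 + \<gamma>5 x *\<^sub>R b5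
        + \<gamma>6 x *\<^sub>R b6" by (simp only: g_def Q.linear_of_def)
    then have "h (g x) = \<gamma>1 x *\<^sub>R c1 + \<gamma>2 x *\<^sub>R c2 + \<gamma>3 x *\<^sub>R c3 + \<gamma>4 x *\<^sub>R c4 + \<gamma>5 x *\<^sub>R c5
        + \<gamma>6 x *\<^sub>R c6"
      by (simp only: linear_add[OF lin(2)] linear_scale[OF lin(2)] h)
    then show ?thesis using Q.expand[of x] by simp
  qed
  have inv: "pull g (pull h \<Omega>) = \<Omega>" "pull h (pull g \<Omega>) = \<Omega>" for \<Omega>
    by (intro blinfun_eqI; simp add: pull_apply lin gh hg)+
  have alt: "alternating (pull g \<Omega>) \<longleftrightarrow> alternating \<Omega>" for \<Omega>
    using alternating_pull[OF lin(1)] alternating_pull[OF lin(2), of "pull g \<Omega>"] inv by auto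
  have image: "pull g ` D = D'" if "\<And>\<Omega>. \<Omega> \<in> D \<longleftrightarrow> pull g \<Omega> \<in> D'" for D D'
  proof (intro set_eqI iffI)
    fix \<Omega> assume "\<Omega> \<in> D'"
    then have "pull h \<Omega> \<in> D" by (simp only: that inv)
    then show "\<Omega> \<in> pull g ` D" using inv(1)[of \<Omega>] by (metis imageI)
  qed (use that in auto)
  show ?thesis
    by (intro exI[of _ "pull g"] conjI linear_pull lin image)
       (simp_all only: P.im_N_2_iff Q.im_N_2_iff P.im_N_1_iff Q.im_N_1_iff P.ker_N_1_iff
           Q.ker_N_1_iff
          P.ker_N_2_iff Q.ker_N_2_iff alt pull_apply[OF lin(1)] g)
qed

lemma subspace_tangent_space:
  assumes "\<zeta> \<in> U0 \<alpha>"
  shows "subspace (tangent_space (U0 \<alpha>) \<zeta>)"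
proof -
  obtain b1 b2 b3 b4 b5 b6 \<beta>1 \<beta>2 \<beta>3 \<beta>4 \<beta>5 \<beta>6 where "orbit_frame \<alpha> \<theta> b1 b2 b3 b4 b5 b6 \<beta>1 \<beta>2 \<beta>3 \<beta>4 \<beta>5
      \<beta>6 \<zeta>"
    using U0_orbit_frame[OF assms] .
  then interpret orbit_frame \<alpha> \<theta> b1 b2 b3 b4 b5 b6 \<beta>1 \<beta>2 \<beta>3 \<beta>4 \<beta>5 \<beta>6 \<zeta> .
  show ?thesis
    by (auto simp: subspace_def tangent_space_iff alternating_def blinfun.bilinear_simps)
qed

lemma linear_tensor_N_power:
  assumes "\<zeta> \<in> U0 \<alpha>"
  shows "linear (tensor_N \<theta> \<zeta> ^^ k)"
proof -
  obtain b1 b2 b3 b4 b5 b6 \<beta>1 \<beta>2 \<beta>3 \<beta>4 \<beta>5 \<beta>6 where "orbit_frame \<alpha> \<theta> b1 b2 b3 b4 b5 b6 \<beta>1 \<beta>2 \<beta>3 \<beta>4 \<beta>5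
      \<beta>6 \<zeta>"
    using U0_orbit_frame[OF assms] .
  then interpret orbit_frame \<alpha> \<theta> b1 b2 b3 b4 b5 b6 \<beta>1 \<beta>2 \<beta>3 \<beta>4 \<beta>5 \<beta>6 \<zeta> .
  show ?thesis
    unfolding tensor_N_eq
    by (induction k) (simp_all only: funpow.simps linear_id linear_compose linear_derivation[OF
        linear_F])
qed

lemma tensor_N_power_in_tangent_space:
  assumes "\<zeta> \<in> U0 \<alpha>" "\<Omega> \<in> tangent_space (U0 \<alpha>) \<zeta>"
  shows "(tensor_N \<theta> \<zeta> ^^ k) \<Omega> \<in> tangent_space (U0 \<alpha>) \<zeta>"
proof -
  obtain b1 b2 b3 b4 b5 b6 \<beta>1 \<beta>2 \<beta>3 \<beta>4 \<beta>5 \<beta>6 where "orbit_frame \<alpha> \<theta> b1 b2 b3 b4 b5 b6 \<beta>1 \<beta>2 \<beta>3 \<beta>4 \<beta>5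
      \<beta>6 \<zeta>"
    using U0_orbit_frame[OF assms(1)] .
  then interpret orbit_frame \<alpha> \<theta> b1 b2 b3 b4 b5 b6 \<beta>1 \<beta>2 \<beta>3 \<beta>4 \<beta>5 \<beta>6 \<zeta> .
  show ?thesis
    using assms(2) by (induction k) (simp_all add: tensor_N_eq N_in_tangent_space)
qed

lemma subspace_im_N: "\<zeta> \<in> U0 \<alpha> \<Longrightarrow> subspace (im_N \<alpha> \<theta> k \<zeta>)"
  unfolding im_N_def by (intro linear_subspace_image linear_tensor_N_power subspace_tangent_space)

lemma subspace_ker_N:
  assumes "\<zeta> \<in> U0 \<alpha>"
  shows "subspace (ker_N \<alpha> \<theta> k \<zeta>)"
proof -
  have "ker_N \<alpha> \<theta> k \<zeta> = tangent_space (U0 \<alpha>) \<zeta> \<inter> {\<Omega>. (tensor_N \<theta> \<zeta> ^^ k) \<Omega> = 0}"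
    by (auto simp: ker_N_def)
  then show ?thesis
    by (simp add: subspace_inter subspace_tangent_space[OF assms] linear_subspace_kernel
        linear_tensor_N_power[OF assms])
qed

lemma im_N_tangent: "\<zeta> \<in> U0 \<alpha> \<Longrightarrow> im_N \<alpha> \<theta> k \<zeta> \<subseteq> tangent_space (U0 \<alpha>) \<zeta>"
  by (auto simp: im_N_def tensor_N_power_in_tangent_space)

lemma ker_N_tangent: "ker_N \<alpha> \<theta> k \<zeta> \<subseteq> tangent_space (U0 \<alpha>) \<zeta>"
  by (auto simp: ker_N_def)

end

section \<open>Polynomial fields with values in the distributions\<close>

context orbit_frame
begin

lemma tensor_N_eq_F: "q \<in> U0 \<alpha> \<Longrightarrow> tensor_N \<theta> q = derivation (F q)"
  by (simp add: tensor_N_def endo_F_eq[OF U0_alternating])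

text \<open>The endomorphism \<open>A\<close> that represents the preimage at \<zeta> is kept
  constant while \<open>q\<close> varies; written with \<open>F q\<close>, the field is defined on
  the whole ambient space.\<close>

lemma im_N_field:
  assumes "w \<in> im_N \<alpha> \<theta> k \<zeta>"
  shows "\<exists>X. smooth_on UNIV X \<and> X \<zeta> = w \<and> (\<forall>q\<in>U0 \<alpha>. X q \<in> im_N \<alpha> \<theta> k q)"
proof -
  obtain \<Omega> where \<Omega>: "\<Omega> \<in> tangent_space (U0 \<alpha>) \<zeta>" "w = (tensor_N \<theta> \<zeta> ^^ k) \<Omega>"
    using assms by (auto simp: im_N_def)
  then obtain A where A: "linear A" "derivation A \<zeta> = \<Omega>"
    using tangent_vector_eq_derivation[of \<Omega>] by (auto simp: tangent_space_iff)
  let ?X = "\<lambda>q. (derivation (F q) ^^ k) (derivation A q)"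
  have "smooth_on UNIV ?X"
  proof (induction k)
    case 0
    then show ?case
      by (simp add: smooth_on_derivation A(1) smooth_on_const smooth_on_bounded_linear)
  next
    case (Suc k)
    have "smooth_on UNIV (\<lambda>q. derivation (F q) ((derivation (F q) ^^ k) (derivation A q)))"
      by (intro smooth_on_derivation Suc smooth_on_F linear_F open_UNIV)
    then show ?case by simp
  qed
  moreover have "?X \<zeta> = w"
    using \<Omega> A by (simp add: tensor_N_eq)
  moreover have "?X q \<in> im_N \<alpha> \<theta> k q" if "q \<in> U0 \<alpha>" for q
    using derivation_in_tangent_space[OF that A(1)] by (auto simp: im_N_def tensor_N_eq_F[OF that])
  ultimately show ?thesis by blast
qed

definition trF :: "('v \<Rightarrow> 'v) \<Rightarrow> 'v trilin \<Rightarrow> real" where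
  "trF A q = (\<Sum>i\<in>Basis. F q (A i) \<bullet> i)"

text \<open>The kernel of \<open>\<N>\<^sup>2\<close> at \<open>q\<close> consists of all \<open>derivation A q\<close> with \<open>trF A q = 0\<close>
  (by \<open>derivation_trace\<close>). The next combination lies in it at every point of the orbit.\<close>

definition ker_field :: "('v \<Rightarrow> 'v) \<Rightarrow> ('v \<Rightarrow> 'v) \<Rightarrow> 'v trilin \<Rightarrow> 'v trilin" where
  "ker_field A\<^sub>0 A q = trF A\<^sub>0 q *\<^sub>R derivation A q - trF A q *\<^sub>R derivation A\<^sub>0 q"

lemma smooth_on_trF: "smooth_on UNIV (trF A)"
  unfolding trF_def[abs_def]
  by (intro smooth_on_sum smooth_on_inner smooth_on_F smooth_on_const open_UNIV)

lemma smooth_on_ker_field: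
  assumes "linear A\<^sub>0" "linear A"
  shows "smooth_on UNIV (ker_field A\<^sub>0 A)"
proof -
  have smooth: "smooth_on UNIV (derivation B)" if "linear B" for B :: "'v \<Rightarrow> 'v"
    using that by (intro smooth_on_derivation smooth_on_const smooth_on_bounded_linear
        bounded_linear_ident) auto
  show ?thesis
    unfolding ker_field_def[abs_def]
    by (intro smooth_on_diff smooth_on_scaleR smooth_on_trF smooth assms open_UNIV)
qed

lemma ker_field_in_ker_N:
  assumes "linear A\<^sub>0" "linear A" "q \<in> U0 \<alpha>"
  shows "ker_field A\<^sub>0 A q \<in> ker_N \<alpha> \<theta> 2 q"
proof -
  obtain c1 c2 c3 c4 c5 c6 \<gamma>1 \<gamma>2 \<gamma>3 \<gamma>4 \<gamma>5 \<gamma>6 where "orbit_frame \<alpha> \<theta> c1 c2 c3 c4 c5 c6 \<gamma>1 \<gamma>2 \<gamma>3 \<gamma>4 \<gamma>5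
      \<gamma>6 q"
    using U0_orbit_frame[OF assms(3)] .
  then interpret Q: orbit_frame \<alpha> \<theta> c1 c2 c3 c4 c5 c6 \<gamma>1 \<gamma>2 \<gamma>3 \<gamma>4 \<gamma>5 \<gamma>6 q .
  \<comment> \<open>Both formulas compute \<open>endo_F\<close> at \<open>q\<close>, although they
    are written in frames adapted to different points.\<close>
  have F: "Q.F q = F q"
    using endo_F_eq[OF U0_alternating[OF assms(3)]] Q.endo_F_\<zeta> by simp
  have "ker_field A\<^sub>0 A q \<in> tangent_space (U0 \<alpha>) q"
    unfolding ker_field_def
    by (intro subspace_diff subspace_scale subspace_tangent_space derivation_in_tangent_space assms)
  moreover have "ker_field A\<^sub>0 A q c1 c2 c4 + ker_field A\<^sub>0 A q c1 c3 c5
      + ker_field A\<^sub>0 A q c2 c3 c6 = 0"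
  proof -
    let ?\<mu> = "\<lambda>\<Omega> :: 'v trilin. \<Omega> c1 c2 c4 + \<Omega> c1 c3 c5 + \<Omega> c2 c3 c6"
    have "?\<mu> (ker_field A\<^sub>0 A q) = trF A\<^sub>0 q * ?\<mu> (derivation A q)
        - trF A q * ?\<mu> (derivation A\<^sub>0 q)"
      by (simp add: ker_field_def blinfun.bilinear_simps algebra_simps)
    also have "\<dots> = 0"
      unfolding Q.derivation_trace[OF assms(1)] Q.derivation_trace[OF assms(2)] F trF_def by simp
    finally show ?thesis .
  qed
  ultimately show ?thesis by (simp add: Q.ker_N_2_iff Q.tangent_space_iff)
qed

text \<open>A rank one choice with \<open>tr (F \<zeta> A\<^sub>0)\<close> nonzero:
  \<open>F \<zeta>\<close> returns \<open>b6\<close> to a multiple of \<open>b1\<close>.\<close>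

definition A\<^sub>0 :: "'v \<Rightarrow> 'v" where "A\<^sub>0 = linear_of b6 0 0 0 0 0"

lemma linear_A\<^sub>0: "linear A\<^sub>0"
  unfolding A\<^sub>0_def by (rule linear_linear_of)

lemma trF_\<zeta>:
  assumes "linear A"
  shows "trF A \<zeta> = \<kappa> * (\<beta>5 (A b2) - \<beta>4 (A b3) - \<beta>6 (A b1))"
  unfolding trF_def trace_frame[OF linear_compose[OF assms linear_F, unfolded o_def]]
  by (simp add: F_apply coord_simps dual algebra_simps)

lemma trF_A\<^sub>0: "trF A\<^sub>0 \<zeta> = - \<kappa>"
  unfolding trF_\<zeta>[OF linear_A\<^sub>0] by (simp add: A\<^sub>0_def linear_of_frame coord_simps dual)

lemma ker_N_2_field:
  assumes "w \<in> ker_N \<alpha> \<theta> 2 \<zeta>"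
  shows "\<exists>X. smooth_on UNIV X \<and> X \<zeta> = w \<and> (\<forall>q\<in>U0 \<alpha>. X q \<in> ker_N \<alpha> \<theta> 2 q)"
proof -
  obtain A where A: "linear A" "derivation A \<zeta> = w"
    using assms tangent_vector_eq_derivation[of w] by (auto simp: ker_N_2_iff)
  have "trF A \<zeta> = 0"
    using derivation_trace[OF A(1)] assms \<kappa>_neq_0 unfolding A(2) trF_def ker_N_2_iff by simp
  \<comment> \<open>At \<zeta> the correction term drops out, because
    \<open>trF A \<zeta> = 0\<close>; the scalar normalises what remains to
    \<open>w\<close>.\<close>
  let ?X = "\<lambda>q. (1 / trF A\<^sub>0 \<zeta>) *\<^sub>R ker_field A\<^sub>0 A q"
  have "smooth_on UNIV ?X"
    by (intro smooth_on_scaleR smooth_on_const smooth_on_ker_field linear_A\<^sub>0 A(1) open_UNIV)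
  moreover have "?X \<zeta> = w"
    using \<open>trF A \<zeta> = 0\<close> \<kappa>_neq_0 by (simp add: ker_field_def A(2) trF_A\<^sub>0)
  moreover have "?X q \<in> ker_N \<alpha> \<theta> 2 q" if "q \<in> U0 \<alpha>" for q
    by (intro subspace_scale subspace_ker_N ker_field_in_ker_N linear_A\<^sub>0 A(1) that)
  ultimately show ?thesis by blast
qed

lemma ker_N_1_subset_im_N_1: "ker_N \<alpha> \<theta> 1 \<zeta> \<subseteq> im_N \<alpha> \<theta> 1 \<zeta>"
  unfolding subset_iff ker_N_1_iff im_N_1_iff by blast

lemma im_N_2_subset_ker_N_1: "im_N \<alpha> \<theta> 2 \<zeta> \<subseteq> ker_N \<alpha> \<theta> 1 \<zeta>"
  unfolding subset_iff ker_N_1_iff im_N_2_iff by simp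

lemma im_N_1_subset_ker_N_2: "im_N \<alpha> \<theta> 1 \<zeta> \<subseteq> ker_N \<alpha> \<theta> 2 \<zeta>"
  unfolding subset_iff ker_N_2_iff im_N_1_iff by simp

text \<open>As the kernel lies in the image, it is the image under \<open>N\<close> of the kernel of
  the square; fields of the latter are pushed forward by \<open>derivation (F q)\<close>.\<close>

lemma ker_N_1_field:
  assumes "w \<in> ker_N \<alpha> \<theta> 1 \<zeta>"
  shows "\<exists>X. smooth_on UNIV X \<and> X \<zeta> = w \<and> (\<forall>q\<in>U0 \<alpha>. X q \<in> ker_N \<alpha> \<theta> 1 q)"
proof -
  have "w \<in> im_N \<alpha> \<theta> 1 \<zeta>" using assms ker_N_1_subset_im_N_1 by blast
  then obtain \<Omega> where \<Omega>: "\<Omega> \<in> tangent_space (U0 \<alpha>) \<zeta>" "w = N \<Omega>"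
    by (auto simp: im_N_def tensor_N_eq)
  then have "\<Omega> \<in> ker_N \<alpha> \<theta> 2 \<zeta>"
    using assms by (simp add: ker_N_def tensor_N_eq numeral_2_eq_2)
  then obtain X where X: "smooth_on UNIV X" "X \<zeta> = \<Omega>" "\<And>q. q \<in> U0 \<alpha> \<Longrightarrow> X q \<in> ker_N \<alpha> \<theta> 2 q"
    using ker_N_2_field by blast
  have "smooth_on UNIV (\<lambda>q. derivation (F q) (X q))"
    by (intro smooth_on_derivation X smooth_on_F linear_F open_UNIV)
  moreover have "derivation (F q) (X q) \<in> ker_N \<alpha> \<theta> 1 q" if "q \<in> U0 \<alpha>" for q
    using X(3)[OF that] tensor_N_power_in_tangent_space[OF that, of "X q" 1]
    by (simp add: ker_N_def tensor_N_eq_F[OF that] numeral_2_eq_2)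
  ultimately show ?thesis using X(2) \<Omega>(2) by blast
qed

end

context orbit
begin

lemma smooth_distribution_U0:
  fixes D :: "'v trilin \<Rightarrow> 'v trilin set"
  assumes "\<And>p. p \<in> U0 \<alpha> \<Longrightarrow> D p \<subseteq> tangent_space (U0 \<alpha>) p"
    and "\<And>p. p \<in> U0 \<alpha> \<Longrightarrow> subspace (D p)"
    and "\<And>p q. p \<in> U0 \<alpha> \<Longrightarrow> q \<in> U0 \<alpha> \<Longrightarrow> \<exists>\<Phi>. linear \<Phi> \<and> \<Phi> ` D p = D q"
    and "\<And>p w. p \<in> U0 \<alpha> \<Longrightarrow> w \<in> D p \<Longrightarrow>
      \<exists>X. smooth_on UNIV X \<and> X p = w \<and> (\<forall>q\<in>U0 \<alpha>. X q \<in> D q)"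
  shows "smooth_distribution (U0 \<alpha>) D"
proof -
  obtain S where "finite S" "span S = (UNIV :: 'v trilin set)"
    using trilin_finite_span by blast
  then show ?thesis
    using assms by (intro smooth_distributionI linear_trilin_imp_bounded)
qed

lemma transport:
  assumes "p \<in> U0 \<alpha>" "q \<in> U0 \<alpha>"
  shows "\<exists>\<Phi>. linear \<Phi> \<and> \<Phi> ` im_N \<alpha> \<theta> 2 p = im_N \<alpha> \<theta> 2 q \<and> \<Phi> ` ker_N \<alpha> \<theta> 1 p = ker_N \<alpha> \<theta> 1 q \<and>
    \<Phi> ` im_N \<alpha> \<theta> 1 p = im_N \<alpha> \<theta> 1 q \<and> \<Phi> ` ker_N \<alpha> \<theta> 2 p = ker_N \<alpha> \<theta> 2 q"
  by (rule U0_orbit_frame[OF assms(1)], rule U0_orbit_frame[OF assms(2)], rule frame_transport)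

lemma smooth_distributions:
  "smooth_distribution (U0 \<alpha>) (im_N \<alpha> \<theta> 2)" "smooth_distribution (U0 \<alpha>) (ker_N \<alpha> \<theta> 1)"
  "smooth_distribution (U0 \<alpha>) (im_N \<alpha> \<theta> 1)" "smooth_distribution (U0 \<alpha>) (ker_N \<alpha> \<theta> 2)"
  subgoal
    by (rule smooth_distribution_U0[OF im_N_tangent subspace_im_N])
       (assumption, assumption, use transport in blast, rule U0_orbit_frame, assumption, rule
           orbit_frame.im_N_field)
  subgoal
    by (rule smooth_distribution_U0[OF ker_N_tangent subspace_ker_N])
       (assumption, use transport in blast, rule U0_orbit_frame, assumption, rule
           orbit_frame.ker_N_1_field)
  subgoal
    by (rule smooth_distribution_U0[OF im_N_tangent subspace_im_N])
       (assumption, assumption, use transport in blast, rule U0_orbit_frame, assumption, rule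
           orbit_frame.im_N_field)
  subgoal
    by (rule smooth_distribution_U0[OF ker_N_tangent subspace_ker_N])
       (assumption, use transport in blast, rule U0_orbit_frame, assumption, rule
           orbit_frame.ker_N_2_field)
  done

end


section \<open>Integrability\<close>

lemma trilin_has_vector_derivative:
  fixes G :: "real \<Rightarrow> 'v::real_normed_vector trilin"
  assumes "(G has_vector_derivative G') (at x)" "(f has_vector_derivative f') (at x)"
    "(g has_vector_derivative g') (at x)" "(h has_vector_derivative h') (at x)"
  shows "((\<lambda>t. G t (f t) (g t) (h t)) has_vector_derivative
    G' (f x) (g x) (h x) + G x f' (g x) (h x) + G x (f x) g' (h x) + G x (f x) (g x) h') (at x)"
proof -
  note bil = bounded_bilinear.has_vector_derivative[OF bounded_bilinear_blinfun_apply]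
  show ?thesis
    using bil[OF bil[OF bil[OF assms(1,2)] assms(3)] assms(4)]
    by (simp add: blinfun.bilinear_simps algebra_simps)
qed

context volume_frame
begin

lemma linear_F2: "linear (F2 \<Omega> \<Omega>')"
  by (rule linearI) (simp_all add: F2_def shuffle23_def blinfun.bilinear_simps algebra_simps)

end

context orbit
begin

lemma im_N_iff_V0:
  assumes "q \<in> U0 \<alpha>"
  shows "\<Omega> \<in> im_N \<alpha> \<theta> 1 q \<longleftrightarrow> alternating \<Omega> \<and> (\<forall>x\<in>V0 q. \<forall>y\<in>V0 q. \<forall>z. \<Omega> x y z = 0)"
    and "\<Omega> \<in> im_N \<alpha> \<theta> 2 q \<longleftrightarrow> alternating \<Omega> \<and> (\<forall>x\<in>V0 q. \<forall>y z. \<Omega> x y z = 0)"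
  by (rule U0_orbit_frame[OF assms], rule orbit_frame.im_N_1_iff_V0, assumption,
      rule U0_orbit_frame[OF assms], rule orbit_frame.im_N_2_iff_V0, assumption)

end

context orbit_frame
begin

text \<open>If \<open>A\<close> maps into \<open>V0 \<zeta>\<close>, then the pullback of \<open>\<zeta>\<close> under \<open>1 + t A\<close> is affine in \<open>t\<close>.\<close>

lemma im_N_1_line:
  assumes X: "X \<in> im_N \<alpha> \<theta> 1 \<zeta>" and W: "open W" "\<zeta> \<in> W"
  obtains e where "e > 0"
    and "\<And>t. \<bar>t\<bar> < e \<Longrightarrow> \<zeta> + t *\<^sub>R X \<in> W \<inter> U0 \<alpha> \<and> V0 (\<zeta> + t *\<^sub>R X) = V0 \<zeta>"
proof -
  have "alternating X" "X b1 b2 b3 = 0"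
    and "\<And>x. X b1 b2 x = 0 \<and> X b1 b3 x = 0 \<and> X b2 b3 x = 0"
    using X frame_in_V0 unfolding im_N_1_iff_V0 by blast+
  then obtain A where A: "linear A" "derivation A \<zeta> = X"
    and "\<And>x. \<beta>4 (A x) = 0 \<and> \<beta>5 (A x) = 0 \<and> \<beta>6 (A x) = 0"
    using tangent_vector_eq_derivation[of X] by metis
  then have AV: "A x \<in> V0 \<zeta>" for x by (simp add: V0_eq)
  have "\<zeta> \<in> im_N \<alpha> \<theta> 1 \<zeta>"
    unfolding im_N_1_iff by (simp add: alt coeff)
  then have z1: "\<zeta> x y z = 0" if "x \<in> V0 \<zeta>" "y \<in> V0 \<zeta>" for x y z
    using that unfolding im_N_1_iff_V0 by blast
  have z2: "\<zeta> x z y = 0" "\<zeta> z x y = 0" if "x \<in> V0 \<zeta>" "y \<in> V0 \<zeta>" for x y z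
    using z1[OF that, of z] alternating_swap[OF alt] by (metis minus_zero)+
  have lin: "linear (\<lambda>x. x + t *\<^sub>R A x)" for t
    using A(1) by (auto simp: linear_iff algebra_simps)
  \<comment> \<open>The terms of order \<open>t^2\<close> and \<open>t^3\<close> evaluate \<zeta> on
    at least two vectors of \<open>V0\<close> and vanish.\<close>
  have pull: "pull (\<lambda>x. x + t *\<^sub>R A x) \<zeta> = \<zeta> + t *\<^sub>R X" for t
    by (intro blinfun_eqI)
       (simp add: pull_apply[OF lin] A(2)[symmetric] derivation_apply[OF A(1)]
           blinfun.bilinear_simps
          AV z1 z2 algebra_simps)
  obtain e where e: "e > 0" "\<And>t. \<bar>t\<bar> < e \<Longrightarrow> bij (\<lambda>x. x + t *\<^sub>R A x)"
    using bij_id_plus_small[OF A(1)] by blast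
  obtain d where d: "d > 0" "ball \<zeta> d \<subseteq> W"
    using W openE by blast
  have "\<zeta> + t *\<^sub>R X \<in> W \<inter> U0 \<alpha> \<and> V0 (\<zeta> + t *\<^sub>R X) = V0 \<zeta>" if t: "\<bar>t\<bar> < min e (d / (norm X
      + 1))" for t
  proof -
    have "\<bar>t\<bar> * norm X \<le> \<bar>t\<bar> * (norm X + 1)" by (simp add: mult_left_mono)
    also have "\<dots> < d" using t by (simp add: pos_less_divide_eq add_nonneg_pos)
    finally have "\<zeta> + t *\<^sub>R X \<in> W" using d(2) by (auto simp: dist_norm)
    moreover have bij: "bij (\<lambda>x. x + t *\<^sub>R A x)" using t e(2) by simp
    then have "\<zeta> + t *\<^sub>R X \<in> U0 \<alpha>"
      unfolding pull[symmetric] by (intro U0_pull \<zeta> lin)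
    \<comment> \<open>\<open>V0\<close> of the pullback is the preimage of
      \<open>V0 \<zeta>\<close>, and \<open>x + t A x\<close> has the same last three coordinates as
      \<open>x\<close>.\<close>
    moreover have "\<beta>4 (A x) = 0" "\<beta>5 (A x) = 0" "\<beta>6 (A x) = 0" for x
      using AV[of x] by (auto simp: V0_eq)
    then have "V0 (\<zeta> + t *\<^sub>R X) = V0 \<zeta>"
      unfolding pull[symmetric] set_eq_iff V0_pull[OF alt lin bij] by (simp add: V0_eq coord_simps)
    ultimately show ?thesis by blast
  qed
  moreover have "min e (d / (norm X + 1)) > 0"
    using e(1) d(1) by (simp add: add_nonneg_pos)
  ultimately show ?thesis using that by blast
qed

text \<open>A linear condition determined by \<open>V0 q\<close> alone does not change along the
  line, so the derivative of the field inherits it.\<close>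

lemma line_derivative_eq_0:
  assumes W: "open W" "\<zeta> \<in> W" "smooth_on W Y" and X: "X \<in> im_N \<alpha> \<theta> 1 \<zeta>"
    and l: "bounded_linear l" "\<And>q. q \<in> W \<Longrightarrow> q \<in> U0 \<alpha> \<Longrightarrow> V0 q = V0 \<zeta> \<Longrightarrow> l (Y q) = 0"
  shows "l (frechet_derivative Y (at \<zeta>) X) = (0 :: real)"
proof -
  obtain e where e: "e > 0"
    "\<And>t. \<bar>t\<bar> < e \<Longrightarrow> \<zeta> + t *\<^sub>R X \<in> W \<inter> U0 \<alpha> \<and> V0 (\<zeta> + t *\<^sub>R X) = V0 \<zeta>"
    using im_N_1_line[OF X W(1,2)] by blast
  show ?thesis
    by (rule has_vector_derivative_bounded_linear_eq_0[OF
          has_vector_derivative_line[OF smooth_on_imp_differentiable[OF W(3,2)]] l(1) e(1)])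
       (use e(2) l(2) in blast)
qed

text \<open>More than involutivity: each of the two terms of a bracket lies in the fibre
  separately.\<close>

lemma im_N_derivative:
  assumes W: "open W" "\<zeta> \<in> W" "smooth_on W Y" and X: "X \<in> im_N \<alpha> \<theta> 1 \<zeta>"
  shows "(\<And>q. q \<in> W \<inter> U0 \<alpha> \<Longrightarrow> Y q \<in> im_N \<alpha> \<theta> 1 q) \<Longrightarrow>
      frechet_derivative Y (at \<zeta>) X \<in> im_N \<alpha> \<theta> 1 \<zeta>"
    and "(\<And>q. q \<in> W \<inter> U0 \<alpha> \<Longrightarrow> Y q \<in> im_N \<alpha> \<theta> 2 q) \<Longrightarrow>
      frechet_derivative Y (at \<zeta>) X \<in> im_N \<alpha> \<theta> 2 \<zeta>"
proof -
  note * = line_derivative_eq_0[OF W X bounded_linear_trilin_apply]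
  show "frechet_derivative Y (at \<zeta>) X \<in> im_N \<alpha> \<theta> 1 \<zeta>"
    if "\<And>q. q \<in> W \<inter> U0 \<alpha> \<Longrightarrow> Y q \<in> im_N \<alpha> \<theta> 1 q"
    unfolding im_N_iff_V0(1)[OF \<zeta>] alternating_def
  proof (intro conjI allI ballI; rule *)
    fix q assume "q \<in> W" "q \<in> U0 \<alpha>" "V0 q = V0 \<zeta>"
    then have "Y q x x y = 0" "Y q x y y = 0" "x \<in> V0 \<zeta> \<Longrightarrow> y \<in> V0 \<zeta> \<Longrightarrow> Y q x y z = 0" for x y z
      using that[of q] im_N_iff_V0(1)[of q "Y q"] by (auto simp: alternating_def)
    then show "Y q x x y = 0" "Y q x y y = 0" "x \<in> V0 \<zeta> \<Longrightarrow> y \<in> V0 \<zeta> \<Longrightarrow> Y q x y z = 0" for x y z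
      by blast+
  qed
  show "frechet_derivative Y (at \<zeta>) X \<in> im_N \<alpha> \<theta> 2 \<zeta>"
    if "\<And>q. q \<in> W \<inter> U0 \<alpha> \<Longrightarrow> Y q \<in> im_N \<alpha> \<theta> 2 q"
    unfolding im_N_iff_V0(2)[OF \<zeta>] alternating_def
  proof (intro conjI allI ballI; rule *)
    fix q assume "q \<in> W" "q \<in> U0 \<alpha>" "V0 q = V0 \<zeta>"
    then have "Y q x x y = 0" "Y q x y y = 0" "x \<in> V0 \<zeta> \<Longrightarrow> Y q x y z = 0" for x y z
      using that[of q] im_N_iff_V0(2)[of q "Y q"] by (auto simp: alternating_def)
    then show "Y q x x y = 0" "Y q x y y = 0" "x \<in> V0 \<zeta> \<Longrightarrow> Y q x y z = 0" for x y z
      by blast+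
  qed
qed

text \<open>The zeroth order term that appears when \<open>\<N> Y = 0\<close> is differentiated in the direction \<open>X\<close>.
  Its symmetry makes it cancel in the bracket.\<close>

definition mixed :: "'v trilin \<Rightarrow> 'v trilin \<Rightarrow> real" where
  "mixed X Y = (let f = (\<lambda>v. F2 X \<zeta> v + F2 \<zeta> X v) in
     Y (f b4) b5 b6 + Y b4 (f b5) b6 + Y b4 b5 (f b6))"

text \<open>Let \<open>x\<close> and \<open>y\<close> be the 3 by 3 matrices of the coordinates of
  \<open>X\<close> and \<open>Y\<close> with one argument in \<open>V0\<close>. The value is then
  \<open>\<kappa> (tr (x y) - tr x tr y)\<close>, which is symmetric.\<close>

lemma mixed_commute:
  assumes "X \<in> im_N \<alpha> \<theta> 1 \<zeta>" "Y \<in> im_N \<alpha> \<theta> 1 \<zeta>"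
  shows "mixed X Y = mixed Y X"
proof -
  have X: "alternating X" and Y: "alternating Y"
    using assms unfolding im_N_1_iff by blast+
  show ?thesis
    using assms[unfolded im_N_1_iff]
    by (simp add: mixed_def Let_def F2_def shuffle23_def sort[OF X] sort[OF Y] sort[OF alt] coeff
        blinfun.bilinear_simps algebra_simps)
qed

text \<open>The derivative already lies in the image by \<open>im_N_derivative\<close>, so the
  coordinate at \<open>b4 b5 b6\<close> holds the only remaining equation of the kernel.\<close>

lemma ker_N_1_derivative:
  assumes W: "open W" "\<zeta> \<in> W" "smooth_on W Y" and X: "X \<in> im_N \<alpha> \<theta> 1 \<zeta>"
    and Y: "\<And>q. q \<in> W \<inter> U0 \<alpha> \<Longrightarrow> Y q \<in> ker_N \<alpha> \<theta> 1 q"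
  shows "N (frechet_derivative Y (at \<zeta>) X) b4 b5 b6 = - mixed X (Y \<zeta>)"
proof -
  obtain e where e: "e > 0"
    "\<And>t. \<bar>t\<bar> < e \<Longrightarrow> \<zeta> + t *\<^sub>R X \<in> W \<inter> U0 \<alpha> \<and> V0 (\<zeta> + t *\<^sub>R X) = V0 \<zeta>"
    using im_N_1_line[OF X W(1,2)] by blast
  let ?q = "\<lambda>t. \<zeta> + t *\<^sub>R X"
  let ?dY = "frechet_derivative Y (at \<zeta>) X"
  let ?f = "\<lambda>v. F2 X \<zeta> v + F2 \<zeta> X v"
  have dY: "((\<lambda>t. Y (?q t)) has_vector_derivative ?dY) (at 0)"
    by (rule has_vector_derivative_line[OF smooth_on_imp_differentiable[OF W(3,2)]])
  have "(?q has_vector_derivative X) (at 0)"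
    by (auto intro!: derivative_eq_intros)
  then have dF: "((\<lambda>t. F (?q t) v) has_vector_derivative ?f v) (at 0)" for v
    using F_has_vector_derivative[of ?q X v] by simp
  note const = has_vector_derivative_const[of _ "at 0"]
  have "((\<lambda>t. Y (?q t) (F (?q t) b4) b5 b6 + Y (?q t) b4 (F (?q t) b5) b6
      + Y (?q t) b4 b5 (F (?q t) b6))
      has_vector_derivative N ?dY b4 b5 b6 + mixed X (Y \<zeta>)) (at 0)"
    by (rule has_vector_derivative_eq_rhs[OF has_vector_derivative_add[OF
        has_vector_derivative_add[OF
            trilin_has_vector_derivative[OF dY dF const const]
            trilin_has_vector_derivative[OF dY const dF const]]
          trilin_has_vector_derivative[OF dY const const dF]]])
       (simp add: derivation_apply[OF linear_F] mixed_def Let_def blinfun.bilinear_simps)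
  moreover have "Y (?q t) (F (?q t) b4) b5 b6 + Y (?q t) b4 (F (?q t) b5) b6
      + Y (?q t) b4 b5 (F (?q t) b6) = 0"
    if "\<bar>t\<bar> < e" for t
  proof -
    have "derivation (F (?q t)) (Y (?q t)) = 0"
      using Y[of "?q t"] e(2)[OF that] by (simp add: ker_N_def tensor_N_eq_F)
    then show ?thesis
      using derivation_apply[OF linear_F, of "?q t" "Y (?q t)" b4 b5 b6] by simp
  qed
  ultimately have "N ?dY b4 b5 b6 + mixed X (Y \<zeta>) = 0"
    using has_vector_derivative_bounded_linear_eq_0[OF _ bounded_linear_ident e(1)] by blast
  then show ?thesis by simp
qed

text \<open>Endomorphisms \<open>A\<close>, \<open>B\<close> with \<open>tr (F A) = tr (F B) = 0\<close> but \<open>tr (F [A, B]) \<noteq> 0\<close>.\<close>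

definition B\<^sub>1 :: "'v \<Rightarrow> 'v" where "B\<^sub>1 = linear_of 0 0 b3 0 0 0"
definition B\<^sub>2 :: "'v \<Rightarrow> 'v" where "B\<^sub>2 = linear_of 0 b5 b4 0 0 0"

lemma linear_B: "linear B\<^sub>1" "linear B\<^sub>2"
  unfolding B\<^sub>1_def B\<^sub>2_def by (rule linear_linear_of)+

definition dtrF :: "('v \<Rightarrow> 'v) \<Rightarrow> 'v trilin \<Rightarrow> real" where
  "dtrF A w = (\<Sum>i\<in>Basis. (F2 w \<zeta> (A i) + F2 \<zeta> w (A i)) \<bullet> i)"

lemma ker_field_derivative:
  assumes "linear A"
  shows "frechet_derivative (ker_field A\<^sub>0 A) (at \<zeta>) w =
    trF A\<^sub>0 \<zeta> *\<^sub>R derivation A w + dtrF A\<^sub>0 w *\<^sub>R derivation A \<zeta>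
    - (trF A \<zeta> *\<^sub>R derivation A\<^sub>0 w + dtrF A w *\<^sub>R derivation A\<^sub>0 \<zeta>)"
proof -
  have line: "((\<lambda>t. \<zeta> + t *\<^sub>R w) has_vector_derivative w) (at 0)"
    by (auto intro!: derivative_eq_intros)
  have tr: "((\<lambda>t. trF B (\<zeta> + t *\<^sub>R w)) has_vector_derivative dtrF B w) (at 0)" for B
    unfolding trF_def dtrF_def
    using F_has_vector_derivative[OF line]
    by (intro has_vector_derivative_sum bounded_linear.has_vector_derivative[OF
        bounded_linear_inner_left]) simp
  have der: "((\<lambda>t. derivation B (\<zeta> + t *\<^sub>R w)) has_vector_derivative derivation B w) (at 0)"
    if "linear B" for B
    using linear_derivation[OF that]
    by (auto simp: linear_add linear_scale intro!: derivative_eq_intros)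
  have "((\<lambda>t. ker_field A\<^sub>0 A (\<zeta> + t *\<^sub>R w)) has_vector_derivative
    trF A\<^sub>0 \<zeta> *\<^sub>R derivation A w + dtrF A\<^sub>0 w *\<^sub>R derivation A \<zeta>
    - (trF A \<zeta> *\<^sub>R derivation A\<^sub>0 w + dtrF A w *\<^sub>R derivation A\<^sub>0 \<zeta>)) (at 0)"
    unfolding ker_field_def
    using has_vector_derivative_diff[OF
        has_vector_derivative_scaleR[OF tr[folded has_real_derivative_iff_has_vector_derivative]
            der[OF assms]]
        has_vector_derivative_scaleR[OF tr[folded has_real_derivative_iff_has_vector_derivative]
            der[OF linear_A\<^sub>0]]]
    by simp
  moreover have "ker_field A\<^sub>0 A differentiable (at \<zeta>)"
    using smooth_on_ker_field[OF linear_A\<^sub>0 assms] by (rule smooth_on_imp_differentiable) simp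
  note has_vector_derivative_line[OF this, of w]
  ultimately show ?thesis by (rule vector_derivative_unique_at[rotated])
qed

text \<open>For \<open>B\<^sub>2\<close> the contributions of \<open>b2\<close> and
  \<open>b3\<close> to the trace with \<open>F \<zeta>\<close> cancel. \<open>B\<^sub>1\<close> acts
  on \<open>b3\<close> only, so the commutator keeps just one of them: it sends \<open>b3\<close> to
  \<open>- b4\<close> and has trace \<kappa> with \<open>F \<zeta>\<close>.\<close>

lemma bracket_not_in_ker_N_2:
  "lie_bracket (ker_field A\<^sub>0 B\<^sub>1) (ker_field A\<^sub>0 B\<^sub>2) \<zeta> \<notin> ker_N \<alpha> \<theta> 2 \<zeta>"
proof -
  have lin: "linear (\<lambda>x. F2 v w (A x) + F2 w v (A x))" if "linear A" for A v w
    using linear_compose_add[OF linear_compose[OF that linear_F2] linear_compose[OF that linear_F2]]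
    by (simp add: o_def)
  define v1 where "v1 = ker_field A\<^sub>0 B\<^sub>1 \<zeta>"
  define v2 where "v2 = ker_field A\<^sub>0 B\<^sub>2 \<zeta>"
  have tr: "trF B\<^sub>1 \<zeta> = 0" "trF B\<^sub>2 \<zeta> = 0"
    unfolding trF_\<zeta>[OF linear_B(1)] trF_\<zeta>[OF linear_B(2)]
    by (simp_all add: B\<^sub>1_def B\<^sub>2_def linear_of_frame dual coord_simps)
  have v: "v1 = - \<kappa> *\<^sub>R derivation B\<^sub>1 \<zeta>" "v2 = - \<kappa> *\<^sub>R derivation B\<^sub>2 \<zeta>"
    by (simp_all add: v1_def v2_def ker_field_def tr trF_A\<^sub>0)
  have alt_v: "alternating v1" "alternating v2"
    unfolding v using alternating_derivation[OF linear_B(1) alt] alternating_derivation[OF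
        linear_B(2) alt]
    by (simp_all add: alternating_def blinfun.bilinear_simps)
  note dc = derivation_coords[OF linear_B(1)] derivation_coords[OF linear_B(2)] derivation_coords[OF
      linear_A\<^sub>0]
  have Bb: "B\<^sub>1 b1 = 0" "B\<^sub>1 b2 = 0" "B\<^sub>1 b3 = b3" "B\<^sub>1 b4 = 0" "B\<^sub>1 b5 = 0" "B\<^sub>1 b6 = 0"
    "B\<^sub>2 b1 = 0" "B\<^sub>2 b2 = b5" "B\<^sub>2 b3 = b4" "B\<^sub>2 b4 = 0" "B\<^sub>2 b5 = 0" "B\<^sub>2 b6 = 0"
    "A\<^sub>0 b1 = b6" "A\<^sub>0 b2 = 0" "A\<^sub>0 b3 = 0" "A\<^sub>0 b4 = 0" "A\<^sub>0 b5 = 0" "A\<^sub>0 b6 = 0"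
    by (simp_all add: B\<^sub>1_def B\<^sub>2_def A\<^sub>0_def linear_of_frame)
  have v1_coords:
    "v1 b1 b2 b3 = 0" "v1 b1 b2 b4 = 0" "v1 b1 b2 b5 = 0" "v1 b1 b2 b6 = 0"
    "v1 b1 b3 b4 = 0" "v1 b1 b3 b5 = 0" "v1 b1 b3 b6 = 0" "v1 b1 b4 b5 = 0"
    "v1 b1 b4 b6 = 0" "v1 b1 b5 b6 = 0" "v1 b2 b3 b4 = 0" "v1 b2 b3 b5 = 0"
    "v1 b2 b3 b6 = 0" "v1 b2 b4 b5 = 0" "v1 b2 b4 b6 = 0" "v1 b2 b5 b6 = 0"
    "v1 b3 b4 b5 = 0" "v1 b3 b4 b6 = 0" "v1 b3 b5 b6 = - \<kappa>" "v1 b4 b5 b6 = 0"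
    unfolding v by (simp_all add: dc Bb blinfun.bilinear_simps dual coord_simps)
  have v2_coords:
    "v2 b1 b2 b3 = 0" "v2 b1 b2 b4 = \<kappa>" "v2 b1 b2 b5 = 0" "v2 b1 b2 b6 = 0"
    "v2 b1 b3 b4 = 0" "v2 b1 b3 b5 = - \<kappa>" "v2 b1 b3 b6 = 0" "v2 b1 b4 b5 = 0"
    "v2 b1 b4 b6 = 0" "v2 b1 b5 b6 = 0" "v2 b2 b3 b4 = 0" "v2 b2 b3 b5 = 0"
    "v2 b2 b3 b6 = 0" "v2 b2 b4 b5 = 0" "v2 b2 b4 b6 = 0" "v2 b2 b5 b6 = 0"
    "v2 b3 b4 b5 = 0" "v2 b3 b4 b6 = 0" "v2 b3 b5 b6 = 0" "v2 b4 b5 b6 = 0"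
    unfolding v by (simp_all add: dc Bb blinfun.bilinear_simps dual coord_simps)
  let ?\<mu> = "\<lambda>\<Omega> :: 'v trilin. \<Omega> b1 b2 b4 + \<Omega> b1 b3 b5 + \<Omega> b2 b3 b6"
  have \<mu>_B: "?\<mu> (derivation B\<^sub>1 \<zeta>) = 0" "?\<mu> (derivation B\<^sub>2 \<zeta>) = 0" "?\<mu> (derivation A\<^sub>0 \<zeta>) = 2"
    by (simp_all add: dc Bb dual coord_simps)
  have \<mu>_B_v: "?\<mu> (derivation B\<^sub>2 v1) = \<kappa>" "?\<mu> (derivation B\<^sub>1 v2) = - \<kappa>"
    by (simp_all add: derivation_apply[OF linear_B(1)] derivation_apply[OF linear_B(2)] Bb v1_coords
        v2_coords
        sort[OF alt_v(1)] sort[OF alt_v(2)])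
  have dtrF: "dtrF B\<^sub>2 v1 = - \<kappa>\<^sup>2" "dtrF B\<^sub>1 v2 = \<kappa>\<^sup>2"
    unfolding dtrF_def trace_frame[OF lin[OF linear_B(2)]] trace_frame[OF lin[OF linear_B(1)]]
    using vol_frame_neq_0
    by (simp_all add: Bb F2_def shuffle23_def v1_coords v2_coords coeff sort[OF alt_v(1)] sort[OF
        alt_v(2)]
        sort[OF alt] dual coord_simps power2_eq_square) (simp_all add: \<kappa>_def field_simps)
  \<comment> \<open>Coefficients \<open>trF B\<^sub>1\<close> and \<open>trF B\<^sub>2\<close>
    vanish at \<zeta>, and the terms with \<open>dtrF A\<^sub>0\<close> vanish under the functional.
    The second derivations contribute \<open>- 2 \<kappa>^2\<close>, the differentiated trace
    coefficients \<open>4 \<kappa>^2\<close>.\<close>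
  have "?\<mu> (lie_bracket (ker_field A\<^sub>0 B\<^sub>1) (ker_field A\<^sub>0 B\<^sub>2) \<zeta>) =
      trF A\<^sub>0 \<zeta> * ?\<mu> (derivation B\<^sub>2 v1) + dtrF A\<^sub>0 v1 * ?\<mu> (derivation B\<^sub>2 \<zeta>)
        - dtrF B\<^sub>2 v1 * ?\<mu> (derivation A\<^sub>0 \<zeta>)
      - (trF A\<^sub>0 \<zeta> * ?\<mu> (derivation B\<^sub>1 v2) + dtrF A\<^sub>0 v2 * ?\<mu> (derivation B\<^sub>1 \<zeta>)
        - dtrF B\<^sub>1 v2 * ?\<mu> (derivation A\<^sub>0 \<zeta>))"
    unfolding lie_bracket_def ker_field_derivative[OF linear_B(1)] ker_field_derivative[OF
        linear_B(2)]
      v1_def[symmetric] v2_def[symmetric] tr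
    by (simp add: blinfun.bilinear_simps algebra_simps)
  also have "\<dots> = 2 * \<kappa>\<^sup>2"
    unfolding \<mu>_B \<mu>_B_v dtrF trF_A\<^sub>0 by (simp add: power2_eq_square)
  finally show ?thesis
    using \<kappa>_neq_0 by (simp add: ker_N_2_iff)
qed

end

section \<open>Involutivity of the distributions\<close>

context orbit
begin

lemma frobenius_im_N:
  "frobenius_integrable (U0 \<alpha>) (im_N \<alpha> \<theta> 1)" "frobenius_integrable (U0 \<alpha>) (im_N \<alpha> \<theta> 2)"
proof -
  have "lie_bracket X Y p \<in> im_N \<alpha> \<theta> k p"
    if W: "open W" "smooth_on W X" "smooth_on W Y"
      and XY: "\<And>p. p \<in> W \<inter> U0 \<alpha> \<Longrightarrow> X p \<in> im_N \<alpha> \<theta> k p" "\<And>p. p \<in> W \<inter> U0 \<alpha> \<Longrightarrow> Y p \<in> im_N \<alpha> \<theta> k p"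
      and p: "p \<in> W" "p \<in> U0 \<alpha>" and k: "k = 1 \<or> k = 2"
    for W X Y p k
  proof -
    obtain b1 b2 b3 b4 b5 b6 \<beta>1 \<beta>2 \<beta>3 \<beta>4 \<beta>5 \<beta>6 where "orbit_frame \<alpha> \<theta> b1 b2 b3 b4 b5 b6 \<beta>1 \<beta>2 \<beta>3 \<beta>4
        \<beta>5 \<beta>6 p"
      using U0_orbit_frame[OF p(2)] .
    then interpret orbit_frame \<alpha> \<theta> b1 b2 b3 b4 b5 b6 \<beta>1 \<beta>2 \<beta>3 \<beta>4 \<beta>5 \<beta>6 p .
    have "im_N \<alpha> \<theta> 2 p \<subseteq> im_N \<alpha> \<theta> 1 p"
      using im_N_2_subset_ker_N_1 ker_N_1_subset_im_N_1 by blast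
    then have "X p \<in> im_N \<alpha> \<theta> 1 p" "Y p \<in> im_N \<alpha> \<theta> 1 p" using XY[of p] p k by auto
    then have "frechet_derivative Y (at p) (X p) \<in> im_N \<alpha> \<theta> k p"
        "frechet_derivative X (at p) (Y p) \<in> im_N \<alpha> \<theta> k p"
      using k im_N_derivative[OF W(1) p(1) W(3)] im_N_derivative[OF W(1) p(1) W(2)] XY by blast+
    then show ?thesis
      unfolding lie_bracket_def by (intro subspace_diff subspace_im_N p(2))
  qed
  then show "frobenius_integrable (U0 \<alpha>) (im_N \<alpha> \<theta> 1)" "frobenius_integrable (U0 \<alpha>) (im_N \<alpha> \<theta> 2)"
    unfolding frobenius_integrable_def by blast+
qed

text \<open>Involutivity of the image leaves a single equation for the bracket; in it the two
  \<open>mixed\<close> terms cancel by symmetry.\<close>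

lemma frobenius_ker_N_1: "frobenius_integrable (U0 \<alpha>) (ker_N \<alpha> \<theta> 1)"
  unfolding frobenius_integrable_def
proof (intro allI impI ballI)
  fix W X Y p
  assume *: "open W \<and> smooth_on W X \<and> smooth_on W Y \<and> (\<forall>p\<in>W \<inter> U0 \<alpha>. X p \<in> ker_N \<alpha> \<theta> 1 p \<and>
      Y p \<in> ker_N \<alpha> \<theta> 1 p)"
    and p: "p \<in> W \<inter> U0 \<alpha>"
  obtain b1 b2 b3 b4 b5 b6 \<beta>1 \<beta>2 \<beta>3 \<beta>4 \<beta>5 \<beta>6 where "orbit_frame \<alpha> \<theta> b1 b2 b3 b4 b5 b6 \<beta>1 \<beta>2 \<beta>3 \<beta>4 \<beta>5
      \<beta>6 p"
    using U0_orbit_frame[of p] p by blast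
  then interpret orbit_frame \<alpha> \<theta> b1 b2 b3 b4 b5 b6 \<beta>1 \<beta>2 \<beta>3 \<beta>4 \<beta>5 \<beta>6 p .
  have sub: "ker_N \<alpha> \<theta> 1 q \<subseteq> im_N \<alpha> \<theta> 1 q" if "q \<in> U0 \<alpha>" for q
    by (rule U0_orbit_frame[OF that]) (rule orbit_frame.ker_N_1_subset_im_N_1)
  have W: "open W" "p \<in> W" "smooth_on W X" "smooth_on W Y" using * p by auto
  have XY: "X q \<in> ker_N \<alpha> \<theta> 1 q" "Y q \<in> ker_N \<alpha> \<theta> 1 q" "X q \<in> im_N \<alpha> \<theta> 1 q" "Y q \<in> im_N \<alpha> \<theta> 1 q"
    if "q \<in> W \<inter> U0 \<alpha>" for q
    using * that sub by blast+
  let ?Z = "lie_bracket X Y p"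
  have Z: "?Z \<in> im_N \<alpha> \<theta> 1 p"
    using frobenius_im_N(1) * p sub unfolding frobenius_integrable_def by blast
  have "N ?Z b4 b5 b6 = N (frechet_derivative Y (at p) (X p)) b4 b5 b6
      - N (frechet_derivative X (at p) (Y p)) b4 b5 b6"
    unfolding lie_bracket_def by (simp add: linear_diff[OF linear_derivation[OF linear_F]]
        blinfun.bilinear_simps)
  also have "\<dots> = 0"
    using ker_N_1_derivative[OF W(1,2,4) XY(3)[OF p] XY(2)] ker_N_1_derivative[OF W(1,2,3) XY(4)[OF
        p] XY(1)]
      mixed_commute[OF XY(3,4)[OF p]] by simp
  finally have "N ?Z b4 b5 b6 = 0" .
  moreover have "alternating ?Z" using Z unfolding im_N_1_iff by blast
  ultimately have "?Z b1 b4 b5 + ?Z b2 b4 b6 + ?Z b3 b5 b6 = 0"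
    using \<kappa>_neq_0 by (simp add: N_coords(20))
  then show "?Z \<in> ker_N \<alpha> \<theta> 1 p"
    using Z unfolding im_N_1_iff ker_N_1_iff by blast
qed

lemma not_frobenius_ker_N_2: "\<not> frobenius_integrable (U0 \<alpha>) (ker_N \<alpha> \<theta> 2)"
proof
  assume *: "frobenius_integrable (U0 \<alpha>) (ker_N \<alpha> \<theta> 2)"
  obtain p where p: "p \<in> U0 \<alpha>" using U0_nonempty by blast
  obtain b1 b2 b3 b4 b5 b6 \<beta>1 \<beta>2 \<beta>3 \<beta>4 \<beta>5 \<beta>6 where "orbit_frame \<alpha> \<theta> b1 b2 b3 b4 b5 b6 \<beta>1 \<beta>2 \<beta>3 \<beta>4 \<beta>5
      \<beta>6 p"
    using U0_orbit_frame[OF p] .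
  then interpret orbit_frame \<alpha> \<theta> b1 b2 b3 b4 b5 b6 \<beta>1 \<beta>2 \<beta>3 \<beta>4 \<beta>5 \<beta>6 p .
  have "lie_bracket (ker_field A\<^sub>0 B\<^sub>1) (ker_field A\<^sub>0 B\<^sub>2) p \<in> ker_N \<alpha> \<theta> 2 p"
    using *[unfolded frobenius_integrable_def, rule_format, of UNIV "ker_field A\<^sub>0 B\<^sub>1"
        "ker_field A\<^sub>0 B\<^sub>2" p]
    by (simp add: smooth_on_ker_field ker_field_in_ker_N linear_A\<^sub>0 linear_B p)
  then show False using bracket_not_in_ker_N_2 by blast
qed

end

theorem proposition6p3:
  fixes \<alpha> :: "nat \<Rightarrow> 'v::euclidean_space \<Rightarrow>\<^sub>L real" and \<theta>\<^sub>0 :: "'v form"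
  assumes "DIM('v) = 6"
    and "dual_basis6 \<alpha>"
    and "\<theta>\<^sub>0 \<in> ext_power 6" and "\<theta>\<^sub>0 \<noteq> (\<lambda>_. 0)"
  shows "smooth_distribution (U0 \<alpha>) (im_N \<alpha> \<theta>\<^sub>0 2) \<and>
     smooth_distribution (U0 \<alpha>) (ker_N \<alpha> \<theta>\<^sub>0 1) \<and>
     smooth_distribution (U0 \<alpha>) (im_N \<alpha> \<theta>\<^sub>0 1) \<and>
     smooth_distribution (U0 \<alpha>) (ker_N \<alpha> \<theta>\<^sub>0 2) \<and>
     (\<forall>\<zeta>\<in>U0 \<alpha>.
        im_N \<alpha> \<theta>\<^sub>0 2 \<zeta> \<subseteq> ker_N \<alpha> \<theta>\<^sub>0 1 \<zeta> \<and>
        ker_N \<alpha> \<theta>\<^sub>0 1 \<zeta> \<subseteq> im_N \<alpha> \<theta>\<^sub>0 1 \<zeta> \<and>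
        im_N \<alpha> \<theta>\<^sub>0 1 \<zeta> \<subseteq> ker_N \<alpha> \<theta>\<^sub>0 2 \<zeta> \<and>
        im_N \<alpha> \<theta>\<^sub>0 2 \<zeta> = distr_D \<alpha> 1 \<zeta> \<and>
        im_N \<alpha> \<theta>\<^sub>0 1 \<zeta> = distr_D \<alpha> 2 \<zeta>) \<and>
     frobenius_integrable (U0 \<alpha>) (im_N \<alpha> \<theta>\<^sub>0 2) \<and>
     frobenius_integrable (U0 \<alpha>) (ker_N \<alpha> \<theta>\<^sub>0 1) \<and>
     frobenius_integrable (U0 \<alpha>) (im_N \<alpha> \<theta>\<^sub>0 1) \<and>
     \<not> frobenius_integrable (U0 \<alpha>) (ker_N \<alpha> \<theta>\<^sub>0 2)"
proof -
  interpret orbit \<alpha> \<theta>\<^sub>0 by unfold_locales (fact assms)+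
  have "im_N \<alpha> \<theta>\<^sub>0 2 \<zeta> \<subseteq> ker_N \<alpha> \<theta>\<^sub>0 1 \<zeta> \<and>
      ker_N \<alpha> \<theta>\<^sub>0 1 \<zeta> \<subseteq> im_N \<alpha> \<theta>\<^sub>0 1 \<zeta> \<and>
      im_N \<alpha> \<theta>\<^sub>0 1 \<zeta> \<subseteq> ker_N \<alpha> \<theta>\<^sub>0 2 \<zeta> \<and>
      im_N \<alpha> \<theta>\<^sub>0 2 \<zeta> = distr_D \<alpha> 1 \<zeta> \<and>
      im_N \<alpha> \<theta>\<^sub>0 1 \<zeta> = distr_D \<alpha> 2 \<zeta>" if \<zeta>: "\<zeta> \<in> U0 \<alpha>" for \<zeta>
  proof -
    obtain b1 b2 b3 b4 b5 b6 \<beta>1 \<beta>2 \<beta>3 \<beta>4 \<beta>5 \<beta>6 where "orbit_frame \<alpha> \<theta>\<^sub>0 b1 b2 b3 b4 b5 b6 \<beta>1 \<beta>2 \<beta>3 \<beta>4 \<beta>5 \<beta>6 \<zeta>"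
      using U0_orbit_frame[OF \<zeta>] .
    then interpret orbit_frame \<alpha> \<theta>\<^sub>0 b1 b2 b3 b4 b5 b6 \<beta>1 \<beta>2 \<beta>3 \<beta>4 \<beta>5 \<beta>6 \<zeta> .
    show ?thesis
      using im_N_2_subset_ker_N_1 ker_N_1_subset_im_N_1 im_N_1_subset_ker_N_2 distr_D_eq by blast
  qed
  then show ?thesis
    using smooth_distributions frobenius_im_N frobenius_ker_N_1 not_frobenius_ker_N_2 by blast
qed

end
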